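(* Let $X$ be a non-trivial complex Banach space, $n\in\mathbb{N}$, and let $A=[a_{ij}]_{1\le i,j\le n}$ be a complex matrix with $\sigma(A)\subseteq\{z\in\mathbb{C}:\Re z<0\}$. Below, "resp." separates the asymptotically almost periodic version and the asymptotically almost automorphic version. (i) Let $F=[F_1\ F_2\cdots F_n]^T\in B'_{AAP}(X^n)$, resp. $F=[F_1\ F_2\cdots F_n]^T\in B'_{AAA}(X^n)$. Then there exists a solution $Y=[Y_1\ Y_2\cdots Y_n]^T\in B'_{AAP}(X^n)$, resp. $Y=[Y_1\ Y_2\cdots Y_n]^T\in B'_{AAA}(X^n)$, of $$Y'=AY+F,\quad Y\in\mathcal{D}'(X^n),\ \text{ on }[0,\infty).$$ Furthermore, any distributional solution $Y$ of this equation belongs to the space $B'_{AAP}(X^n)$, resp. $B'_{AAA}(X^n)$. (ii) Let $(M_p)_{p\in\mathbb{N}_0}$ be a sequence of positive reals with $M_0=1$ satisfying (M.1), (M.2) and (M.3'), let $*$ be either $(M_p)$ or $\{M_p\}$, and let $F=[F_1\ F_2\cdots F_n]^T\in\mathcal{D}^{\prime *}_{L^1}(M_p:X^n)$ be such that for every $i\in\{1,\dots,n\}$ there exist an ultradifferential operator $P_i(D)=\sum_{p=0}^\infty a_{i,p}D^p$ of $*$-class and bounded functions $f_{1,i},f_{2,i}\in AAP(\mathbb{R}:X)$, resp. $f_{1,i},f_{2,i}\in AAA(\mathbb{R}:X)$, such that $F_i=P_i(D)f_{1,i}+f_{2,i}$ on $[0,\infty)$. Then there exist ultradifferential operators $P_{ij}(D)$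 of $*$-class, bounded functions $h_{ij}\in AAP(\mathbb{R}:X)$, resp. $h_{ij}\in AAA(\mathbb{R}:X)$ ($1\le i,j\le n$), and bounded functions $h_{2,i}\in AAP(\mathbb{R}:X)$, resp. $h_{2,i}\in AAA(\mathbb{R}:X)$ ($1\le i\le n$), such that $Y=[Y_1\ Y_2\cdots Y_n]^T\in B^{\prime *}_{AAP}(X^n)$, resp. $Y=[Y_1\ Y_2\cdots Y_n]^T\in B^{\prime *}_{AAA}(X^n)$, is a solution of $$Y'=AY+F,\quad Y\in\mathcal{D}^{\prime *}(X^n),\ \text{ on }[0,\infty),$$ where $Y_i=\sum_{j=1}^nP_{ij}(D)h_{ij}+h_{2,i}$ for $1\le i\le n$. Furthermore, any ultradistributional solution $Y$ of $*$-class to this equation has such a form.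
   Context: Let $E$ denote a complex Banach space ($E=X$ or $E=X^n$ with any standard product norm); an $X^n$-valued (ultra)distribution is identified with the $n$-tuple of its components. **Distributions.** $\mathcal{D}$: complex-valued compactly supported smooth functions on $\mathbb{R}$; $\mathcal{D}_0:=\{\varphi\in\mathcal{D}:\operatorname{supp}\varphi\subseteq[0,\infty)\}$; $\mathcal{D}'(E)$: continuous linear maps $\mathcal{D}\to E$. $\mathcal{D}_{L^1}$: Fréchet space of $f\in C^\infty(\mathbb{R})$ with all $f^{(j)}\in L^1(\mathbb{R})$, seminorms $\sum_{j\le k}\|f^{(j)}\|_{L^1}$; $\mathcal{D}'_{L^1}(E)$: continuous linear maps $\mathcal{D}_{L^1}\to E$. **Ultradistributions.** (M.1): $M_p^2\le M_{p+1}M_{p-1}$, $p\in\mathbb{N}$. (M.2): $M_p\le aH^p\sup_{0\le i\le p}M_iM_{p-i}$, $p\in\mathbb{N}$, for some constants $a,H>1$. (M.3'): $\sum_{p\ge1}M_{p-1}/M_p<\infty$. $*$ stands for $(M_p)$ (Beurling) or $\{M_p\}$ (Roumieu). For compact $K$ and $h>0$, $\mathcal{D}^{M_p,h}_K$ is the space of $\phi\in C^\infty(\mathbb{R})$ with $\operatorname{supp}\phi\subseteq K$ and finite norm $\sup\{h^p|\phi^{(p)}(t)|/M_p:t\in K,p\ge0\}$; $\mathcal{D}^{(M_p)}_K$ is the projective limit as $h\to\infty$, $\mathcal{D}^{\{M_p\}}_K$ the inductive limit as $h\to0$; $\mathcal{D}^*$ is the inductive limit of $\mathcal{D}^*_K$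 over compact $K$; $\mathcal{D}^*_0:=\{\varphi\in\mathcal{D}^*:\operatorname{supp}\varphi\subseteq[0,\infty)\}$; $\mathcal{D}^{\prime *}(E)$: continuous linear maps $\mathcal{D}^*\to E$. $\mathcal{D}_{L^1}((M_p),h):=\{f\in\mathcal{D}_{L^1}:\sup_{p\ge0}h^p\|f^{(p)}\|_1/M_p<\infty\}$; $\mathcal{D}_{L^1}((M_p))$ is the projective limit as $h\to\infty$, $\mathcal{D}_{L^1}(\{M_p\})$ the inductive limit as $h\to0+$; $\mathcal{D}^{\prime *}_{L^1}(M_p:E)$ is the space of continuous linear maps from $\mathcal{D}_{L^1}((M_p))$, resp. $\mathcal{D}_{L^1}(\{M_p\})$, to $E$. $P(D)=\sum_{p\ge0}a_pD^p$ is an ultradifferential operator of class $(M_p)$, resp. $\{M_p\}$, if for some $l>0$ and $C>0$, resp. for every $l>0$ and some $C>0$ depending on $l$, $|a_p|\le Cl^p/M_p$ for $p\in\mathbb{N}$; here $D=d/dx$. **Conventions.** Functions are identified with regular (ultra)distributions. Equality "on $[0,\infty)$" means equality when tested on all of $\mathcal{D}_0$, resp. $\mathcal{D}^*_0$. A solution of the equation is any element of $\mathcal{D}'(X^n)$, resp. $\mathcal{D}^{\prime *}(X^n)$, for which the equation holds in the distributional, resp. ultradistributional, sense on $[0,\infty)$. $(T*\varphi)(x)=\langle T,\varphi(x-\cdot)\rangle$, $\langle T_h,\varphi\rangle:=\langle T,\varphi(\cdot-h)\rangle$. **Functions.** A continuous $f:\mathbb{R}\to E$ is almost periodic ($AP(\mathbb{R}:E)$)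 if for each $\epsilon>0$ the set of $\tau>0$ with $\|f(t+\tau)-f(t)\|\le\epsilon$ for all $t\in\mathbb{R}$ is relatively dense in $\mathbb{R}$, i.e. meets every interval of some fixed length $l>0$ (for $\tau>0$ and $\tau<0$ alike, $\tau$ and $-\tau$ being $\epsilon$-periods simultaneously). A bounded continuous $f:\mathbb{R}\to E$ is almost automorphic ($AA(\mathbb{R}:E)$) if every real sequence $(b_n)$ has a subsequence $(a_n)$ and there is $g:\mathbb{R}\to E$ with $\lim_nf(t+a_n)=g(t)$, $\lim_ng(t-a_n)=f(t)$ pointwise on $\mathbb{R}$. $AAP(\mathbb{R}:E)$, resp. $AAA(\mathbb{R}:E)$: continuous $f:\mathbb{R}\to E$ with $f=g+q$ on $[0,\infty)$ for some $g\in AP(\mathbb{R}:E)$, resp. $AA(\mathbb{R}:E)$, and some continuous $q:[0,\infty)\to E$ vanishing at $+\infty$. **Classes.** $B'_{+,0}(E)$: those $T\in\mathcal{D}'_{L^1}(E)$ with $\lim_{h\to+\infty}\langle T_h,\varphi\rangle=0$ for all $\varphi\in\mathcal{D}$. $B'_{AP}(E)$, resp. $B'_{AA}(E)$: those $T\in\mathcal{D}'_{L^1}(E)$ with $T*\varphi\in AP(\mathbb{R}:E)$, resp. $AA(\mathbb{R}:E)$, for all $\varphi\in\mathcal{D}$. $B'_{AAP}(E)$, resp. $B'_{AAA}(E)$: those $T\in\mathcal{D}'_{L^1}(E)$ for which there are $T_1\in B'_{AP}(E)$, resp. $B'_{AA}(E)$, and $Q\in B'_{+,0}(E)$ with $T=T_1+Q$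 on $[0,\infty)$. The spaces $B^{\prime *}_{+,0}(E)$, $B^{\prime *}_{AP}(E)$, $B^{\prime *}_{AA}(E)$, $B^{\prime *}_{AAP}(E)$, $B^{\prime *}_{AAA}(E)$ are defined identically with $\mathcal{D}'_{L^1}(E)$, $\mathcal{D}$, $\mathcal{D}_0$ replaced by $\mathcal{D}^{\prime *}_{L^1}(M_p:E)$, $\mathcal{D}^*$, $\mathcal{D}^*_0$.
   Formalization: As solutions are arbitrary on (-∞,0), "any solution belongs to the class / has such a form" is false literally; it is proved that any solution equals on [0,∞) a member of the class (of the stated form), and lies in the class itself if it is in D'_{L^1}, resp. D'*_{L^1}. *)

theory Defs
  imports "HOL-Analysis.Analysis"
begin

section \<open>Complex Banach spaces\<close>

class complex_banach = banach +
  fixes scaleC :: "complex \<Rightarrow> 'a \<Rightarrow> 'a" (infixr \<open>*\<^sub>C\<close> 75)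
  assumes scaleC_add_right: "c *\<^sub>C (x + y) = c *\<^sub>C x + c *\<^sub>C y"
    and scaleC_add_left: "(c + d) *\<^sub>C x = c *\<^sub>C x + d *\<^sub>C x"
    and scaleC_scaleC: "c *\<^sub>C d *\<^sub>C x = (c * d) *\<^sub>C x"
    and scaleR_scaleC: "scaleR r x = complex_of_real r *\<^sub>C x"
    and norm_scaleC: "norm (c *\<^sub>C x) = cmod c * norm x"

instantiation complex :: complex_banach
begin
definition scaleC_complex :: "complex \<Rightarrow> complex \<Rightarrow> complex" where
  "scaleC_complex c x = c * x"
instance
  by standard (simp_all add: scaleC_complex_def algebra_simps scaleR_conv_of_real norm_mult)
end

text \<open>The product space \<open>X\<^sup>n\<close> is \<^typ>\<open>'a ^ 'n\<close> with the Euclidean product norm.\<close>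

instantiation vec :: (complex_banach, finite) complex_banach
begin
definition scaleC_vec :: "complex \<Rightarrow> 'a ^ 'b \<Rightarrow> 'a ^ 'b" where
  "scaleC_vec c x = (\<chi> i. c *\<^sub>C x $ i)"
instance
proof
  fix c :: complex and x :: "'a ^ 'b"
  show "norm (c *\<^sub>C x) = cmod c * norm x"
    by (simp add: scaleC_vec_def norm_vec_def norm_scaleC L2_set_right_distrib)
qed (simp_all add: scaleC_vec_def vec_eq_iff scaleC_add_right scaleC_add_left
      scaleC_scaleC scaleR_scaleC)
end

definition mat_act :: "complex ^ 'n ^ 'm \<Rightarrow> 'a::complex_banach ^ 'n \<Rightarrow> 'a ^ 'm" where
  "mat_act A y = (\<chi> i. \<Sum>j\<in>UNIV. A $ i $ j *\<^sub>C y $ j)"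

definition mat_spectrum :: "complex ^ 'n ^ 'n \<Rightarrow> complex set" where
  "mat_spectrum A = {z. \<not> invertible (mat z - A)}"

section \<open>Locally convex function spaces\<close>

text \<open>A locally convex space of functions is a carrier together with a family of seminorms
  generating its topology. Seminorms, and later functionals, are total in HOL; only their values
  on the carrier matter.\<close>

type_synonym lcs = "(real \<Rightarrow> complex) set \<times> ((real \<Rightarrow> complex) \<Rightarrow> real) set"

abbreviation carrier :: "lcs \<Rightarrow> (real \<Rightarrow> complex) set" where
  "carrier S \<equiv> fst S"

definition lc_topology :: "lcs \<Rightarrow> (real \<Rightarrow> complex) topology" where
  "lc_topology S = topology (\<lambda>U. U \<subseteq> carrier S \<and>
     (\<forall>f\<in>U. \<exists>Q e. finite Q \<and> Q \<subseteq> snd S \<and> 0 < e \<and>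
        {g \<in> carrier S. \<forall>p\<in>Q. p (\<lambda>t. g t - f t) < e} \<subseteq> U))"

lemma openin_lc_topology:
  "openin (lc_topology S) U \<longleftrightarrow> U \<subseteq> carrier S \<and>
     (\<forall>f\<in>U. \<exists>Q e. finite Q \<and> Q \<subseteq> snd S \<and> 0 < e \<and>
        {g \<in> carrier S. \<forall>p\<in>Q. p (\<lambda>t. g t - f t) < e} \<subseteq> U)"
proof -
  define N where "N f U \<longleftrightarrow> (\<exists>Q e. finite Q \<and> Q \<subseteq> snd S \<and> 0 < e \<and>
      {g \<in> carrier S. \<forall>p\<in>Q. p (\<lambda>t. g t - f t) < e} \<subseteq> U)" for f U
  have inter: "N f (U \<inter> V)" if "N f U" "N f V" for f U V
  proof -
    obtain Q d where Q: "finite Q" "Q \<subseteq> snd S" "0 < d"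
        "{g \<in> carrier S. \<forall>p\<in>Q. p (\<lambda>t. g t - f t) < d} \<subseteq> U"
      using \<open>N f U\<close> unfolding N_def by (elim exE conjE)
    obtain R e where R: "finite R" "R \<subseteq> snd S" "0 < e"
        "{g \<in> carrier S. \<forall>p\<in>R. p (\<lambda>t. g t - f t) < e} \<subseteq> V"
      using \<open>N f V\<close> unfolding N_def by (elim exE conjE)
    have "{g \<in> carrier S. \<forall>p\<in>Q \<union> R. p (\<lambda>t. g t - f t) < min d e} \<subseteq> U \<inter> V"
      using Q(4) R(4) by (simp add: subset_iff)
    then show ?thesis
      unfolding N_def using Q(1-3) R(1-3)
      by (intro exI[of _ "Q \<union> R"] exI[of _ "min d e"] conjI) simp_all
  qed
  have mono: "N f V" if "N f U" "U \<subseteq> V" for f U V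
    using \<open>N f U\<close> unfolding N_def by (meson \<open>U \<subseteq> V\<close> subset_trans)
  have "istopology (\<lambda>U. U \<subseteq> carrier S \<and> (\<forall>f\<in>U. N f U))"
    unfolding istopology_def
  proof (rule conjI)
    show "\<forall>U V. U \<subseteq> carrier S \<and> (\<forall>f\<in>U. N f U) \<longrightarrow> V \<subseteq> carrier S \<and> (\<forall>f\<in>V. N f V) \<longrightarrow>
        U \<inter> V \<subseteq> carrier S \<and> (\<forall>f\<in>U \<inter> V. N f (U \<inter> V))"
      using inter by (simp add: le_infI1)
    show "\<forall>\<K>. (\<forall>U\<in>\<K>. U \<subseteq> carrier S \<and> (\<forall>f\<in>U. N f U)) \<longrightarrow>
        \<Union>\<K> \<subseteq> carrier S \<and> (\<forall>f\<in>\<Union>\<K>. N f (\<Union>\<K>))"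
      by (meson Sup_le_iff Sup_upper UnionE mono)
  qed
  then show ?thesis
    unfolding lc_topology_def N_def by (simp only: topology_inverse')
qed

definition seminorm_on :: "(real \<Rightarrow> complex) set \<Rightarrow> ((real \<Rightarrow> complex) \<Rightarrow> real) \<Rightarrow> bool" where
  "seminorm_on V p \<longleftrightarrow>
     (\<forall>f\<in>V. \<forall>g\<in>V. p (\<lambda>t. f t + g t) \<le> p f + p g) \<and>
     (\<forall>c. \<forall>f\<in>V. p (\<lambda>t. c * f t) = cmod c * p f)"

definition proj_limit :: "'i set \<Rightarrow> ('i \<Rightarrow> lcs) \<Rightarrow> lcs" where
  "proj_limit I S = (\<Inter>i\<in>I. carrier (S i), \<Union>i\<in>I. snd (S i))"

text \<open>The inductive limit carries the finest locally convex topology making all inclusions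
  continuous, which is generated by all seminorms with continuous restrictions.\<close>

definition ind_limit :: "'i set \<Rightarrow> ('i \<Rightarrow> lcs) \<Rightarrow> lcs" where
  "ind_limit I S =
     (let V = (\<Union>i\<in>I. carrier (S i))
      in (V, {p. seminorm_on V p \<and> (\<forall>i\<in>I. continuous_map (lc_topology (S i)) euclideanreal p)}))"

text \<open>A functional is not required to take any particular value outside the carrier, so it is
  determined by an element of the dual only up to its values there. Consequently the dual of a
  space is contained in the dual of every continuously included subspace.\<close>

definition dual :: "lcs \<Rightarrow> ((real \<Rightarrow> complex) \<Rightarrow> 'e::complex_banach) set" where
  "dual S = {T.
     (\<forall>f\<in>carrier S. \<forall>g\<in>carrier S. T (\<lambda>t. f t + g t) = T f + T g) \<and>
     (\<forall>c. \<forall>f\<in>carrier S. T (\<lambda>t. c * f t) = c *\<^sub>C T f) \<and>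
     continuous_map (lc_topology S) euclidean T}"

section \<open>Test function spaces\<close>

definition nderiv :: "nat \<Rightarrow> (real \<Rightarrow> complex) \<Rightarrow> real \<Rightarrow> complex" where
  "nderiv k = (\<lambda>f t. vector_derivative f (at t)) ^^ k"

definition smooth :: "(real \<Rightarrow> complex) \<Rightarrow> bool" where
  "smooth f \<longleftrightarrow> (\<forall>k t. nderiv k f differentiable (at t))"

definition supp :: "(real \<Rightarrow> complex) \<Rightarrow> real set" where
  "supp f = closure {t. f t \<noteq> 0}"

definition positive_part :: "lcs \<Rightarrow> (real \<Rightarrow> complex) set" where
  "positive_part S = {\<phi> \<in> carrier S. supp \<phi> \<subseteq> {0..}}"

definition L1_norm :: "(real \<Rightarrow> complex) \<Rightarrow> real" where
  "L1_norm f = (\<integral>t. cmod (f t) \<partial>lborel)"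

definition test_space_on :: "real set \<Rightarrow> lcs" where
  "test_space_on K = ({\<phi>. smooth \<phi> \<and> supp \<phi> \<subseteq> K},
     {\<lambda>\<phi>. SUP t. cmod (nderiv k \<phi> t) |k. True})"

definition test_space :: lcs where
  "test_space = ind_limit {K. compact K} test_space_on"

definition DL1_space :: lcs where
  "DL1_space = ({f. smooth f \<and> (\<forall>j. integrable lborel (nderiv j f))},
     {\<lambda>f. \<Sum>j\<le>k. L1_norm (nderiv j f) |k. True})"

subsection \<open>Ultradifferentiable test functions\<close>

definition cond_M1 :: "(nat \<Rightarrow> real) \<Rightarrow> bool" where
  "cond_M1 M \<longleftrightarrow> (\<forall>p\<ge>1. (M p)\<^sup>2 \<le> M (p + 1) * M (p - 1))"

text \<open>Stability is stated with a supremum. When \<open>M 0 = 1\<close> it is then implied by the more common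
  variant with an infimum (and holds for every positive sequence), so results assuming the
  condition below cover that variant as well.\<close>

definition cond_M2 :: "(nat \<Rightarrow> real) \<Rightarrow> bool" where
  "cond_M2 M \<longleftrightarrow> (\<exists>a>1. \<exists>H>1. \<forall>p\<ge>1. M p \<le> a * H ^ p * (SUP i\<in>{0..p}. M i * M (p - i)))"

definition cond_M3' :: "(nat \<Rightarrow> real) \<Rightarrow> bool" where
  "cond_M3' M \<longleftrightarrow> summable (\<lambda>p. M p / M (Suc p))"

datatype ultra_class = Beurling | Roumieu

definition ultra_norm :: "(nat \<Rightarrow> real) \<Rightarrow> real set \<Rightarrow> real \<Rightarrow> (real \<Rightarrow> complex) \<Rightarrow> real" where
  "ultra_norm M K h \<phi> = (SUP (p, t)\<in>UNIV \<times> K. h ^ p * cmod (nderiv p \<phi> t) / M p)"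

definition ultra_test_space_h :: "(nat \<Rightarrow> real) \<Rightarrow> real set \<Rightarrow> real \<Rightarrow> lcs" where
  "ultra_test_space_h M K h =
     ({\<phi>. smooth \<phi> \<and> supp \<phi> \<subseteq> K \<and>
          bdd_above ((\<lambda>(p, t). h ^ p * cmod (nderiv p \<phi> t) / M p) ` (UNIV \<times> K))},
      {ultra_norm M K h})"

fun ultra_limit :: "ultra_class \<Rightarrow> (real \<Rightarrow> lcs) \<Rightarrow> lcs" where
  "ultra_limit Beurling S = proj_limit {0<..} S"
| "ultra_limit Roumieu S = ind_limit {0<..} S"

definition ultra_test_space :: "ultra_class \<Rightarrow> (nat \<Rightarrow> real) \<Rightarrow> lcs" where
  "ultra_test_space s M =
     ind_limit {K. compact K} (\<lambda>K. ultra_limit s (ultra_test_space_h M K))"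

definition ultra_DL1_space_h :: "(nat \<Rightarrow> real) \<Rightarrow> real \<Rightarrow> lcs" where
  "ultra_DL1_space_h M h =
     ({f \<in> carrier DL1_space. bdd_above (range (\<lambda>p. h ^ p * L1_norm (nderiv p f) / M p))},
      {\<lambda>f. SUP p. h ^ p * L1_norm (nderiv p f) / M p})"

definition ultra_DL1_space :: "ultra_class \<Rightarrow> (nat \<Rightarrow> real) \<Rightarrow> lcs" where
  "ultra_DL1_space s M = ultra_limit s (ultra_DL1_space_h M)"

section \<open>Operations on (ultra)distributions\<close>

definition dist_deriv ::
    "((real \<Rightarrow> complex) \<Rightarrow> 'e::complex_banach) \<Rightarrow> (real \<Rightarrow> complex) \<Rightarrow> 'e" where
  "dist_deriv T \<phi> = - T (nderiv 1 \<phi>)"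

text \<open>The Henstock--Kurzweil integral is used for vector-valued functions because the Bochner
  integral of the library requires a second countable range.\<close>

definition regular :: "(real \<Rightarrow> 'e::complex_banach) \<Rightarrow> (real \<Rightarrow> complex) \<Rightarrow> 'e" where
  "regular f \<phi> = integral UNIV (\<lambda>t. \<phi> t *\<^sub>C f t)"

definition convolution ::
    "((real \<Rightarrow> complex) \<Rightarrow> 'e::complex_banach) \<Rightarrow> (real \<Rightarrow> complex) \<Rightarrow> real \<Rightarrow> 'e" where
  "convolution T \<phi> x = T (\<lambda>t. \<phi> (x - t))"

definition translate ::
    "real \<Rightarrow> ((real \<Rightarrow> complex) \<Rightarrow> 'e::complex_banach) \<Rightarrow> (real \<Rightarrow> complex) \<Rightarrow> 'e" where
  "translate h T \<phi> = T (\<lambda>t. \<phi> (t - h))"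

fun ultradiff_coeffs :: "ultra_class \<Rightarrow> (nat \<Rightarrow> real) \<Rightarrow> (nat \<Rightarrow> complex) \<Rightarrow> bool" where
  "ultradiff_coeffs Beurling M a \<longleftrightarrow> (\<exists>l>0. \<exists>C>0. \<forall>p. cmod (a p) \<le> C * l ^ p / M p)"
| "ultradiff_coeffs Roumieu M a \<longleftrightarrow> (\<forall>l>0. \<exists>C>0. \<forall>p. cmod (a p) \<le> C * l ^ p / M p)"

definition ultradiff ::
    "(nat \<Rightarrow> complex) \<Rightarrow> ((real \<Rightarrow> complex) \<Rightarrow> 'e::complex_banach) \<Rightarrow> (real \<Rightarrow> complex) \<Rightarrow> 'e" where
  "ultradiff a T \<phi> = (\<Sum>p. a p *\<^sub>C (dist_deriv ^^ p) T \<phi>)"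

section \<open>Almost periodic and almost automorphic functions\<close>

definition relatively_dense :: "real set \<Rightarrow> bool" where
  "relatively_dense S \<longleftrightarrow> (\<exists>l>0. \<forall>a. S \<inter> {a..a + l} \<noteq> {})"

text \<open>Since \<open>\<tau>\<close> and \<open>- \<tau>\<close> are \<open>\<epsilon>\<close>-periods simultaneously, the positive periods are taken
  together with their negatives, so that intervals on the negative half-line are met as well.\<close>

definition AP :: "(real \<Rightarrow> 'e::complex_banach) set" where
  "AP = {f. continuous_on UNIV f \<and>
     (\<forall>\<epsilon>>0. relatively_dense {\<tau>. \<tau> \<noteq> 0 \<and> (\<forall>t. norm (f (t + \<tau>) - f t) \<le> \<epsilon>)})}"

definition AA :: "(real \<Rightarrow> 'e::complex_banach) set" where
  "AA = {f. continuous_on UNIV f \<and> bounded (range f) \<and>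
     (\<forall>b :: nat \<Rightarrow> real. \<exists>r g. strict_mono r \<and>
        (\<forall>t. (\<lambda>n. f (t + b (r n))) \<longlonglongrightarrow> g t) \<and>
        (\<forall>t. (\<lambda>n. g (t - b (r n))) \<longlonglongrightarrow> f t))}"

datatype almost_kind = Periodic | Automorphic

fun almost :: "almost_kind \<Rightarrow> (real \<Rightarrow> 'e::complex_banach) set" where
  "almost Periodic = AP"
| "almost Automorphic = AA"

text \<open>\<open>AAP\<close>, respectively \<open>AAA\<close>.\<close>

definition asymp_almost :: "almost_kind \<Rightarrow> (real \<Rightarrow> 'e::complex_banach) set" where
  "asymp_almost \<kappa> = {f. continuous_on UNIV f \<and>
     (\<exists>g\<in>almost \<kappa>. \<exists>q. continuous_on {0..} q \<and> (q \<longlongrightarrow> 0) at_top \<and>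
        (\<forall>t\<ge>0. f t = g t + q t))}"

section \<open>The distribution classes\<close>

text \<open>Each class takes the test space \<open>S\<close> and the integrable test space \<open>L\<close>, to be instantiated
  with \<^const>\<open>test_space\<close> and \<^const>\<open>DL1_space\<close>, or with \<^const>\<open>ultra_test_space\<close> and
  \<^const>\<open>ultra_DL1_space\<close>.\<close>

definition eq_on_positive ::
    "lcs \<Rightarrow> ((real \<Rightarrow> complex) \<Rightarrow> 'e) \<Rightarrow> ((real \<Rightarrow> complex) \<Rightarrow> 'e) \<Rightarrow> bool" where
  "eq_on_positive S T U \<longleftrightarrow> (\<forall>\<phi>\<in>positive_part S. T \<phi> = U \<phi>)"

definition B_plus0 :: "lcs \<Rightarrow> lcs \<Rightarrow> ((real \<Rightarrow> complex) \<Rightarrow> 'e::complex_banach) set" where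
  "B_plus0 S L = {T \<in> dual L. \<forall>\<phi>\<in>carrier S. ((\<lambda>h. translate h T \<phi>) \<longlongrightarrow> 0) at_top}"

definition B_almost ::
    "almost_kind \<Rightarrow> lcs \<Rightarrow> lcs \<Rightarrow> ((real \<Rightarrow> complex) \<Rightarrow> 'e::complex_banach) set" where
  "B_almost \<kappa> S L = {T \<in> dual L. \<forall>\<phi>\<in>carrier S. convolution T \<phi> \<in> almost \<kappa>}"

definition B_asymp ::
    "almost_kind \<Rightarrow> lcs \<Rightarrow> lcs \<Rightarrow> ((real \<Rightarrow> complex) \<Rightarrow> 'e::complex_banach) set" where
  "B_asymp \<kappa> S L = {T \<in> dual L. \<exists>T1\<in>B_almost \<kappa> S L. \<exists>Q\<in>B_plus0 S L.
     eq_on_positive S T (\<lambda>\<phi>. T1 \<phi> + Q \<phi>)}"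

section \<open>The differential system\<close>

text \<open>The system is tested with functions supported in \<open>[0, \<infinity>)\<close> only, so the restriction of a
  solution to \<open>(-\<infinity>, 0)\<close> is arbitrary. Accordingly an arbitrary solution can be described only
  up to \<^const>\<open>eq_on_positive\<close>, the equality under which asymptotic classes are defined.\<close>

definition solution ::
    "lcs \<Rightarrow> complex ^ 'n ^ 'n \<Rightarrow> ((real \<Rightarrow> complex) \<Rightarrow> 'a::complex_banach ^ 'n)
      \<Rightarrow> ((real \<Rightarrow> complex) \<Rightarrow> 'a ^ 'n) \<Rightarrow> bool" where
  "solution S A F Y \<longleftrightarrow> Y \<in> dual S \<and>
     eq_on_positive S (dist_deriv Y) (\<lambda>\<phi>. mat_act A (Y \<phi>) + F \<phi>)"

text \<open>\<open>Y\<^sub>i = \<Sum>\<^sub>j P\<^sub>i\<^sub>j(D) h\<^sub>i\<^sub>j + h\<^sub>2\<^sub>,\<^sub>i\<close> as ultradistributions, for all \<open>i\<close>.\<close>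

definition ultra_form ::
    "almost_kind \<Rightarrow> ultra_class \<Rightarrow> (nat \<Rightarrow> real)
      \<Rightarrow> ((real \<Rightarrow> complex) \<Rightarrow> 'a::complex_banach ^ 'n) \<Rightarrow> bool" where
  "ultra_form \<kappa> s M Y \<longleftrightarrow>
     (\<exists>(P :: 'n \<Rightarrow> 'n \<Rightarrow> nat \<Rightarrow> complex) (h :: 'n \<Rightarrow> 'n \<Rightarrow> real \<Rightarrow> 'a) (h2 :: 'n \<Rightarrow> real \<Rightarrow> 'a).
        (\<forall>i j. ultradiff_coeffs s M (P i j)) \<and>
        (\<forall>i j. h i j \<in> asymp_almost \<kappa> \<and> bounded (range (h i j))) \<and>
        (\<forall>i. h2 i \<in> asymp_almost \<kappa> \<and> bounded (range (h2 i))) \<and>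
        (\<forall>\<phi>\<in>carrier (ultra_test_space s M). \<forall>i.
           Y \<phi> $ i = (\<Sum>j\<in>UNIV. ultradiff (P i j) (regular (h i j)) \<phi>) + regular (h2 i) \<phi>))"

end

theory Submission
  imports Defs "HOL-Computational_Algebra.Fundamental_Theorem_Algebra"
begin

text \<open>Everything rests on the scalar equation \<open>u' = \<mu> u + f\<close> with \<open>Re \<mu> < 0\<close>.

From the matrix to scalars: the powers of \<open>A\<close> are linearly dependent, so some polynomial annihilates
\<open>A\<close>. It splits into linear factors \<open>A - \<mu>\<^sub>k\<close>, and those with \<open>Re \<mu>\<^sub>k \<ge> 0\<close> are injective and can be
cancelled. There remains a product \<open>\<Prod>\<^sub>k (A - \<mu>\<^sub>k) = 0\<close> with \<open>Re \<mu>\<^sub>k < 0\<close> for all \<open>k\<close>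
(\<open>stable_matrix_annihilated\<close>). A solution of the system is built along this product by solving scalar
equations one after another. Conversely, if \<open>Y' = A Y + F\<close> then \<open>W = (A - \<mu>) Y\<close> satisfies a system of
the same kind and \<open>Y' = \<mu> Y + (W + F)\<close>, so membership of \<open>Y\<close> in a class follows, factor by factor,
from the membership of \<open>0\<close>. The locale \<open>solvable_class\<close> collects what this argument needs from a class
of functionals, and the distributional and ultradistributional cases are instances of it.

All solutions of the scalar equation: multiplying test functions by \<open>exp (- \<mu> t)\<close> turns \<open>u' = \<mu> u\<close>
into \<open>v' = 0\<close>. Then \<open>v\<close> vanishes on derivatives of test functions supported in \<open>[0, \<infinity>)\<close>, that is, on
test functions with integral \<open>0\<close>, so \<open>v\<close> is constant and \<open>u = c exp (\<mu> t)\<close>, which decays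
(\<open>exponential_if_eigenfunctional\<close>).

One good solution of the scalar equation: for bounded continuous \<open>h\<close> on the line, \<open>v' = \<mu> v + h\<close> has
exactly one bounded solution, and
\<open>\<bar>v t\<bar> \<le> \<integral>\<^sub>0\<^sup>\<infinity> exp (Re \<mu> s) \<bar>h (t - s)\<bar> ds\<close> (\<open>bounded_solution_estimate\<close>). Applied to differences of
translates, this one estimate carries almost periodicity and almost automorphy from \<open>h\<close> to \<open>v\<close>
(\<open>almost_transfer\<close>), and applied to \<open>h\<close> itself it carries decay at \<open>+\<infinity>\<close>. Since only norms are
integrated, dominated convergence for real functions is enough, also when the limit functions in the
definition of almost automorphy are discontinuous.

For a distribution \<open>T\<close> the function \<open>x \<mapsto> \<langle>T\<^sub>x, \<phi>\<rangle>\<close> is bounded and smooth, and the value at \<open>0\<close> of the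
bounded solution with this forcing defines the solution functional (\<open>resolvent\<close>). For an
ultradistribution \<open>\<Sum>\<^sub>j P\<^sub>j(D) f\<^sub>j\<close> the operators commute with the equation, so each \<open>f\<^sub>j\<close> is replaced by its
bounded solution (\<open>ultradiff_regular_solution\<close>). The growth bounds on the coefficients and on the
derivatives of test functions make all series converge geometrically.\<close>

section \<open>Complex-linear maps\<close>

interpretation scaleC: bounded_bilinear "scaleC :: complex \<Rightarrow> 'e::complex_banach \<Rightarrow> 'e"
proof
  show "\<exists>K. \<forall>a b. norm (a *\<^sub>C (b::'e)) \<le> norm a * norm b * K"
    by (rule exI[of _ 1]) (simp add: norm_scaleC)
  show "(r *\<^sub>R a) *\<^sub>C (b::'e) = r *\<^sub>R a *\<^sub>C b" "a *\<^sub>C (r *\<^sub>R b) = r *\<^sub>R a *\<^sub>C b" for r a b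
    unfolding scaleR_scaleC[where 'a='e] scaleR_conv_of_real scaleC_scaleC by (simp_all add: mult.commute)
qed (simp_all add: scaleC_add_left scaleC_add_right)

lemma scaleC_one [simp]: "1 *\<^sub>C (x::'e::complex_banach) = x"
  using scaleR_scaleC[of 1 x] by simp

definition complex_linear :: "('e::complex_banach \<Rightarrow> 'f::complex_banach) \<Rightarrow> bool" where
  "complex_linear L \<longleftrightarrow> bounded_linear L \<and> (\<forall>c x. L (c *\<^sub>C x) = c *\<^sub>C L x)"

lemma complex_linearD:
  assumes "complex_linear L"
  shows "bounded_linear L" "L (c *\<^sub>C x) = c *\<^sub>C L x" "L (x + y) = L x + L y"
    "L (x - y) = L x - L y" "L 0 = 0" "L (- x) = - L x"
  using assms unfolding complex_linear_def
  by (auto simp: linear_simps bounded_linear.linear)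

lemma bounded_linear_axis: "bounded_linear (axis j :: 'a::complex_banach \<Rightarrow> 'a ^ 'n)"
  by (rule bounded_linear_intro[where K=1])
     (auto simp: axis_def vec_eq_iff norm_axis_1 norm_vec_def L2_set_def if_distrib[of norm]
        if_distrib[of "\<lambda>x. x\<^sup>2"] cong: if_cong)

lemma complex_linear_axis: "complex_linear (axis j :: 'a::complex_banach \<Rightarrow> 'a ^ 'n)"
  unfolding complex_linear_def
  by (auto simp: bounded_linear_axis vec_eq_iff axis_def scaleC_vec_def scaleC.zero_right)

lemma complex_linear_nth: "complex_linear (\<lambda>x :: 'a::complex_banach ^ 'n. x $ i)"
  unfolding complex_linear_def by (auto simp: scaleC_vec_def bounded_linear_vec_nth)

lemma complex_linear_compose:
  "complex_linear f \<Longrightarrow> complex_linear g \<Longrightarrow> complex_linear (\<lambda>x. f (g x))"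
  unfolding complex_linear_def using bounded_linear_compose[of f g] by auto

lemma complex_linear_add:
  "complex_linear f \<Longrightarrow> complex_linear g \<Longrightarrow> complex_linear (\<lambda>x. f x + g x)"
  unfolding complex_linear_def using bounded_linear_add by (auto simp: scaleC_add_right)

lemma complex_linear_scale: "complex_linear (\<lambda>x :: 'e::complex_banach. c *\<^sub>C x)"
  unfolding complex_linear_def
  by (auto simp: scaleC.bounded_linear_right scaleC_scaleC mult.commute)

lemma complex_linear_zero: "complex_linear (\<lambda>x. 0)"
  unfolding complex_linear_def by (auto simp: scaleC.zero_right)

lemma complex_linear_sum:
  "(\<And>j. j \<in> J \<Longrightarrow> complex_linear (f j)) \<Longrightarrow> complex_linear (\<lambda>x. \<Sum>j\<in>J. f j x)"
  by (induction J rule: infinite_finite_induct) (auto intro: complex_linear_add complex_linear_zero)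

lemma mat_act_eq_sum: "mat_act A y = (\<Sum>i\<in>UNIV. \<Sum>j\<in>UNIV. axis i (A $ i $ j *\<^sub>C y $ j))"
proof -
  have "(\<Sum>x\<in>UNIV. \<Sum>j\<in>UNIV. if i = x then A $ x $ j *\<^sub>C y $ j else 0) =
      (\<Sum>x\<in>UNIV. if i = x then \<Sum>j\<in>UNIV. A $ x $ j *\<^sub>C y $ j else 0)" for i
    by (intro sum.cong) auto
  then show ?thesis
    unfolding mat_act_def by (simp add: vec_eq_iff axis_def if_distrib cong: if_cong)
qed

lemma complex_linear_mat_act: "complex_linear (mat_act A :: 'a::complex_banach ^ 'n \<Rightarrow> 'a ^ 'm)"
  unfolding mat_act_eq_sum[abs_def]
  by (intro complex_linear_sum complex_linear_compose[OF complex_linear_axis]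
      complex_linear_compose[OF complex_linear_scale] complex_linear_nth)

section \<open>Continuous functionals on locally convex spaces\<close>

definition function_space :: "(real \<Rightarrow> complex) set \<Rightarrow> bool" where
  "function_space V \<longleftrightarrow> (\<lambda>t. 0) \<in> V \<and> (\<forall>f\<in>V. \<forall>g\<in>V. (\<lambda>t. f t + g t) \<in> V) \<and>
     (\<forall>c. \<forall>f\<in>V. (\<lambda>t. c * f t) \<in> V)"

definition linear_functional :: "(real \<Rightarrow> complex) set \<Rightarrow> ((real \<Rightarrow> complex) \<Rightarrow> 'e::complex_banach) \<Rightarrow> bool"
  where "linear_functional V T \<longleftrightarrow>
     (\<forall>f\<in>V. \<forall>g\<in>V. T (\<lambda>t. f t + g t) = T f + T g) \<and>
     (\<forall>c. \<forall>f\<in>V. T (\<lambda>t. c * f t) = c *\<^sub>C T f)"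

lemma dual_iff:
  "T \<in> dual S \<longleftrightarrow>
    linear_functional (carrier S) T \<and> continuous_map (lc_topology S) euclidean T"
  unfolding dual_def linear_functional_def by auto

lemma function_space_diff:
  assumes "function_space V" "f \<in> V" "g \<in> V"
  shows "(\<lambda>t. f t - g t) \<in> V"
proof -
  have "(\<lambda>t. (-1) * g t) \<in> V" using assms unfolding function_space_def by blast
  then have "(\<lambda>t. f t + (-1) * g t) \<in> V" using assms unfolding function_space_def by fast
  then show ?thesis by simp
qed

lemma linear_functional_diff:
  assumes "function_space V" "linear_functional V T" "f \<in> V" "g \<in> V"
  shows "T (\<lambda>t. f t - g t) = T f - T g"
proof -
  have "(\<lambda>t. (-1) * g t) \<in> V" using assms unfolding function_space_def by blast
  then have "T (\<lambda>t. f t + (-1) * g t) = T f + (-1) *\<^sub>C T g"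
    using assms unfolding linear_functional_def by metis
  then show ?thesis by (simp add: scaleC.minus_left)
qed

lemma topspace_lc_topology: "topspace (lc_topology S) = carrier S"
proof -
  have "openin (lc_topology S) (carrier S)"
    unfolding openin_lc_topology by (auto intro!: exI[of _ "{}"] exI[of _ "1::real"])
  then show ?thesis
    by (metis openin_lc_topology openin_subset openin_topspace subset_antisym)
qed

lemma continuous_map_lcI:
  fixes T :: "(real \<Rightarrow> complex) \<Rightarrow> 'e::metric_space"
  assumes "\<And>f e. f \<in> carrier S \<Longrightarrow> e > 0 \<Longrightarrow> \<exists>Q d. finite Q \<and> Q \<subseteq> snd S \<and> 0 < d \<and>
        (\<forall>g\<in>carrier S. (\<forall>p\<in>Q. p (\<lambda>t. g t - f t) < d) \<longrightarrow> dist (T g) (T f) < e)"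
  shows "continuous_map (lc_topology S) euclidean T"
  unfolding continuous_map_def topspace_lc_topology
proof (intro conjI allI impI)
  fix U :: "'e set" assume "openin euclidean U"
  then have U: "open U" by simp
  show "openin (lc_topology S) {x \<in> carrier S. T x \<in> U}"
    unfolding openin_lc_topology
  proof (intro conjI ballI)
    fix f assume f: "f \<in> {x \<in> carrier S. T x \<in> U}"
    then obtain e where e: "e > 0" "\<And>y. dist y (T f) < e \<Longrightarrow> y \<in> U"
      using U unfolding open_dist by blast
    obtain Q d where "finite Q" "Q \<subseteq> snd S" "0 < d" and
      d: "\<And>g. g\<in>carrier S \<Longrightarrow> (\<forall>p\<in>Q. p (\<lambda>t. g t - f t) < d) \<Longrightarrow> dist (T g) (T f) < e"
      using assms[of f e] f e by blast
    then show "\<exists>Q e. finite Q \<and> Q \<subseteq> snd S \<and> 0 < e \<and>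
        {g \<in> carrier S. \<forall>p\<in>Q. p (\<lambda>t. g t - f t) < e} \<subseteq> {x \<in> carrier S. T x \<in> U}"
      using e(2) by (intro exI[of _ Q] exI[of _ d]) auto
  qed auto
qed auto

text \<open>A linear functional bounded by finitely many defining seminorms is continuous, since
\<open>T g - T f = T (g - f)\<close>.\<close>

lemma dual_if_bounded:
  assumes V: "function_space (carrier S)" and lin: "linear_functional (carrier S) T"
    and Q: "finite Q" "Q \<subseteq> snd S" and "C \<ge> 0"
    and bound: "\<And>f. f \<in> carrier S \<Longrightarrow> norm (T f) \<le> C * (\<Sum>p\<in>Q. p f)"
  shows "T \<in> dual S"
  unfolding dual_iff
proof (intro conjI lin continuous_map_lcI)
  fix f e assume f: "f \<in> carrier S" and "(e::real) > 0"
  define N where "N = C * real (card Q) + 1"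
  have "N > 0" using \<open>C \<ge> 0\<close> by (simp add: N_def add_nonneg_pos)
  have "dist (T g) (T f) < e" if g: "g \<in> carrier S" and p: "\<forall>p\<in>Q. p (\<lambda>t. g t - f t) < e / N" for g
  proof -
    have "dist (T g) (T f) = norm (T (\<lambda>t. g t - f t))"
      using linear_functional_diff[OF V lin g f] by (simp add: dist_norm)
    also have "\<dots> \<le> C * (\<Sum>p\<in>Q. p (\<lambda>t. g t - f t))"
      by (intro bound function_space_diff V g f)
    also have "\<dots> \<le> C * (\<Sum>p\<in>Q. e / N)"
      using p by (intro mult_left_mono sum_mono \<open>C \<ge> 0\<close>) auto
    also have "\<dots> = e * ((C * card Q) / N)" by simp
    also have "\<dots> < e * 1"
      using \<open>e > 0\<close> \<open>N > 0\<close> by (intro mult_strict_left_mono) (auto simp: N_def)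
    finally show ?thesis by simp
  qed
  then show "\<exists>Q d. finite Q \<and> Q \<subseteq> snd S \<and> 0 < d \<and>
        (\<forall>g\<in>carrier S. (\<forall>p\<in>Q. p (\<lambda>t. g t - f t) < d) \<longrightarrow> dist (T g) (T f) < e)"
    using Q \<open>e > 0\<close> \<open>N > 0\<close> by (intro exI[of _ Q] exI[of _ "e / N"]) auto
qed

text \<open>If \<open>T\<close> is continuous on every step of an inductive limit, then \<open>f \<mapsto> norm (T f)\<close> is itself one of the
seminorms that generate the topology of the limit.\<close>

lemma dual_ind_limit:
  assumes V: "function_space (carrier (ind_limit I S))"
    and lin: "linear_functional (carrier (ind_limit I S)) T"
    and T: "\<And>i. i \<in> I \<Longrightarrow> T \<in> dual (S i)"
  shows "T \<in> dual (ind_limit I S)"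
proof (rule dual_if_bounded[where Q = "{\<lambda>f. norm (T f)}" and C = 1])
  have sub: "carrier (S i) \<subseteq> carrier (ind_limit I S)" if "i \<in> I" for i
    using that by (auto simp: ind_limit_def Let_def)
  have "seminorm_on (carrier (ind_limit I S)) (\<lambda>f. norm (T f))"
    using lin unfolding seminorm_on_def linear_functional_def
    by (auto simp: norm_scaleC norm_triangle_ineq)
  moreover have "continuous_map (lc_topology (S i)) euclideanreal (\<lambda>f. norm (T f))"
    if "i \<in> I" for i
    using T[OF that] unfolding dual_iff by (auto intro: continuous_map_norm)
  ultimately show "{\<lambda>f. norm (T f)} \<subseteq> snd (ind_limit I S)"
    by (auto simp: ind_limit_def Let_def)
qed (use V lin in auto)

text \<open>The converse of \<open>dual_if_bounded\<close>: a neighbourhood of \<open>0\<close> is mapped into the unit ball, and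
homogeneity spreads the bound to the whole space.\<close>

lemma dual_bound:
  assumes T: "T \<in> dual S" and V: "function_space (carrier S)"
    and hom: "\<And>p f c. p \<in> snd S \<Longrightarrow> f \<in> carrier S \<Longrightarrow> p (\<lambda>t. c * f t) = cmod c * p f"
    and nonneg: "\<And>p f. p \<in> snd S \<Longrightarrow> f \<in> carrier S \<Longrightarrow> p f \<ge> 0"
  obtains Q C where "finite Q" "Q \<subseteq> snd S" "C > 0"
    "\<And>f. f \<in> carrier S \<Longrightarrow> norm (T f) \<le> C * (\<Sum>p\<in>Q. p f)"
proof -
  have lin: "linear_functional (carrier S) T" and
    cont: "continuous_map (lc_topology S) euclidean T" using T unfolding dual_iff by auto
  have zero: "(\<lambda>t. 0) \<in> carrier S" using V unfolding function_space_def by auto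
  have T0: "T (\<lambda>t. 0) = 0"
    using linear_functional_diff[OF V lin zero zero] by simp
  have "openin (lc_topology S) {f \<in> carrier S. T f \<in> ball 0 1}"
    using openin_continuous_map_preimage[OF cont, of "ball 0 1"]
    unfolding topspace_lc_topology by simp
  then have "\<exists>Q e. finite Q \<and> Q \<subseteq> snd S \<and> 0 < e \<and>
      {g \<in> carrier S. \<forall>p\<in>Q. p (\<lambda>t. g t - 0) < e} \<subseteq> {f \<in> carrier S. T f \<in> ball 0 1}"
    unfolding openin_lc_topology using T0 zero
    by (elim conjE ballE[of _ _ "\<lambda>t. 0"]) simp_all
  then obtain Q e where Q: "finite Q" "Q \<subseteq> snd S" and "0 < e" and
    ball: "\<And>g. g \<in> carrier S \<Longrightarrow> \<forall>p\<in>Q. p (\<lambda>t. g t - 0) < e \<Longrightarrow> norm (T g) < 1"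
    by (auto simp: subset_iff)
  have "norm (T f) \<le> (2 / e) * (\<Sum>p\<in>Q. p f)" if f: "f \<in> carrier S" for f
  proof -
    define s where "s = (\<Sum>p\<in>Q. p f)"
    have "s \<ge> 0" unfolding s_def using nonneg Q f by (intro sum_nonneg) auto
    \<comment> \<open>The extra \<open>d\<close> allows division by the bound when all seminorms of \<open>f\<close> vanish.\<close>
    have "norm (T f) \<le> (2 / e) * s + d" if "d > 0" for d
    proof -
      define c where "c = (2 / e) * s + d"
      have "c > 0" using \<open>s \<ge> 0\<close> \<open>e > 0\<close> \<open>d > 0\<close> by (simp add: c_def add_nonneg_pos)
      have "p (\<lambda>t. of_real (1 / c) * f t - 0) < e" if p: "p \<in> Q" for p
      proof -
        have "p (\<lambda>t. of_real (1 / c) * f t - 0) = (1 / c) * p f"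
          using hom[of p f "of_real (1 / c)"] p Q f \<open>c > 0\<close> by (auto simp: norm_divide)
        also have "\<dots> \<le> (1 / c) * s"
          unfolding s_def using p Q nonneg f \<open>c > 0\<close> by (intro mult_left_mono member_le_sum) auto
        also have "\<dots> = e * ((1 / c) * ((2 / e) * s) / 2)" using \<open>e > 0\<close> by simp
        also have "\<dots> \<le> e * ((1 / c) * c / 2)"
          using \<open>c > 0\<close> \<open>e > 0\<close> \<open>d > 0\<close>
          by (intro mult_left_mono divide_right_mono) (auto simp: c_def)
        also have "\<dots> < e" using \<open>c > 0\<close> \<open>e > 0\<close> by simp
        finally show ?thesis .
      qed
      moreover have "(\<lambda>t. of_real (1 / c) * f t) \<in> carrier S"
        using V f unfolding function_space_def by blast
      ultimately have "norm (T (\<lambda>t. of_real (1 / c) * f t)) < 1" by (intro ball) auto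
      moreover have "T (\<lambda>t. of_real (1 / c) * f t) = of_real (1 / c) *\<^sub>C T f"
        using lin f unfolding linear_functional_def by blast
      ultimately have "norm (T f) < c"
        using \<open>c > 0\<close> by (simp add: norm_scaleC norm_divide)
      then show ?thesis by (simp add: c_def)
    qed
    then have "norm (T f) \<le> (2 / e) * s" by (rule field_le_epsilon)
    then show ?thesis by (simp add: s_def)
  qed
  moreover have "2 / e > 0" using \<open>0 < e\<close> by simp
  ultimately show ?thesis using that[OF Q] by blast
qed

section \<open>Derivatives of test functions\<close>

lemma nderiv_0 [simp]: "nderiv 0 f = f"
  by (simp add: nderiv_def)

lemma nderiv_Suc: "nderiv (Suc k) f = nderiv k (nderiv 1 f)"
  by (simp add: nderiv_def funpow_Suc_right del: funpow.simps)

lemma nderiv_add: "nderiv (j + k) f = nderiv j (nderiv k f)"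
  by (simp add: nderiv_def funpow_add)

lemma smooth_has_deriv:
  assumes "smooth f"
  shows "(nderiv k f has_vector_derivative nderiv (Suc k) f t) (at t)"
  using assms unfolding smooth_def nderiv_def by (auto simp: vector_derivative_works)

text \<open>Exhibiting a candidate for every derivative proves smoothness and identifies the derivatives at once.\<close>

lemma nderiv_eqI:
  assumes "F 0 = f" "\<And>k t. (F k has_vector_derivative F (Suc k) t) (at t)"
  shows "nderiv k f = F k" "smooth f"
proof -
  show *: "nderiv k f = F k" for k
  proof (induction k)
    case (Suc k)
    have "nderiv (Suc k) f = (\<lambda>t. vector_derivative (nderiv k f) (at t))"
      by (simp add: nderiv_def)
    then show ?case using Suc assms(2) by (auto simp: vector_derivative_at)
  qed (use assms in auto)
  show "smooth f"
    unfolding smooth_def * using assms(2) by (auto intro: differentiableI_vector)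
qed

lemma smooth_nderiv: "smooth f \<Longrightarrow> smooth (nderiv k f)"
  unfolding smooth_def by (metis nderiv_add)

lemma continuous_on_nderiv: "smooth f \<Longrightarrow> continuous_on A (nderiv k f)"
  by (metis continuous_at_imp_continuous_on differentiable_imp_continuous_within smooth_def)

lemma smooth_zero: "smooth (\<lambda>t. 0)" and nderiv_zero: "nderiv k (\<lambda>t. 0) = (\<lambda>t. 0)"
  by (rule nderiv_eqI[where F="\<lambda>k t. 0"]; simp)+

lemma smooth_add: "smooth f \<Longrightarrow> smooth g \<Longrightarrow> smooth (\<lambda>t. f t + g t)"
  and nderiv_plus: "smooth f \<Longrightarrow> smooth g \<Longrightarrow>
    nderiv k (\<lambda>t. f t + g t) = (\<lambda>t. nderiv k f t + nderiv k g t)"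
  by (rule nderiv_eqI[where F="\<lambda>k t. nderiv k f t + nderiv k g t"];
      auto intro!: derivative_eq_intros smooth_has_deriv)+

lemma smooth_cmult: "smooth f \<Longrightarrow> smooth (\<lambda>t. c * f t)"
  and nderiv_cmult: "smooth f \<Longrightarrow> nderiv k (\<lambda>t. c * f t) = (\<lambda>t. c * nderiv k f t)"
  by (rule nderiv_eqI[where F="\<lambda>k t. c * nderiv k f t"];
      auto intro!: derivative_eq_intros smooth_has_deriv)+

lemma smooth_affine: "smooth f \<Longrightarrow> smooth (\<lambda>t. f (c * t + d))"
  and nderiv_affine: "smooth f \<Longrightarrow>
    nderiv k (\<lambda>t. f (c * t + d)) = (\<lambda>t. of_real (c ^ k) * nderiv k f (c * t + d))"
proof -
  assume f: "smooth f"
  have *: "((\<lambda>t. of_real (c ^ k) * nderiv k f (c * t + d)) has_vector_derivative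
      of_real (c ^ Suc k) * nderiv (Suc k) f (c * t + d)) (at t)" for k t
  proof -
    have "((nderiv k f \<circ> (\<lambda>t. c * t + d)) has_vector_derivative
        c *\<^sub>R nderiv (Suc k) f (c * t + d)) (at t)"
      by (rule vector_diff_chain_at) (auto intro!: derivative_eq_intros smooth_has_deriv f)
    then have "((\<lambda>t. nderiv k f (c * t + d)) has_vector_derivative
        c *\<^sub>R nderiv (Suc k) f (c * t + d)) (at t)"
      by (simp add: o_def)
    then show ?thesis
      by (auto intro!: derivative_eq_intros simp: scaleR_conv_of_real)
  qed
  show "smooth (\<lambda>t. f (c * t + d))"
    "nderiv k (\<lambda>t. f (c * t + d)) = (\<lambda>t. of_real (c ^ k) * nderiv k f (c * t + d))"
    by (rule nderiv_eqI[where F="\<lambda>k t. of_real (c ^ k) * nderiv k f (c * t + d)"];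
        use * in auto)+
qed

text \<open>\<open>exp_twist \<mu> f k = (d/dt + \<mu>)\<^sup>k f\<close>, which is \<open>exp (- \<mu> t)\<close> times the \<open>k\<close>-th derivative of
\<open>exp (\<mu> t) f t\<close>. The recursion replaces the Leibniz rule and its binomial coefficients.\<close>

primrec exp_twist :: "complex \<Rightarrow> (real \<Rightarrow> complex) \<Rightarrow> nat \<Rightarrow> real \<Rightarrow> complex" where
  "exp_twist \<mu> f 0 = f"
| "exp_twist \<mu> f (Suc k) = (\<lambda>t. nderiv 1 (exp_twist \<mu> f k) t + \<mu> * exp_twist \<mu> f k t)"

lemma smooth_exp_twist: "smooth f \<Longrightarrow> smooth (exp_twist \<mu> f k)"
proof (induction k)
  case (Suc k)
  then show ?case
    unfolding exp_twist.simps by (intro smooth_add smooth_nderiv smooth_cmult) auto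
qed simp

lemma has_vector_derivative_cexp:
  "((\<lambda>t. exp (\<mu> * complex_of_real t)) has_vector_derivative \<mu> * exp (\<mu> * of_real t)) (at t)"
proof -
  have "((\<lambda>z. exp (\<mu> * z)) has_field_derivative \<mu> * exp (\<mu> * of_real t)) (at (of_real t))"
    by (rule derivative_eq_intros refl | simp)+
  from has_vector_derivative_real_field[OF this] show ?thesis .
qed

lemma smooth_exp_mult: "smooth f \<Longrightarrow> smooth (\<lambda>t. exp (\<mu> * of_real t) * f t)"
  and nderiv_exp_mult: "smooth f \<Longrightarrow>
    nderiv k (\<lambda>t. exp (\<mu> * of_real t) * f t) = (\<lambda>t. exp (\<mu> * of_real t) * exp_twist \<mu> f k t)"
proof -
  assume f: "smooth f"
  have *: "((\<lambda>t. exp (\<mu> * of_real t) * exp_twist \<mu> f k t) has_vector_derivative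
      exp (\<mu> * of_real t) * exp_twist \<mu> f (Suc k) t) (at t)" for k t
    using has_vector_derivative_mult[OF has_vector_derivative_cexp
        smooth_has_deriv[OF smooth_exp_twist[OF f, of \<mu> k], of 0 t], of \<mu>]
    by (simp add: algebra_simps)
  have 0: "(\<lambda>t. exp (\<mu> * of_real t) * exp_twist \<mu> f 0 t) = (\<lambda>t. exp (\<mu> * of_real t) * f t)"
    by simp
  show "smooth (\<lambda>t. exp (\<mu> * of_real t) * f t)"
    "nderiv k (\<lambda>t. exp (\<mu> * of_real t) * f t) = (\<lambda>t. exp (\<mu> * of_real t) * exp_twist \<mu> f k t)"
    by (rule nderiv_eqI[where F="\<lambda>k t. exp (\<mu> * of_real t) * exp_twist \<mu> f k t", OF 0 *])+
qed

lemma not_in_supp: "t \<notin> supp f \<Longrightarrow> f t = 0"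
  unfolding supp_def using closure_subset[of "{t. f t \<noteq> 0}"] by blast

lemma supp_subsetI: "closed K \<Longrightarrow> (\<And>t. t \<notin> K \<Longrightarrow> f t = 0) \<Longrightarrow> supp f \<subseteq> K"
  unfolding supp_def by (rule closure_minimal) auto

lemma nderiv_vanishes:
  assumes K: "closed K" and "\<And>t. t \<notin> K \<Longrightarrow> f t = 0" "t \<notin> K"
  shows "nderiv k f t = 0"
  using assms(3)
proof (induction k arbitrary: t)
  case (Suc k)
  have "(nderiv k f has_vector_derivative 0) (at t)"
    by (rule has_vector_derivative_transform_within_open[where S="- K" and f="\<lambda>t. 0"])
       (use K Suc in auto)
  then show ?case by (simp add: nderiv_def vector_derivative_at)
qed (use assms in auto)

section \<open>Almost periodic and almost automorphic functions\<close>

definition almost_periods :: "(real \<Rightarrow> 'e::complex_banach) \<Rightarrow> real \<Rightarrow> real set" where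
  "almost_periods f \<epsilon> = {\<tau>. \<forall>t. norm (f (t + \<tau>) - f t) \<le> \<epsilon>}"

lemma relatively_dense_mono: "relatively_dense S \<Longrightarrow> S \<subseteq> S' \<Longrightarrow> relatively_dense S'"
  unfolding relatively_dense_def by blast

text \<open>Of two disjoint intervals at least one avoids \<open>0\<close>, so the requirement that periods be nonzero costs
only a longer inclusion length.\<close>

lemma relatively_dense_remove_zero:
  assumes "relatively_dense S"
  shows "relatively_dense (S - {0})"
proof -
  obtain l where l: "l > 0" "\<And>a. S \<inter> {a..a + l} \<noteq> {}"
    using assms unfolding relatively_dense_def by blast
  have "(S - {0}) \<inter> {a..a + (2 * l + 1)} \<noteq> {}" for a
  proof (cases "0 \<in> {a..a + l}")
    case True
    then show ?thesis using l(2)[of "a + l + 1"] l(1) by force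
  next
    case False
    then show ?thesis using l(2)[of a] l(1) by force
  qed
  then show ?thesis
    unfolding relatively_dense_def using l(1) by (intro exI[of _ "2 * l + 1"]) auto
qed

lemma AP_iff: "f \<in> AP \<longleftrightarrow>
    continuous_on UNIV f \<and> (\<forall>\<epsilon>>0. relatively_dense (almost_periods f \<epsilon>))"
proof -
  have "{\<tau>. \<tau> \<noteq> 0 \<and> (\<forall>t. norm (f (t + \<tau>) - f t) \<le> \<epsilon>)} = almost_periods f \<epsilon> - {0}" for \<epsilon>
    by (auto simp: almost_periods_def)
  then show ?thesis
    unfolding AP_def using relatively_dense_remove_zero relatively_dense_mono by auto
qed

text \<open>Translation by an almost period moves any point into a fixed compact interval. Global boundedness and
uniform continuity are thereby inherited from that interval.\<close>

lemma AP_return_to_interval: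
  assumes "f \<in> AP" "\<epsilon> > 0"
  obtains l where "l > 0" "\<And>t. \<exists>\<tau>. t + \<tau> \<in> {0..l} \<and> (\<forall>s. norm (f (s + \<tau>) - f s) \<le> \<epsilon>)"
proof -
  obtain l where l: "l > 0" "\<And>a. almost_periods f \<epsilon> \<inter> {a..a + l} \<noteq> {}"
    using assms unfolding AP_iff relatively_dense_def by blast
  have "\<exists>\<tau>. t + \<tau> \<in> {0..l} \<and> (\<forall>s. norm (f (s + \<tau>) - f s) \<le> \<epsilon>)" for t
  proof -
    obtain \<tau> where "\<tau> \<in> almost_periods f \<epsilon>" "\<tau> \<in> {- t..- t + l}" using l(2)[of "- t"] by blast
    then show ?thesis by (intro exI[of _ \<tau>]) (auto simp: almost_periods_def)
  qed
  with l(1) show ?thesis by (rule that)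
qed

lemma AP_bounded:
  assumes "f \<in> AP"
  shows "bounded (range f)"
proof -
  obtain l where l: "\<And>t. \<exists>\<tau>. t + \<tau> \<in> {0..l} \<and> (\<forall>s. norm (f (s + \<tau>) - f s) \<le> 1)"
    using AP_return_to_interval[OF assms zero_less_one] by blast
  have "continuous_on {0..l} f"
    using assms unfolding AP_iff by (meson continuous_on_subset subset_UNIV)
  then have "bounded (f ` {0..l})"
    by (intro compact_imp_bounded compact_continuous_image) auto
  then obtain B where B: "\<And>t. t \<in> {0..l} \<Longrightarrow> norm (f t) \<le> B"
    unfolding bounded_iff by blast
  have "norm (f t) \<le> B + 1" for t
  proof -
    obtain \<tau> where \<tau>: "t + \<tau> \<in> {0..l}" "norm (f (t + \<tau>) - f t) \<le> 1" using l by blast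
    have "norm (f t) \<le> norm (f (t + \<tau>)) + norm (f (t + \<tau>) - f t)"
      by (metis norm_minus_commute norm_triangle_sub)
    then show ?thesis using B[OF \<tau>(1)] \<tau>(2) by simp
  qed
  then show ?thesis unfolding bounded_iff by auto
qed

lemma AP_uniformly_continuous:
  assumes f: "f \<in> AP" and "\<epsilon> > 0"
  obtains d where "d > 0" "\<And>s t. \<bar>s - t\<bar> < d \<Longrightarrow> norm (f s - f t) < \<epsilon>"
proof -
  obtain l where l: "\<And>t. \<exists>\<tau>. t + \<tau> \<in> {0..l} \<and> (\<forall>s. norm (f (s + \<tau>) - f s) \<le> \<epsilon> / 3)"
    using AP_return_to_interval[OF f, of "\<epsilon> / 3"] \<open>\<epsilon> > 0\<close> by (metis divide_pos_pos zero_less_numeral)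
  have "continuous_on {-1..l+1} f"
    using f unfolding AP_iff by (meson continuous_on_subset subset_UNIV)
  then have "uniformly_continuous_on {-1..l+1} f"
    by (intro compact_uniformly_continuous) auto
  then obtain d where "d > 0" and
    d: "\<And>s t. s \<in> {-1..l+1} \<Longrightarrow> t \<in> {-1..l+1} \<Longrightarrow> dist s t < d \<Longrightarrow> dist (f s) (f t) < \<epsilon> / 3"
    unfolding uniformly_continuous_on_def using \<open>\<epsilon> > 0\<close> by (metis divide_pos_pos zero_less_numeral)
  have "norm (f s - f t) < \<epsilon>" if st: "\<bar>s - t\<bar> < min d 1" for s t
  proof -
    obtain \<tau> where \<tau>: "t + \<tau> \<in> {0..l}" "\<And>s. norm (f (s + \<tau>) - f s) \<le> \<epsilon> / 3" using l by blast
    have "norm (f (s + \<tau>) - f (t + \<tau>)) < \<epsilon> / 3"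
      using d[of "s + \<tau>" "t + \<tau>"] \<tau>(1) st unfolding abs_less_iff
      by (auto simp: dist_norm abs_less_iff)
    moreover have "norm (f s - f t) \<le> norm (f (s + \<tau>) - f s) + norm (f (s + \<tau>) - f (t + \<tau>))
        + norm (f (t + \<tau>) - f t)"
    proof -
      have "norm (f s - f t) = norm ((f (s + \<tau>) - f (t + \<tau>)) - (f (s + \<tau>) - f s) + (f (t + \<tau>) - f t))"
        by (rule arg_cong[where f = norm]) simp
      then show ?thesis
        using norm_triangle_ineq[of "(f (s + \<tau>) - f (t + \<tau>)) - (f (s + \<tau>) - f s)" "f (t + \<tau>) - f t"]
          norm_triangle_ineq4[of "f (s + \<tau>) - f (t + \<tau>)" "f (s + \<tau>) - f s"] by linarith
    qed
    ultimately show ?thesis using \<tau>(2)[of s] \<tau>(2)[of t] by simp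
  qed
  then show ?thesis using \<open>d > 0\<close> by (intro that[of "min d 1"]) auto
qed

lemma almost_periods_diff:
  assumes "\<tau> \<in> almost_periods f \<delta>" "\<sigma> \<in> almost_periods f \<delta>"
  shows "\<tau> - \<sigma> \<in> almost_periods f (2 * \<delta>)"
proof -
  have "norm (f (t + (\<tau> - \<sigma>)) - f t) \<le> 2 * \<delta>" for t
  proof -
    have "norm (f ((t - \<sigma>) + \<tau>) - f (t - \<sigma>)) \<le> \<delta>" "norm (f ((t - \<sigma>) + \<sigma>) - f (t - \<sigma>)) \<le> \<delta>"
      using assms unfolding almost_periods_def by blast+
    then show ?thesis
      using norm_triangle_ineq4[of "f (t - \<sigma> + \<tau>) - f (t - \<sigma>)" "f t - f (t - \<sigma>)"]
      by (simp add: algebra_simps)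
  qed
  then show ?thesis by (simp add: almost_periods_def)
qed

text \<open>Bohr's pigeonhole argument. Choose in every interval of length \<open>l\<close> an almost period \<open>\<tau>\<close> of \<open>f\<close> and
\<open>\<sigma>\<close> of \<open>g\<close>. The differences \<open>\<tau> - \<sigma>\<close> lie in \<open>[-l, l]\<close>, so they fall into finitely many bins of width
\<open>d\<close>. Subtracting the pair that represents the bin gives almost periods of \<open>f\<close> and of \<open>g\<close> that differ by
less than \<open>d\<close>, and uniform continuity of \<open>g\<close> makes the first one an almost period of both.\<close>

lemma AP_common_almost_periods:
  fixes f :: "real \<Rightarrow> 'e::complex_banach" and g :: "real \<Rightarrow> 'f::complex_banach"
  assumes f: "f \<in> AP" and g: "g \<in> AP" and "\<epsilon> > 0"
  shows "relatively_dense (almost_periods f \<epsilon> \<inter> almost_periods g \<epsilon>)"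
proof -
  have "\<epsilon> / 3 > 0" using \<open>\<epsilon> > 0\<close> by simp
  obtain l1 where l1: "l1 > 0" "\<And>a. almost_periods f (\<epsilon> / 3) \<inter> {a..a + l1} \<noteq> {}"
    using f \<open>\<epsilon> / 3 > 0\<close> unfolding AP_iff relatively_dense_def by blast
  obtain l2 where l2: "l2 > 0" "\<And>a. almost_periods g (\<epsilon> / 3) \<inter> {a..a + l2} \<noteq> {}"
    using g \<open>\<epsilon> / 3 > 0\<close> unfolding AP_iff relatively_dense_def by blast
  define l where "l = max l1 l2"
  have "\<exists>\<tau>. \<tau> \<in> almost_periods f (\<epsilon> / 3) \<and> \<tau> \<in> {a..a + l}" for a
    using l1(2)[of a] unfolding l_def by force
  then obtain \<tau> where \<tau>: "\<And>a. \<tau> a \<in> almost_periods f (\<epsilon> / 3)" "\<And>a. \<tau> a \<in> {a..a + l}" by metis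
  have "\<exists>\<sigma>. \<sigma> \<in> almost_periods g (\<epsilon> / 3) \<and> \<sigma> \<in> {a..a + l}" for a
    using l2(2)[of a] unfolding l_def by force
  then obtain \<sigma> where \<sigma>: "\<And>a. \<sigma> a \<in> almost_periods g (\<epsilon> / 3)" "\<And>a. \<sigma> a \<in> {a..a + l}" by metis
  obtain d where "d > 0" and d: "\<And>s t. \<bar>s - t\<bar> < d \<Longrightarrow> norm (g s - g t) < \<epsilon> / 3"
    using AP_uniformly_continuous[OF g \<open>\<epsilon> / 3 > 0\<close>] by blast
  define bin where "bin a = \<lfloor>(\<tau> a - \<sigma> a) / d\<rfloor>" for a
  have "bin a \<in> {\<lfloor>- l / d\<rfloor>..\<lfloor>l / d\<rfloor>}" for a
    unfolding bin_def atLeastAtMost_iff using \<tau>(2)[of a] \<sigma>(2)[of a] \<open>d > 0\<close>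
    by (intro conjI floor_mono divide_right_mono) auto
  then have fin: "finite (range bin)"
    by (meson finite_atLeastAtMost_int finite_subset image_subsetI)
  \<comment> \<open>Finitely many bins give finitely many representatives, so their almost periods are bounded by some \<open>R\<close>.\<close>
  define rep where "rep = inv_into UNIV bin"
  have rep: "bin (rep (bin a)) = bin a" for a
    unfolding rep_def by (rule f_inv_into_f) simp
  obtain R where R: "\<And>b. b \<in> range bin \<Longrightarrow> \<bar>\<tau> (rep b)\<bar> \<le> R"
    using finite_imageI[OF fin, of "\<lambda>b. \<bar>\<tau> (rep b)\<bar>", THEN finite_imp_bounded]
    unfolding bounded_iff by auto
  have "R \<ge> 0" using R[of "bin 0"] by force
  have "(almost_periods f \<epsilon> \<inter> almost_periods g \<epsilon>) \<inter> {a..a + (l + 2 * R)} \<noteq> {}" for a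
  proof -
    define x where "x = a + R"
    define y where "y = rep (bin x)"
    have "\<tau> x - \<tau> y \<in> almost_periods f (2 * (\<epsilon> / 3))" "\<sigma> x - \<sigma> y \<in> almost_periods g (2 * (\<epsilon> / 3))"
      by (intro almost_periods_diff \<tau> \<sigma>)+
    moreover have "\<bar>(\<tau> x - \<tau> y) - (\<sigma> x - \<sigma> y)\<bar> < d"
    proof -
      have "\<lfloor>(\<tau> x - \<sigma> x) / d\<rfloor> = \<lfloor>(\<tau> y - \<sigma> y) / d\<rfloor>"
        using rep[of x] unfolding y_def bin_def by simp
      then have "\<bar>(\<tau> x - \<sigma> x) / d - (\<tau> y - \<sigma> y) / d\<bar> < 1" by linarith
      then have "\<bar>(\<tau> x - \<sigma> x) - (\<tau> y - \<sigma> y)\<bar> / d < 1"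
        using \<open>d > 0\<close> by (metis abs_divide abs_of_pos diff_divide_distrib)
      then show ?thesis using \<open>d > 0\<close> by (simp add: algebra_simps)
    qed
    ultimately have "\<tau> x - \<tau> y \<in> almost_periods g \<epsilon>"
    proof -
      assume *: "\<sigma> x - \<sigma> y \<in> almost_periods g (2 * (\<epsilon> / 3))"
        and "\<bar>(\<tau> x - \<tau> y) - (\<sigma> x - \<sigma> y)\<bar> < d"
      have "norm (g (t + (\<tau> x - \<tau> y)) - g t) \<le> \<epsilon>" for t
      proof -
        have "norm (g (t + (\<tau> x - \<tau> y)) - g (t + (\<sigma> x - \<sigma> y))) < \<epsilon> / 3"
          by (rule d) (use \<open>\<bar>(\<tau> x - \<tau> y) - (\<sigma> x - \<sigma> y)\<bar> < d\<close> in simp)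
        moreover have "norm (g (t + (\<sigma> x - \<sigma> y)) - g t) \<le> 2 * (\<epsilon> / 3)"
          using * unfolding almost_periods_def by blast
        ultimately show ?thesis
          using norm_triangle_ineq[of "g (t + (\<tau> x - \<tau> y)) - g (t + (\<sigma> x - \<sigma> y))"
              "g (t + (\<sigma> x - \<sigma> y)) - g t"] by simp
      qed
      then show ?thesis by (simp add: almost_periods_def)
    qed
    moreover have "\<tau> x - \<tau> y \<in> almost_periods f \<epsilon>"
    proof -
      have "norm (f (t + (\<tau> x - \<tau> y)) - f t) \<le> 2 * (\<epsilon> / 3)" for t
        using \<open>\<tau> x - \<tau> y \<in> almost_periods f (2 * (\<epsilon> / 3))\<close> unfolding almost_periods_def by blast
      then have "norm (f (t + (\<tau> x - \<tau> y)) - f t) \<le> \<epsilon>" for t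
        by (rule order_trans) (use \<open>\<epsilon> > 0\<close> in simp)
      then show ?thesis by (simp add: almost_periods_def)
    qed
    moreover have "\<tau> x - \<tau> y \<in> {a..a + (l + 2 * R)}"
      using \<tau>(2)[of x] R[of "bin x"] unfolding x_def y_def by auto
    ultimately show ?thesis by blast
  qed
  moreover have "l + 2 * R > 0" using l1(1) \<open>R \<ge> 0\<close> by (simp add: l_def add_pos_nonneg less_max_iff_disj)
  ultimately show ?thesis unfolding relatively_dense_def by blast
qed

lemma almost_continuous: "f \<in> almost \<kappa> \<Longrightarrow> continuous_on UNIV f"
  by (cases \<kappa>) (auto simp: AP_iff AA_def)

lemma almost_bounded: "f \<in> almost \<kappa> \<Longrightarrow> bounded (range f)"
  by (cases \<kappa>) (auto simp: AP_bounded AA_def)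

lemma AA_I:
  assumes "continuous_on UNIV f" "bounded (range f)"
    and "\<And>b :: nat \<Rightarrow> real. \<exists>r g. strict_mono r \<and>
        (\<forall>t. (\<lambda>n. f (t + b (r n))) \<longlonglongrightarrow> g t) \<and> (\<forall>t. (\<lambda>n. g (t - b (r n))) \<longlonglongrightarrow> f t)"
  shows "f \<in> AA"
  using assms by (simp add: AA_def)

lemma AA_E:
  assumes "f \<in> AA"
  obtains r :: "nat \<Rightarrow> nat" and g where "strict_mono r" "\<And>t. (\<lambda>n. f (t + b (r n))) \<longlonglongrightarrow> g t"
    "\<And>t. (\<lambda>n. g (t - b (r n))) \<longlonglongrightarrow> f t"
  using assms unfolding AA_def mem_Collect_eq by meson

text \<open>The periodic case needs common almost periods of the two functions, the automorphic case a subsequence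
of a subsequence.\<close>

lemma almost_add:
  assumes f: "f \<in> almost \<kappa>" and g: "g \<in> almost \<kappa>"
  shows "(\<lambda>t. f t + g t) \<in> almost \<kappa>"
proof (cases \<kappa>)
  case Periodic
  have "relatively_dense (almost_periods (\<lambda>t. f t + g t) \<epsilon>)" if "\<epsilon> > 0" for \<epsilon>
  proof (rule relatively_dense_mono)
    show "relatively_dense (almost_periods f (\<epsilon> / 2) \<inter> almost_periods g (\<epsilon> / 2))"
      using f g that Periodic by (intro AP_common_almost_periods) auto
    have "norm (f (t + \<tau>) + g (t + \<tau>) - (f t + g t)) \<le> \<epsilon>"
      if "norm (f (t + \<tau>) - f t) \<le> \<epsilon> / 2" "norm (g (t + \<tau>) - g t) \<le> \<epsilon> / 2" for t \<tau>
      using norm_triangle_ineq[of "f (t + \<tau>) - f t" "g (t + \<tau>) - g t"] that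
      by (simp add: algebra_simps)
    then show "almost_periods f (\<epsilon> / 2) \<inter> almost_periods g (\<epsilon> / 2)
        \<subseteq> almost_periods (\<lambda>t. f t + g t) \<epsilon>"
      by (auto simp: almost_periods_def)
  qed
  then show ?thesis
    using Periodic f g by (auto simp: AP_iff intro!: continuous_on_add)
next
  case Automorphic
  have "(\<lambda>t. f t + g t) \<in> AA"
  proof (rule AA_I)
    show "bounded (range (\<lambda>t. f t + g t))"
      by (rule bounded_plus_comp) (rule almost_bounded[OF f] almost_bounded[OF g])+
    fix b :: "nat \<Rightarrow> real"
    obtain r f' where r: "strict_mono r" "\<And>t. (\<lambda>n. f (t + b (r n))) \<longlonglongrightarrow> f' t"
        "\<And>t. (\<lambda>n. f' (t - b (r n))) \<longlonglongrightarrow> f t"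
      using AA_E[of f b] f Automorphic by auto
    obtain q g' where q: "strict_mono q" "\<And>t. (\<lambda>n. g (t + b (r (q n)))) \<longlonglongrightarrow> g' t"
        "\<And>t. (\<lambda>n. g' (t - b (r (q n)))) \<longlonglongrightarrow> g t"
      using AA_E[of g "b \<circ> r"] g Automorphic by (auto simp: o_def)
    show "\<exists>r h. strict_mono r \<and> (\<forall>t. (\<lambda>n. f (t + b (r n)) + g (t + b (r n))) \<longlonglongrightarrow> h t) \<and>
        (\<forall>t. (\<lambda>n. h (t - b (r n))) \<longlonglongrightarrow> f t + g t)"
    proof (intro exI[of _ "r \<circ> q"] exI[of _ "\<lambda>t. f' t + g' t"] conjI allI)
      show "strict_mono (r \<circ> q)" using r q by (simp add: strict_mono_o)
    qed (use q r(2,3)[THEN LIMSEQ_subseq_LIMSEQ, OF q(1)] in \<open>auto simp: o_def intro!: tendsto_add\<close>)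
  qed (intro continuous_on_add almost_continuous[OF f] almost_continuous[OF g])
  then show ?thesis using Automorphic by simp
qed

lemma almost_bounded_linear:
  assumes L: "bounded_linear L" and f: "f \<in> almost \<kappa>"
  shows "(\<lambda>t. L (f t)) \<in> almost \<kappa>"
proof -
  interpret bounded_linear L by (rule L)
  have cont: "continuous_on UNIV (\<lambda>t. L (f t))"
    by (intro continuous_on almost_continuous[OF f])
  obtain K where "K > 0" and K: "\<And>x. norm (L x) \<le> norm x * K" using pos_bounded by blast
  show ?thesis
  proof (cases \<kappa>)
    case Periodic
    have "relatively_dense (almost_periods (\<lambda>t. L (f t)) \<epsilon>)" if "\<epsilon> > 0" for \<epsilon>
    proof (rule relatively_dense_mono)
      show "relatively_dense (almost_periods f (\<epsilon> / K))"
        using f that Periodic \<open>K > 0\<close> by (simp add: AP_iff)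
      have "norm (L (f (t + \<tau>)) - L (f t)) \<le> \<epsilon>" if "norm (f (t + \<tau>) - f t) \<le> \<epsilon> / K" for t \<tau>
        using K[of "f (t + \<tau>) - f t"] that \<open>K > 0\<close> by (simp add: diff field_simps)
      then show "almost_periods f (\<epsilon> / K) \<subseteq> almost_periods (\<lambda>t. L (f t)) \<epsilon>"
        by (auto simp: almost_periods_def)
    qed
    then show ?thesis using cont Periodic by (simp add: AP_iff)
  next
    case Automorphic
    have "(\<lambda>t. L (f t)) \<in> AA"
    proof (rule AA_I[OF cont])
      show "bounded (range (\<lambda>t. L (f t)))"
        using bounded_linear_image[OF almost_bounded[OF f] L] by (simp add: image_image)
      fix b :: "nat \<Rightarrow> real"
      obtain r f' where "strict_mono r" "\<And>t. (\<lambda>n. f (t + b (r n))) \<longlonglongrightarrow> f' t"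
          "\<And>t. (\<lambda>n. f' (t - b (r n))) \<longlonglongrightarrow> f t"
        using AA_E[of f b] f Automorphic by auto
      then show "\<exists>r h. strict_mono r \<and> (\<forall>t. (\<lambda>n. L (f (t + b (r n)))) \<longlonglongrightarrow> h t) \<and>
          (\<forall>t. (\<lambda>n. h (t - b (r n))) \<longlonglongrightarrow> L (f t))"
        by (intro exI[of _ r] exI[of _ "\<lambda>t. L (f' t)"]) (auto intro!: tendsto)
    qed
    then show ?thesis using Automorphic by simp
  qed
qed

lemma zero_almost: "(\<lambda>t. 0) \<in> almost \<kappa>"
proof (cases \<kappa>)
  case Periodic
  have "relatively_dense UNIV" unfolding relatively_dense_def by (auto intro!: exI[of _ 1])
  then show ?thesis using Periodic by (simp add: AP_iff almost_periods_def)
next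
  case Automorphic
  then show ?thesis
    using strict_mono_id by (auto intro!: AA_I exI[of _ id] exI[of _ "\<lambda>t. 0 :: 'a"])
qed

lemma weighted_dominated_convergence:
  fixes k :: "real \<Rightarrow> real"
  assumes k: "integrable lborel k" and "\<And>n. h n \<in> borel_measurable borel"
    and B: "\<And>n s. \<bar>h n s\<bar> \<le> B" and lim: "\<And>s. (\<lambda>n. h n s) \<longlonglongrightarrow> h' s"
  shows "(\<lambda>n. \<integral>s. k s * h n s \<partial>lborel) \<longlonglongrightarrow> (\<integral>s. k s * h' s \<partial>lborel)"
    and "integrable lborel (\<lambda>s. k s * h n s)" "integrable lborel (\<lambda>s. k s * h' s)"
proof -
  have [measurable]: "h n \<in> borel_measurable borel" for n by fact
  have [measurable]: "h' \<in> borel_measurable borel"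
    by (rule borel_measurable_LIMSEQ_real[OF lim]) auto
  have [measurable]: "k \<in> borel_measurable borel" using borel_measurable_integrable[OF k] by simp
  have w: "integrable lborel (\<lambda>s. \<bar>k s\<bar> * B)" using k by auto
  have lim': "AE s in lborel. (\<lambda>n. k s * h n s) \<longlonglongrightarrow> k s * h' s"
    by (intro AE_I2 tendsto_mult_left lim)
  have bound: "AE s in lborel. norm (k s * h n s) \<le> \<bar>k s\<bar> * B" for n
    using B by (intro AE_I2) (auto simp: abs_mult intro: mult_left_mono)
  have meas: "(\<lambda>s. k s * h n s) \<in> borel_measurable lborel"
    "(\<lambda>s. k s * h' s) \<in> borel_measurable lborel" for n by auto
  note dom = meas(2,1) w lim' bound
  show "(\<lambda>n. \<integral>s. k s * h n s \<partial>lborel) \<longlonglongrightarrow> (\<integral>s. k s * h' s \<partial>lborel)"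
    by (rule integral_dominated_convergence[OF dom])
  show "integrable lborel (\<lambda>s. k s * h n s)"
    by (rule integrable_dominated_convergence2[OF dom])
  show "integrable lborel (\<lambda>s. k s * h' s)"
    by (rule integrable_dominated_convergence[OF dom])
qed

text \<open>The transfer principle: a function whose increments are dominated by weighted averages of the
increments of an almost periodic or almost automorphic function is of the same kind. It applies to
solutions of the scalar equation as well as to convolutions.

In the automorphic case let \<open>f (t + c\<^sub>n) \<longlonglongrightarrow> g t\<close> and \<open>g (t - c\<^sub>n) \<longlonglongrightarrow> f t\<close>. Then \<open>v (x + c\<^sub>n)\<close> is a
Cauchy sequence, because the averages of \<open>norm (f (x + c\<^sub>n - s) - g (x - s))\<close> tend to \<open>0\<close>. Its limit
serves as the function required for \<open>v\<close>. The function \<open>g\<close> need not be continuous, but the norms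
above are limits of continuous real functions, hence measurable.\<close>

lemma almost_transfer:
  fixes f :: "real \<Rightarrow> 'e::complex_banach" and v :: "real \<Rightarrow> 'f::complex_banach"
  assumes f: "f \<in> almost \<kappa>" and k: "integrable lborel k" and k0: "\<And>s. k s \<ge> 0"
    and v: "\<And>x y. norm (v x - v y) \<le> (\<integral>s. k s * norm (f (x - s) - f (y - s)) \<partial>lborel)"
  shows "v \<in> almost \<kappa>"
proof -
  have cf: "continuous_on A f" for A
    using almost_continuous[OF f] by (meson continuous_on_subset subset_UNIV)
  have cont_f: "continuous_on A (\<lambda>s. f (g s))" if "continuous_on A g" for g and A :: "real set"
    using continuous_on_compose2[OF cf[of UNIV] that] by simp
  obtain B where B: "\<And>t. norm (f t) \<le> B" using almost_bounded[OF f] unfolding bounded_iff by auto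
  have diff_B: "norm (a - b) \<le> 2 * B" if "norm a \<le> B" "norm b \<le> B" for a b :: 'e
    using norm_triangle_ineq4[of a b] that by simp
  have meas: "(\<lambda>s. norm (f (x - s) - f (y - s))) \<in> borel_measurable borel" for x y
    by (intro borel_measurable_continuous_onI continuous_intros cont_f)
  have int_f: "integrable lborel (\<lambda>s. k s * norm (f (x - s) - f (y - s)))" for x y
    by (rule weighted_dominated_convergence(2)[OF k,
          where h = "\<lambda>_ s. norm (f (x - s) - f (y - s))" and h' = "\<lambda>s. norm (f (x - s) - f (y - s))" and B = "2 * B"])
       (auto simp: B diff_B meas)
  have cont_v: "continuous_on UNIV v"
    unfolding continuous_on_sequentially
  proof (intro allI ballI impI, elim conjE)
    fix x :: "nat \<Rightarrow> real" and a assume x: "x \<longlonglongrightarrow> a"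
    have fx: "(\<lambda>n. f (x n - s)) \<longlonglongrightarrow> f (a - s)" for s
      by (rule continuous_on_tendsto_compose[OF cf[of UNIV]]) (auto intro!: tendsto_intros x)
    have "(\<lambda>n. \<integral>s. k s * norm (f (x n - s) - f (a - s)) \<partial>lborel) \<longlonglongrightarrow> (\<integral>s. k s * 0 \<partial>lborel)"
    proof (rule weighted_dominated_convergence(1)[where B = "2 * B", OF k meas])
      show "(\<lambda>n. norm (f (x n - s) - f (a - s))) \<longlonglongrightarrow> 0" for s
        by (rule tendsto_norm_zero[OF LIM_zero[OF fx]])
    qed (simp add: B diff_B)
    then have "(\<lambda>n. v (x n) - v a) \<longlonglongrightarrow> 0"
      by (intro Lim_null_comparison[OF always_eventually[OF allI, OF v]]) simp
    then show "(v \<circ> x) \<longlonglongrightarrow> v a" by (simp add: o_def LIM_zero_cancel)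
  qed
  show ?thesis
  proof (cases \<kappa>)
    case Periodic
    define I where "I = (\<integral>s. k s \<partial>lborel)"
    have "I \<ge> 0" unfolding I_def using k0 by (intro integral_nonneg_AE) auto
    have "relatively_dense (almost_periods v \<epsilon>)" if "\<epsilon> > 0" for \<epsilon>
    proof (rule relatively_dense_mono)
      show "relatively_dense (almost_periods f (\<epsilon> / (I + 1)))"
        using f that Periodic \<open>I \<ge> 0\<close> by (simp add: AP_iff)
      show "almost_periods f (\<epsilon> / (I + 1)) \<subseteq> almost_periods v \<epsilon>"
      proof
        fix \<tau> assume "\<tau> \<in> almost_periods f (\<epsilon> / (I + 1))"
        then have \<tau>: "norm (f (t + \<tau>) - f t) \<le> \<epsilon> / (I + 1)" for t by (simp add: almost_periods_def)
        have "norm (v (t + \<tau>) - v t) \<le> \<epsilon>" for t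
        proof -
          have "norm (v (t + \<tau>) - v t) \<le> (\<integral>s. k s * norm (f (t + \<tau> - s) - f (t - s)) \<partial>lborel)"
            by (rule v)
          also have "\<dots> \<le> (\<integral>s. k s * (\<epsilon> / (I + 1)) \<partial>lborel)"
          proof (rule integral_mono)
            show "integrable lborel (\<lambda>s. k s * norm (f (t + \<tau> - s) - f (t - s)))"
              by (rule int_f)
            show "k s * norm (f (t + \<tau> - s) - f (t - s)) \<le> k s * (\<epsilon> / (I + 1))" for s
              using \<tau>[of "t - s"] k0 by (intro mult_left_mono) (auto simp: algebra_simps)
          qed (use k in auto)
          also have "\<dots> = I * (\<epsilon> / (I + 1))"
            unfolding I_def by (rule integral_mult_left_zero)
          also have "\<dots> \<le> \<epsilon>" using \<open>I \<ge> 0\<close> that by (simp add: field_simps)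
          finally show ?thesis .
        qed
        then show "\<tau> \<in> almost_periods v \<epsilon>" by (simp add: almost_periods_def)
      qed
    qed
    then show ?thesis using cont_v Periodic by (simp add: AP_iff)
  next
    case Automorphic
    have "v \<in> AA"
    proof (rule AA_I[OF cont_v])
      have "norm (v x) \<le> norm (v 0) + (\<integral>s. k s * (2 * B) \<partial>lborel)" for x
      proof -
        have "norm (v x - v 0) \<le> (\<integral>s. k s * norm (f (x - s) - f (0 - s)) \<partial>lborel)" by (rule v)
        also have "\<dots> \<le> (\<integral>s. k s * (2 * B) \<partial>lborel)"
        proof (rule integral_mono)
          show "integrable lborel (\<lambda>s. k s * norm (f (x - s) - f (0 - s)))"
            by (rule int_f)
        qed (use k k0 B diff_B in \<open>auto intro!: mult_left_mono\<close>)
        finally show ?thesis using norm_triangle_sub[of "v x" "v 0"] by simp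
      qed
      then show "bounded (range v)" unfolding bounded_iff by auto
      fix b :: "nat \<Rightarrow> real"
      obtain r g where r: "strict_mono r" and g: "\<And>t. (\<lambda>n. f (t + b (r n))) \<longlonglongrightarrow> g t"
          and f: "\<And>t. (\<lambda>n. g (t - b (r n))) \<longlonglongrightarrow> f t"
        using AA_E[of f b] f Automorphic by auto
      define c where "c n = b (r n)" for n
      have gc: "(\<lambda>n. f (x + c n - s)) \<longlonglongrightarrow> g (x - s)" for x s
        using g[of "x - s"] by (simp add: c_def algebra_simps)
      have fc: "(\<lambda>n. g (x - c n - s)) \<longlonglongrightarrow> f (x - s)" for x s
        using f[of "x - s"] by (simp add: c_def algebra_simps)
      have Bg: "norm (g t) \<le> B" for t
        by (rule Lim_bounded[OF tendsto_norm[OF g[of t]]]) (simp add: B)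
      have measg: "(\<lambda>s. norm (f (y - s) - g (x - s))) \<in> borel_measurable borel" for x y
      proof (rule borel_measurable_LIMSEQ_real)
        show "(\<lambda>n. norm (f (y - s) - f (x + c n - s))) \<longlonglongrightarrow> norm (f (y - s) - g (x - s))" for s
          by (intro tendsto_intros gc)
      qed (rule meas)
      have d0: "(\<lambda>n. \<integral>s. k s * norm (f (x + c n - s) - g (x - s)) \<partial>lborel) \<longlonglongrightarrow> (\<integral>s. k s * 0 \<partial>lborel)"
        and int_fg: "integrable lborel (\<lambda>s. k s * norm (f (x + c n - s) - g (x - s)))" for x n
      proof -
        have *: "(\<lambda>n. norm (f (x + c n - s) - g (x - s))) \<longlonglongrightarrow> 0" for s
          by (rule tendsto_norm_zero[OF LIM_zero[OF gc]])
        show "(\<lambda>n. \<integral>s. k s * norm (f (x + c n - s) - g (x - s)) \<partial>lborel) \<longlonglongrightarrow> (\<integral>s. k s * 0 \<partial>lborel)"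
          "integrable lborel (\<lambda>s. k s * norm (f (x + c n - s) - g (x - s)))"
          by (rule weighted_dominated_convergence[where B = "2 * B", OF k measg _ *]; simp add: B Bg diff_B)+
      qed
      have "\<exists>G. (\<lambda>n. v (x + c n)) \<longlonglongrightarrow> G" for x
      proof -
        define d where "d n = (\<integral>s. k s * norm (f (x + c n - s) - g (x - s)) \<partial>lborel)" for n
        have d: "d \<longlonglongrightarrow> 0" using d0[of x] by (simp add: d_def[abs_def])
        have vd: "norm (v (x + c n) - v (x + c m)) \<le> d n + d m" for n m
        proof -
          have "norm (v (x + c n) - v (x + c m))
              \<le> (\<integral>s. k s * norm (f (x + c n - s) - f (x + c m - s)) \<partial>lborel)" by (rule v)
          also have "\<dots> \<le> (\<integral>s. k s * norm (f (x + c n - s) - g (x - s))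
              + k s * norm (f (x + c m - s) - g (x - s)) \<partial>lborel)"
          proof (rule integral_mono)
            show "integrable lborel (\<lambda>s. k s * norm (f (x + c n - s) - f (x + c m - s)))"
              by (rule int_f)
            show "k s * norm (f (x + c n - s) - f (x + c m - s)) \<le>
                k s * norm (f (x + c n - s) - g (x - s)) + k s * norm (f (x + c m - s) - g (x - s))" for s
              using mult_left_mono[OF norm_triangle_ineq4[of "f (x + c n - s) - g (x - s)" "f (x + c m - s) - g (x - s)"] k0[of s]]
              by (simp add: algebra_simps)
          qed (intro Bochner_Integration.integrable_add int_fg)
          also have "\<dots> = d n + d m"
            unfolding d_def by (rule Bochner_Integration.integral_add[OF int_fg int_fg])
          finally show ?thesis .
        qed
        have "Cauchy (\<lambda>n. v (x + c n))"
        proof (rule CauchyI)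
          fix e :: real assume "e > 0"
          then obtain N where "\<And>n. n \<ge> N \<Longrightarrow> norm (d n - 0) < e / 2"
            using LIMSEQ_D[OF d, of "e / 2"] by auto
          then have "norm (v (x + c m) - v (x + c n)) < e" if "m \<ge> N" "n \<ge> N" for m n
            using vd[of m n] that by (smt (verit) field_sum_of_halves real_norm_def diff_zero)
          then show "\<exists>M. \<forall>m\<ge>M. \<forall>n\<ge>M. norm (v (x + c m) - v (x + c n)) < e" by blast
        qed
        then show ?thesis by (simp add: Cauchy_convergent_iff convergent_def)
      qed
      then obtain G where G: "\<And>x. (\<lambda>n. v (x + c n)) \<longlonglongrightarrow> G x" by metis
      have "(\<lambda>n. G (x - c n)) \<longlonglongrightarrow> v x" for x
      proof -
        define d where "d n = (\<integral>s. k s * norm (f (x - s) - g (x - c n - s)) \<partial>lborel)" for n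
        have *: "(\<lambda>n. norm (f (x - s) - g (x - c n - s))) \<longlonglongrightarrow> 0" for s
          using tendsto_norm_zero[OF LIM_zero[OF fc]] by (simp add: norm_minus_commute)
        have "d \<longlonglongrightarrow> (\<integral>s. k s * 0 \<partial>lborel)"
          unfolding d_def
          by (rule weighted_dominated_convergence[where B = "2 * B", OF k measg _ *]) (simp add: B Bg diff_B)
        then have d: "d \<longlonglongrightarrow> 0" by simp
        \<comment> \<open>Pass to the limit in the increments of \<open>v\<close> between \<open>x - c n + c m\<close> and \<open>x\<close> as \<open>m\<close> tends to infinity.\<close>
        have "norm (G (x - c n) - v x) \<le> d n" for n
        proof (rule LIMSEQ_le)
          show "(\<lambda>m. norm (v (x - c n + c m) - v x)) \<longlonglongrightarrow> norm (G (x - c n) - v x)"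
            by (intro tendsto_intros G)
          have "(\<lambda>m. norm (f (x - s) - f (x - c n + c m - s))) \<longlonglongrightarrow> norm (f (x - s) - g (x - c n - s))" for s
            by (intro tendsto_intros gc)
          then show "(\<lambda>m. \<integral>s. k s * norm (f (x - s) - f (x - c n + c m - s)) \<partial>lborel) \<longlonglongrightarrow> d n"
            unfolding d_def
            by (rule weighted_dominated_convergence[where B = "2 * B", OF k meas, rotated]) (simp add: B diff_B)
          show "\<exists>N. \<forall>m\<ge>N. norm (v (x - c n + c m) - v x) \<le>
              (\<integral>s. k s * norm (f (x - s) - f (x - c n + c m - s)) \<partial>lborel)"
            using v[of "x - c n + c _" x] v by (auto simp: norm_minus_commute)
        qed
        then have "(\<lambda>n. G (x - c n) - v x) \<longlonglongrightarrow> 0"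
          by (intro Lim_null_comparison[OF _ d] always_eventually allI)
        then show ?thesis by (simp add: LIM_zero_cancel)
      qed
      with r G show "\<exists>r g. strict_mono r \<and> (\<forall>t. (\<lambda>n. v (t + b (r n))) \<longlonglongrightarrow> g t) \<and>
        (\<forall>t. (\<lambda>n. g (t - b (r n))) \<longlonglongrightarrow> v t)"
        unfolding c_def by blast
    qed
    then show ?thesis using Automorphic by simp
  qed
qed

section \<open>Bounded solutions of a scalar equation\<close>

lemma continuous_integrable_if_dominated:
  fixes g :: "real \<Rightarrow> 'e::banach"
  assumes g: "continuous_on UNIV g" and "S = UNIV \<or> S = {c..}"
    and "\<And>s. s \<in> S \<Longrightarrow> norm (g s) \<le> k s" "k integrable_on S"
  shows "g integrable_on S"
proof (rule integrable_on_all_intervals_integrable_bound)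
  have cont: "g integrable_on {a..b}" for a b
    by (intro integrable_continuous_real continuous_on_subset[OF g]) auto
  have "{c..} \<inter> {a..b} = {max c a..b}" for a b by auto
  then show "(\<lambda>x. if x \<in> S then g x else 0) integrable_on cbox a b" for a b
    using assms(2) cont by (auto simp: integrable_restrict_Int)
qed (use assms in auto)

definition exp_kernel :: "complex \<Rightarrow> real \<Rightarrow> real" where
  "exp_kernel \<mu> s = (if s \<ge> 0 then exp (Re \<mu> * s) else 0)"

lemma exp_kernel_nonneg: "exp_kernel \<mu> s \<ge> 0"
  by (simp add: exp_kernel_def)

lemma has_integral_exp_half_line:
  assumes "Re \<mu> < 0"
  shows "((\<lambda>s. exp (Re \<mu> * s)) has_integral exp (Re \<mu> * c) / - Re \<mu>) {c..}"
  using has_integral_exp_minus_to_infinity[of "- Re \<mu>" c] assms by simp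

lemma exp_kernel_integral:
  assumes "Re \<mu> < 0"
  shows "integrable lborel (exp_kernel \<mu>)" "(\<integral>s. exp_kernel \<mu> s \<partial>lborel) = 1 / - Re \<mu>"
proof -
  have eq: "exp_kernel \<mu> = (\<lambda>s. if s \<in> {0..} then exp (Re \<mu> * s) else 0)"
    by (auto simp: exp_kernel_def)
  have int: "(exp_kernel \<mu> has_integral 1 / - Re \<mu>) UNIV"
    unfolding eq has_integral_restrict_UNIV
    using has_integral_exp_half_line[OF assms, of 0] by simp
  have meas: "exp_kernel \<mu> \<in> borel_measurable borel" unfolding eq by measurable
  have "exp_kernel \<mu> absolutely_integrable_on UNIV"
    using int exp_kernel_nonneg by (intro nonnegative_absolutely_integrable_1) auto
  then show *: "integrable lborel (exp_kernel \<mu>)"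
    using integrable_completion[of "exp_kernel \<mu>" lborel] meas by (simp add: set_integrable_def)
  show "(\<integral>s. exp_kernel \<mu> s \<partial>lborel) = 1 / - Re \<mu>"
    using has_integral_integral_lborel[OF *] int by (rule has_integral_unique)
qed

definition bounded_solution ::
    "complex \<Rightarrow> (real \<Rightarrow> 'e::complex_banach) \<Rightarrow> (real \<Rightarrow> 'e) \<Rightarrow> bool" where
  "bounded_solution \<mu> h v \<longleftrightarrow> bounded (range v) \<and>
     (\<forall>t. (v has_vector_derivative \<mu> *\<^sub>C v t + h t) (at t))"

lemma has_vector_derivative_exp_scaleC:
  assumes "(v has_vector_derivative v') (at t)"
  shows "((\<lambda>t. exp (\<mu> * of_real t) *\<^sub>C v t) has_vector_derivative
    exp (\<mu> * of_real t) *\<^sub>C v' + (\<mu> * exp (\<mu> * of_real t)) *\<^sub>C v t) (at t)"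
  by (rule scaleC.has_vector_derivative[OF has_vector_derivative_cexp assms])

lemma has_vector_derivative_affine:
  assumes "\<And>t. (v has_vector_derivative v' t) (at t)"
  shows "((\<lambda>s. v (c * s + d)) has_vector_derivative c *\<^sub>R v' (c * s + d)) (at s)"
proof -
  have "((\<lambda>s. c * s + d) has_vector_derivative c) (at s)" by (auto intro!: derivative_eq_intros)
  from vector_diff_chain_at[OF this assms] show ?thesis by (simp add: o_def)
qed

text \<open>Variation of constants from infinity: \<open>v t = exp (\<mu> t) \<integral>\<^sub>-\<^sub>\<infinity>\<^sup>t exp (- \<mu> r) h r dr\<close>. The substitution
\<open>r = - s\<close> turns the lower half-line into an upper one, whence the reflected integrand \<open>G\<close> and the
argument \<open>- t\<close> of \<open>K\<close>.\<close>

lemma bounded_solution_exists: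
  fixes h :: "real \<Rightarrow> 'e::complex_banach"
  assumes \<mu>: "Re \<mu> < 0" and h: "continuous_on UNIV h" "bounded (range h)"
  obtains v where "bounded_solution \<mu> h v"
proof -
  obtain B where B: "\<And>t. norm (h t) \<le> B" using h(2) unfolding bounded_iff by auto
  define G where "G s = exp (\<mu> * of_real s) *\<^sub>C h (- s)" for s
  define K where "K t = integral {t..} G" for t
  define v where "v t = exp (\<mu> * of_real t) *\<^sub>C K (- t)" for t
  have contG: "continuous_on A G" for A
    unfolding G_def
    by (intro scaleC.continuous_on continuous_intros continuous_on_compose2[OF h(1)]) auto
  have normG: "norm (G s) \<le> exp (Re \<mu> * s) * B" for s
    using B[of "- s"] by (simp add: G_def norm_scaleC mult_left_mono)
  have dom: "((\<lambda>s. exp (Re \<mu> * s) * B) has_integral exp (Re \<mu> * c) / - Re \<mu> * B) {c..}" for c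
    using has_integral_mult_left[OF has_integral_exp_half_line[OF \<mu>]] .
  have intG: "G integrable_on {c..}" for c
    by (rule continuous_integrable_if_dominated[OF contG _ normG]) (use dom in auto)
  have normK: "norm (K t) \<le> exp (Re \<mu> * t) / - Re \<mu> * B" for t
  proof -
    have "norm (K t) \<le> integral {t..} (\<lambda>s. exp (Re \<mu> * s) * B)"
      unfolding K_def using dom normG intG by (intro integral_norm_bound_integral) auto
    then show ?thesis using integral_unique[OF dom[of t]] by simp
  qed
  have derivK: "(K has_vector_derivative - G t) (at t)" for t
  proof -
    have split: "K x = K (t - 1) - integral {t - 1..x} G" if "x \<ge> t - 1" for x
    proof -
      have "(G has_integral (integral {t - 1..x} G + K x)) ({t - 1..x} \<union> {x..})"
        unfolding K_def
      proof (intro has_integral_Un integrable_integral intG integrable_continuous_real contG)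
        show "negligible ({t - 1..x} \<inter> {x..})"
          by (rule negligible_subset[of "{x}"]) auto
      qed
      moreover have "{t - 1..x} \<union> {x..} = {t - 1..}" using that by auto
      ultimately show ?thesis unfolding K_def by (simp add: integral_unique)
    qed
    have "((\<lambda>x. integral {t - 1..x} G) has_vector_derivative G t) (at t within {t - 1..t + 1})"
      by (rule integral_has_vector_derivative[OF contG]) auto
    then have "((\<lambda>x. integral {t - 1..x} G) has_vector_derivative G t) (at t)"
      using at_within_Icc_at[of "t - 1" t "t + 1"] by simp
    then have "((\<lambda>x. K (t - 1) - integral {t - 1..x} G) has_vector_derivative - G t) (at t)"
      by (auto intro!: derivative_eq_intros)
    then show ?thesis
    proof (rule has_vector_derivative_transform_within_open[where S="{t - 1<..}"])
      show "K (t - 1) - integral {t - 1..x} G = K x" if "x \<in> {t - 1<..}" for x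
        using split[of x] that by simp
    qed auto
  qed
  have "(v has_vector_derivative \<mu> *\<^sub>C v t + h t) (at t)" for t
  proof -
    have "((\<lambda>t. K (- t)) has_vector_derivative G (- t)) (at t)"
      using has_vector_derivative_affine[OF derivK, of "-1" 0 t] by simp
    from has_vector_derivative_exp_scaleC[OF this, of \<mu>]
    have "(v has_vector_derivative
        exp (\<mu> * of_real t) *\<^sub>C G (- t) + (\<mu> * exp (\<mu> * of_real t)) *\<^sub>C K (- t)) (at t)"
      by (simp only: v_def[abs_def])
    moreover have "exp (\<mu> * of_real t) * exp (\<mu> * of_real (- t)) = 1"
      by (simp add: exp_minus_inverse)
    then have "exp (\<mu> * of_real t) *\<^sub>C G (- t) = h t"
      unfolding G_def scaleC_scaleC by simp
    ultimately show ?thesis by (simp add: v_def scaleC_scaleC add.commute)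
  qed
  moreover have "norm (v t) \<le> B / - Re \<mu>" for t
  proof -
    have "norm (v t) \<le> exp (Re \<mu> * t) * (exp (Re \<mu> * - t) / - Re \<mu> * B)"
      unfolding v_def norm_scaleC using mult_left_mono[OF normK[of "- t"], of "exp (Re \<mu> * t)"]
      by simp
    also have "\<dots> = (exp (Re \<mu> * t) * exp (Re \<mu> * - t)) * (B / - Re \<mu>)" by simp
    also have "exp (Re \<mu> * t) * exp (Re \<mu> * - t) = 1" by (simp flip: exp_add)
    finally show ?thesis by simp
  qed
  then have "bounded (range v)" unfolding bounded_iff by auto
  ultimately show ?thesis using that unfolding bounded_solution_def by auto
qed

text \<open>By the fundamental theorem,
\<open>v t = exp (\<mu> N) v (t - N) + \<integral>\<^sub>0\<^sup>N exp (\<mu> s) h (t - s) ds\<close> for every \<open>N\<close>. The first term vanishes as \<open>N\<close>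
grows because \<open>v\<close> is bounded.\<close>

lemma bounded_solution_estimate:
  fixes h :: "real \<Rightarrow> 'e::complex_banach"
  assumes \<mu>: "Re \<mu> < 0" and v: "bounded_solution \<mu> h v"
    and h: "continuous_on UNIV h" "bounded (range h)"
  shows "norm (v t) \<le> (\<integral>s. exp_kernel \<mu> s * norm (h (t - s)) \<partial>lborel)"
proof -
  obtain B where B: "\<And>t. norm (h t) \<le> B" using h(2) unfolding bounded_iff by auto
  obtain V where V: "\<And>t. norm (v t) \<le> V"
    using v unfolding bounded_solution_def bounded_iff by auto
  define w where "w s = exp (\<mu> * of_real s) *\<^sub>C v (t - s)" for s
  define g where "g s = exp (\<mu> * of_real s) *\<^sub>C h (t - s)" for s
  define I where "I = (\<integral>s. exp_kernel \<mu> s * norm (h (t - s)) \<partial>lborel)"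
  have conth: "continuous_on A (\<lambda>s. h (t - s))" for A
    by (rule continuous_on_compose2[OF h(1)]) (auto intro!: continuous_intros)
  have contg: "continuous_on A g" for A
    unfolding g_def by (intro scaleC.continuous_on continuous_intros conth)
  have int: "integrable lborel (\<lambda>s. exp_kernel \<mu> s * norm (h (t - s)))"
    by (rule weighted_dominated_convergence(2)[OF exp_kernel_integral(1)[OF \<mu>],
          where h = "\<lambda>_ s. norm (h (t - s))" and h' = "\<lambda>s. norm (h (t - s))" and B = B])
       (auto simp: B intro!: borel_measurable_continuous_onI continuous_on_norm conth)
  have "norm (v t) \<le> exp (Re \<mu> * real N) * V + I" for N :: nat
  proof -
    have dw: "(w has_vector_derivative - g s) (at s)" for s
    proof -
      have "(v has_vector_derivative \<mu> *\<^sub>C v t + h t) (at t)" for t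
        using v unfolding bounded_solution_def by auto
      from has_vector_derivative_affine[OF this, of "-1" t s]
      have "((\<lambda>s. v (t - s)) has_vector_derivative - (\<mu> *\<^sub>C v (t - s) + h (t - s))) (at s)"
        by simp
      from has_vector_derivative_exp_scaleC[OF this, of \<mu>] show ?thesis
        by (simp add: w_def[abs_def] g_def scaleC.diff_right scaleC.minus_right scaleC_scaleC mult.commute)
    qed
    have "((\<lambda>s. - g s) has_integral (w (real N) - w 0)) {0..real N}"
      by (rule fundamental_theorem_of_calculus) (auto intro: has_vector_derivative_at_within dw)
    then have "v t = w (real N) + integral {0..real N} g"
      using has_integral_neg[of "\<lambda>s. - g s" "w (real N) - w 0" "{0..real N}"]
      by (simp add: w_def integral_unique)
    also have "norm \<dots> \<le> norm (w (real N)) + norm (integral {0..real N} g)"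
      by (rule norm_triangle_ineq)
    also have "norm (w (real N)) \<le> exp (Re \<mu> * real N) * V"
      unfolding w_def norm_scaleC using mult_left_mono[OF V[of "t - N"], of "exp (Re \<mu> * real N)"]
      by simp
    also have "norm (integral {0..real N} g)
        \<le> integral {0..real N} (\<lambda>s. exp_kernel \<mu> s * norm (h (t - s)))"
    proof (rule integral_norm_bound_integral)
      show "g integrable_on {0..real N}" by (intro integrable_continuous_real contg)
      show "(\<lambda>s. exp_kernel \<mu> s * norm (h (t - s))) integrable_on {0..real N}"
        by (rule integrable_on_subinterval[OF integrable_on_lborel[OF int]]) simp
    qed (auto simp: g_def norm_scaleC exp_kernel_def)
    also have "\<dots> \<le> integral UNIV (\<lambda>s. exp_kernel \<mu> s * norm (h (t - s)))"
      by (rule integral_subset_le) (auto simp: exp_kernel_nonneg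
          intro: integrable_on_lborel[OF int] integrable_on_subinterval[OF integrable_on_lborel[OF int]])
    also have "\<dots> = I" unfolding I_def by (rule integral_lborel[OF int])
    finally show ?thesis by simp
  qed
  moreover have "(\<lambda>N. exp (Re \<mu> * real N) * V + I) \<longlonglongrightarrow> 0 * V + I"
  proof (intro tendsto_intros)
    have "(\<lambda>N. exp (Re \<mu>) ^ N) \<longlonglongrightarrow> 0" using \<mu> by (intro LIMSEQ_realpow_zero) auto
    then show "(\<lambda>N. exp (Re \<mu> * real N)) \<longlonglongrightarrow> 0"
      by (simp add: exp_of_nat_mult[symmetric] mult.commute)
  qed
  ultimately have "norm (v t) \<le> 0 * V + I"
    by (intro LIMSEQ_le_const[of _ "0 * V + I" "norm (v t)"]) auto
  then show ?thesis by (simp add: I_def)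
qed

lemma bounded_solution_norm:
  assumes \<mu>: "Re \<mu> < 0" and v: "bounded_solution \<mu> h v"
    and h: "continuous_on UNIV h" and B: "\<And>t. norm (h t) \<le> B"
  shows "norm (v t) \<le> B / - Re \<mu>"
proof -
  have hb: "bounded (range h)" using B unfolding bounded_iff by auto
  have conth: "continuous_on A (\<lambda>s. h (t - s))" for A
    by (rule continuous_on_compose2[OF h(1)]) (auto intro!: continuous_intros)
  have "norm (v t) \<le> (\<integral>s. exp_kernel \<mu> s * norm (h (t - s)) \<partial>lborel)"
    by (rule bounded_solution_estimate[OF \<mu> v h hb])
  also have "\<dots> \<le> (\<integral>s. exp_kernel \<mu> s * B \<partial>lborel)"
  proof (rule integral_mono)
    show "integrable lborel (\<lambda>s. exp_kernel \<mu> s * norm (h (t - s)))"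
      by (rule weighted_dominated_convergence(2)[OF exp_kernel_integral(1)[OF \<mu>],
            where h = "\<lambda>_ s. norm (h (t - s))" and h' = "\<lambda>s. norm (h (t - s))" and B = B])
         (auto simp: B intro!: borel_measurable_continuous_onI continuous_on_norm conth)
    show "exp_kernel \<mu> s * norm (h (t - s)) \<le> exp_kernel \<mu> s * B" for s
      using B exp_kernel_nonneg by (intro mult_left_mono)
  qed (use exp_kernel_integral[OF \<mu>] in auto)
  also have "\<dots> = (\<integral>s. exp_kernel \<mu> s \<partial>lborel) * B" by (rule integral_mult_left_zero)
  finally show ?thesis using exp_kernel_integral[OF \<mu>] by simp
qed

lemma bounded_solution_diff:
  assumes "bounded_solution \<mu> h v" "bounded_solution \<mu> g w"
  shows "bounded_solution \<mu> (\<lambda>t. h t - g t) (\<lambda>t. v t - w t)"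
  using assms unfolding bounded_solution_def
  by (auto intro!: derivative_eq_intros bounded_minus_comp simp: scaleC.diff_right)

lemma bounded_solution_add:
  assumes "bounded_solution \<mu> h v" "bounded_solution \<mu> g w"
  shows "bounded_solution \<mu> (\<lambda>t. h t + g t) (\<lambda>t. v t + w t)"
  using assms unfolding bounded_solution_def
  by (auto intro!: derivative_eq_intros bounded_plus_comp simp: scaleC_add_right)

lemma bounded_solution_complex_linear:
  assumes L: "complex_linear L" and v: "bounded_solution \<mu> h v"
  shows "bounded_solution \<mu> (\<lambda>t. L (h t)) (\<lambda>t. L (v t))"
proof -
  have "((\<lambda>t. L (v t)) has_vector_derivative L (\<mu> *\<^sub>C v t + h t)) (at t)" for t
    by (rule bounded_linear.has_vector_derivative[OF complex_linearD(1)[OF L]])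
      (use v in \<open>auto simp: bounded_solution_def\<close>)
  moreover have "bounded (range (\<lambda>t. L (v t)))"
    using bounded_linear_image[OF _ complex_linearD(1)[OF L], of "range v"] v
    by (simp add: bounded_solution_def image_image)
  ultimately show ?thesis
    by (simp add: bounded_solution_def complex_linearD(2,3)[OF L])
qed

lemma bounded_solution_translate:
  assumes v: "bounded_solution \<mu> h v"
  shows "bounded_solution \<mu> (\<lambda>t. h (t + x)) (\<lambda>t. v (t + x))"
proof -
  have "(v has_vector_derivative \<mu> *\<^sub>C v t + h t) (at t)" for t
    using v by (simp add: bounded_solution_def)
  from has_vector_derivative_affine[OF this, of 1 x] show ?thesis
    using v bounded_subset[of "range v" "range (\<lambda>t. v (t + x))"]
    by (auto simp: bounded_solution_def)
qed

lemma bounded_solution_unique: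
  assumes \<mu>: "Re \<mu> < 0" and "bounded_solution \<mu> h v" "bounded_solution \<mu> h w"
  shows "v = w"
proof
  fix t
  have "bounded_solution \<mu> (\<lambda>t. 0) (\<lambda>t. v t - w t)"
    using bounded_solution_diff[OF assms(2,3)] by simp
  from bounded_solution_norm[OF \<mu> this, of 0 t] show "v t = w t" by simp
qed

lemma bounded_solution_continuous:
  "bounded_solution \<mu> h v \<Longrightarrow> continuous_on A v"
  unfolding bounded_solution_def
  by (meson continuous_at_imp_continuous_on has_vector_derivative_continuous)

text \<open>The difference of two translates of \<open>v\<close> is the bounded solution for the difference of the
corresponding translates of \<open>h\<close>, so the estimate has exactly the form that \<open>almost_transfer\<close> needs.\<close>

lemma bounded_solution_almost:
  assumes \<mu>: "Re \<mu> < 0" and v: "bounded_solution \<mu> h v" and h: "h \<in> almost \<kappa>"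
  shows "v \<in> almost \<kappa>"
proof (rule almost_transfer[OF h exp_kernel_integral(1)[OF \<mu>] exp_kernel_nonneg])
  fix x y
  have conth: "continuous_on UNIV (\<lambda>t. h (t + x))" for x
    by (rule continuous_on_compose2[OF almost_continuous[OF h]]) (auto intro!: continuous_intros)
  have bh: "bounded (range (\<lambda>t. h (t + x)))" for x
    by (rule bounded_subset[OF almost_bounded[OF h]]) auto
  have "norm ((\<lambda>t. v (t + x) - v (t + y)) 0)
      \<le> (\<integral>s. exp_kernel \<mu> s * norm (h (0 - s + x) - h (0 - s + y)) \<partial>lborel)"
    by (rule bounded_solution_estimate[OF \<mu> bounded_solution_diff[OF
          bounded_solution_translate[OF v, of x] bounded_solution_translate[OF v, of y]]])
      (intro continuous_intros conth bounded_minus_comp bh)+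
  then show "norm (v x - v y) \<le> (\<integral>s. exp_kernel \<mu> s * norm (h (x - s) - h (y - s)) \<partial>lborel)"
    by simp
qed

lemma bounded_solution_vanishing:
  assumes \<mu>: "Re \<mu> < 0" and v: "bounded_solution \<mu> h v"
    and h: "continuous_on UNIV h" "bounded (range h)" and lim: "(h \<longlongrightarrow> 0) at_top"
  shows "(v \<longlongrightarrow> 0) at_top"
proof (rule tendsto_at_topI_sequentially)
  fix X :: "nat \<Rightarrow> real" assume X: "filterlim X at_top sequentially"
  obtain B where B: "\<And>t. norm (h t) \<le> B" using h(2) unfolding bounded_iff by auto
  have conth: "continuous_on A (\<lambda>s. h (t - s))" for A t
    by (rule continuous_on_compose2[OF h(1)]) (auto intro!: continuous_intros)
  have "(\<lambda>n. \<integral>s. exp_kernel \<mu> s * norm (h (X n - s)) \<partial>lborel)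
      \<longlonglongrightarrow> (\<integral>s. exp_kernel \<mu> s * 0 \<partial>lborel)"
  proof (rule weighted_dominated_convergence(1)[where B = B, OF exp_kernel_integral(1)[OF \<mu>]])
    show "(\<lambda>n. norm (h (X n - s))) \<longlonglongrightarrow> 0" for s
    proof (intro tendsto_norm_zero filterlim_compose[OF lim])
      show "filterlim (\<lambda>n. X n - s) at_top sequentially"
        using filterlim_tendsto_add_at_top[OF tendsto_const X, of "- s"] by (simp add: add.commute)
    qed
  qed (auto simp: B intro!: borel_measurable_continuous_onI continuous_on_norm conth)
  then show "(\<lambda>n. v (X n)) \<longlonglongrightarrow> 0"
    by (intro Lim_null_comparison[OF always_eventually[OF allI, OF bounded_solution_estimate[OF \<mu> v h]]])
      simp
qed

section \<open>Annihilating products for a stable matrix\<close>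

primrec shift_prod :: "('e \<Rightarrow> 'e) \<Rightarrow> complex list \<Rightarrow> 'e \<Rightarrow> 'e::complex_banach" where
  "shift_prod \<Lambda> [] y = y"
| "shift_prod \<Lambda> (\<mu> # \<mu>s) y = shift_prod \<Lambda> \<mu>s (\<Lambda> y - \<mu> *\<^sub>C y)"

lemma complex_linear_shift:
  "complex_linear \<Lambda> \<Longrightarrow> complex_linear (\<lambda>y. \<Lambda> y - \<mu> *\<^sub>C y)"
  using complex_linear_add[OF _ complex_linear_scale[of "- \<mu>"], of \<Lambda>] by (simp add: scaleC.minus_left)

lemma complex_linear_shift_prod:
  "complex_linear \<Lambda> \<Longrightarrow> complex_linear (shift_prod \<Lambda> \<mu>s)"
proof (induction \<mu>s)
  case Nil
  then show ?case by (simp add: complex_linear_def bounded_linear_ident)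
next
  case (Cons \<mu> \<mu>s)
  then show ?case
    using complex_linear_compose[OF Cons.IH[OF Cons.prems] complex_linear_shift[OF Cons.prems, of \<mu>]]
    by simp
qed

definition poly_act :: "('e \<Rightarrow> 'e) \<Rightarrow> complex poly \<Rightarrow> 'e \<Rightarrow> 'e::complex_banach" where
  "poly_act \<Lambda> p y = (\<Sum>k\<le>degree p. coeff p k *\<^sub>C (\<Lambda> ^^ k) y)"

lemma poly_act_eq:
  assumes "degree p \<le> n"
  shows "poly_act \<Lambda> p y = (\<Sum>k\<le>n. coeff p k *\<^sub>C (\<Lambda> ^^ k) y)"
  unfolding poly_act_def
proof (rule sum.mono_neutral_left)
  show "\<forall>i\<in>{..n} - {..degree p}. coeff p i *\<^sub>C (\<Lambda> ^^ i) y = 0"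
    by (auto simp: coeff_eq_0 scaleC.zero_left)
qed (use assms in auto)

lemma complex_linear_funpow:
  fixes \<Lambda> :: "'e::complex_banach \<Rightarrow> 'e"
  shows "complex_linear \<Lambda> \<Longrightarrow> complex_linear (\<Lambda> ^^ k)"
proof (induction k)
  case 0
  have "(\<Lambda> ^^ 0) = (\<lambda>x. x)" by auto
  then show ?case by (simp only: complex_linear_def bounded_linear_ident simp_thms)
next
  case (Suc k)
  then show ?case using complex_linear_compose[OF Suc.prems Suc.IH] by (simp add: o_def)
qed

lemma complex_linear_poly_act:
  assumes "complex_linear \<Lambda>"
  shows "complex_linear (poly_act \<Lambda> p)"
  unfolding poly_act_def[abs_def]
  by (intro complex_linear_sum complex_linear_compose[OF complex_linear_scale]
      complex_linear_funpow assms)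

lemma poly_act_linear_factor:
  assumes \<Lambda>: "complex_linear \<Lambda>"
  shows "poly_act \<Lambda> ([:- \<mu>, 1:] * q) y = poly_act \<Lambda> q (\<Lambda> y) - \<mu> *\<^sub>C poly_act \<Lambda> q y"
proof -
  have eq: "[:- \<mu>, 1:] * q = pCons 0 q - smult \<mu> q" by simp
  have "degree ([:- \<mu>, 1:] * q) \<le> Suc (degree q)"
    using degree_mult_le[of "[:- \<mu>, 1:]" q] by simp
  then have "poly_act \<Lambda> ([:- \<mu>, 1:] * q) y
      = (\<Sum>k\<le>Suc (degree q). coeff ([:- \<mu>, 1:] * q) k *\<^sub>C (\<Lambda> ^^ k) y)"
    by (rule poly_act_eq)
  also have "\<dots> = (\<Sum>k\<le>Suc (degree q). coeff (pCons 0 q) k *\<^sub>C (\<Lambda> ^^ k) y)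
      - (\<Sum>k\<le>Suc (degree q). \<mu> *\<^sub>C coeff q k *\<^sub>C (\<Lambda> ^^ k) y)"
    unfolding eq by (simp only: coeff_diff coeff_smult scaleC.diff_left sum_subtractf scaleC_scaleC)
  also have "(\<Sum>k\<le>Suc (degree q). coeff (pCons 0 q) k *\<^sub>C (\<Lambda> ^^ k) y) = poly_act \<Lambda> q (\<Lambda> y)"
    by (simp only: sum.atMost_Suc_shift coeff_pCons_Suc coeff_pCons_0 scaleC.zero_left
        poly_act_def funpow_Suc_right o_apply add_0_left)
  also have "(\<Sum>k\<le>Suc (degree q). \<mu> *\<^sub>C coeff q k *\<^sub>C (\<Lambda> ^^ k) y) = \<mu> *\<^sub>C poly_act \<Lambda> q y"
    by (simp only: scaleC.sum_right[symmetric] poly_act_eq[of q "Suc (degree q)"] le_SucI order_refl)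
  finally show ?thesis .
qed

lemma poly_act_commute:
  assumes \<Lambda>: "complex_linear \<Lambda>"
  shows "poly_act \<Lambda> q (\<Lambda> y) = \<Lambda> (poly_act \<Lambda> q y)"
proof -
  interpret bounded_linear \<Lambda> using complex_linearD(1)[OF \<Lambda>] .
  show ?thesis
    by (simp add: poly_act_def sum complex_linearD(2)[OF \<Lambda>] funpow_swap1)
qed

text \<open>A linear factor \<open>\<Lambda> - \<mu>\<close> of an annihilating polynomial can be cancelled when it is injective, which is
the case for \<open>Re \<mu> \<ge> 0\<close>. The map \<open>B\<close> accumulates the factors that were already split off, so that the
induction on the degree goes through.\<close>

lemma annihilating_shifts:
  assumes \<Lambda>: "complex_linear \<Lambda>"
    and inj: "\<And>\<mu> y. Re \<mu> \<ge> 0 \<Longrightarrow> \<Lambda> y = \<mu> *\<^sub>C y \<Longrightarrow> y = 0"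
    and "p \<noteq> 0" "\<And>y. poly_act \<Lambda> p (B y) = 0"
  shows "\<exists>\<mu>s. (\<forall>\<mu>\<in>set \<mu>s. Re \<mu> < 0) \<and> (\<forall>y. shift_prod \<Lambda> \<mu>s (B y) = 0)"
  using assms(3,4)
proof (induction "degree p" arbitrary: p B)
  case 0
  then obtain c where p: "p = [:c:]" by (metis degree_eq_zeroE)
  then have "c \<noteq> 0" using 0 by simp
  have "B y = 0" for y
  proof -
    have "c *\<^sub>C B y = 0" using 0(3)[of y] p by (simp add: poly_act_def)
    then have "inverse c *\<^sub>C c *\<^sub>C B y = 0" by (simp add: scaleC.zero_right)
    then show ?thesis using \<open>c \<noteq> 0\<close> by (simp add: scaleC_scaleC)
  qed
  then show ?case by (intro exI[of _ "[]"]) simp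
next
  case (Suc n)
  have "\<not> constant (poly p)" using Suc.hyps(2) by (simp add: constant_degree)
  then obtain \<mu> where "poly p \<mu> = 0" using fundamental_theorem_of_algebra by blast
  then obtain q where q: "p = [:- \<mu>, 1:] * q" unfolding poly_eq_0_iff_dvd by blast
  have "q \<noteq> 0" using q Suc by auto
  then have n: "n = degree q" using Suc.hyps(2) degree_mult_eq[of "[:- \<mu>, 1:]" q] by (simp add: q)
  have act: "poly_act \<Lambda> p (B y) = poly_act \<Lambda> q (\<Lambda> (B y)) - \<mu> *\<^sub>C poly_act \<Lambda> q (B y)" for y
    unfolding q by (rule poly_act_linear_factor[OF \<Lambda>])
  show ?case
  proof (cases "Re \<mu> < 0")
    case True
    have "poly_act \<Lambda> q (\<Lambda> (B y) - \<mu> *\<^sub>C B y) = 0" for y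
      using act[of y] Suc.prems(2)[of y]
      by (simp only: complex_linearD(2,4)[OF complex_linear_poly_act[OF \<Lambda>]])
    from Suc.hyps(1)[where B = "\<lambda>y. \<Lambda> (B y) - \<mu> *\<^sub>C B y", OF n \<open>q \<noteq> 0\<close> this]
    obtain \<mu>s where "\<forall>\<mu>\<in>set \<mu>s. Re \<mu> < 0"
      "\<forall>y. shift_prod \<Lambda> \<mu>s (\<Lambda> (B y) - \<mu> *\<^sub>C B y) = 0" by (elim exE conjE)
    then show ?thesis using True by (intro exI[of _ "\<mu> # \<mu>s"]) simp
  next
    case False
    have "poly_act \<Lambda> q (B y) = 0" for y
      using inj[of \<mu> "poly_act \<Lambda> q (B y)"] False act[of y] Suc.prems(2)[of y]
      by (simp add: poly_act_commute[OF \<Lambda>])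
    from Suc.hyps(1)[where B = B, OF n \<open>q \<noteq> 0\<close> this] show ?thesis .
  qed
qed

lemma mat_act_mult: "mat_act (A ** B) y = mat_act A (mat_act B y :: 'a::complex_banach ^ 'n)"
proof -
  have "(\<Sum>j\<in>UNIV. (\<Sum>k\<in>UNIV. A $ i $ k * B $ k $ j) *\<^sub>C y $ j)
      = (\<Sum>k\<in>UNIV. A $ i $ k *\<^sub>C (\<Sum>j\<in>UNIV. B $ k $ j *\<^sub>C y $ j))" for i
    unfolding scaleC.sum_left scaleC.sum_right scaleC_scaleC by (rule sum.swap)
  then show ?thesis by (simp add: mat_act_def matrix_matrix_mult_def vec_eq_iff)
qed

lemma mat_act_mat: "mat_act (mat c) y = c *\<^sub>C (y :: 'a::complex_banach ^ 'n)"
proof -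
  have "(if i = j then c else 0) *\<^sub>C y $ j = (if i = j then c *\<^sub>C y $ i else 0)" for i j
    by (simp add: scaleC.zero_left)
  then show ?thesis by (simp add: mat_act_def mat_def scaleC_vec_def vec_eq_iff)
qed

lemma mat_act_add_left: "mat_act (A + B) y = mat_act A y + mat_act B (y :: 'a::complex_banach ^ 'n)"
  and mat_act_diff_left: "mat_act (A - B) y = mat_act A y - mat_act B (y :: 'a::complex_banach ^ 'n)"
  unfolding mat_act_def vec_eq_iff vector_add_component vector_minus_component vec_lambda_beta
    scaleC_add_left scaleC.diff_left sum.distrib sum_subtractf by auto

lemma mat_act_sum_left:
  "mat_act (\<Sum>k\<in>I. c k *\<^sub>R f k) y
    = (\<Sum>k\<in>I. complex_of_real (c k) *\<^sub>C mat_act (f k) (y :: 'a::complex_banach ^ 'n))"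
proof -
  have scale: "mat_act (r *\<^sub>R B) y = complex_of_real r *\<^sub>C mat_act B y" for r and B :: "complex ^ 'n ^ 'm"
    unfolding mat_act_def vec_eq_iff scaleC_vec_def vec_lambda_beta vector_scaleR_component
    unfolding scaleR_conv_of_real scaleC.sum_right scaleC_scaleC by simp
  have "mat_act 0 y = (0 :: 'a ^ 'm)" by (simp add: mat_act_def vec_eq_iff scaleC.zero_left)
  then show ?thesis
    by (induction I rule: infinite_finite_induct) (simp_all add: mat_act_add_left scale)
qed

lemma linear_relation_among:
  fixes f :: "nat \<Rightarrow> 'v::euclidean_space"
  shows "\<exists>c. (\<exists>k\<le>DIM('v). c k \<noteq> 0) \<and> (\<Sum>k\<le>DIM('v). c k *\<^sub>R f k) = 0"
proof (cases "inj_on f {..DIM('v)}")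
  case True
  then have "dependent (f ` {..DIM('v)})"
    by (intro dependent_biggerset) (simp add: card_image)
  then obtain u where "\<exists>v\<in>f ` {..DIM('v)}. u v \<noteq> 0" "(\<Sum>v\<in>f ` {..DIM('v)}. u v *\<^sub>R v) = 0"
    by (auto simp: dependent_finite)
  with True show ?thesis by (intro exI[of _ "\<lambda>k. u (f k)"]) (auto simp: sum.reindex)
next
  case False
  then obtain i j where ij: "i \<le> DIM('v)" "j \<le> DIM('v)" "i \<noteq> j" "f i = f j"
    by (auto simp: inj_on_def)
  define c where "c k = (if k = i then 1 else 0) - (if k = j then 1 else (0::real))" for k
  have "(\<Sum>k\<le>DIM('v). c k *\<^sub>R f k)
      = (\<Sum>k\<le>DIM('v). if k = i then f i else 0) - (\<Sum>k\<le>DIM('v). if k = j then f j else 0)"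
    unfolding sum_subtractf[symmetric] by (rule sum.cong) (auto simp: c_def)
  also have "\<dots> = 0" using ij by simp
  finally show ?thesis using ij by (intro exI[of _ c]) (auto simp: c_def)
qed

text \<open>Among \<open>DIM + 1\<close> powers of \<open>A\<close> there is a real linear relation, which is a nonzero annihilating
polynomial.\<close>

lemma stable_matrix_annihilated:
  fixes A :: "complex ^ 'n ^ 'n"
  assumes stable: "mat_spectrum A \<subseteq> {z. Re z < 0}"
  obtains \<mu>s where "\<And>\<mu>. \<mu> \<in> set \<mu>s \<Longrightarrow> Re \<mu> < 0"
    "\<And>y :: 'a::complex_banach ^ 'n. shift_prod (mat_act A) \<mu>s y = 0"
proof -
  let ?\<Lambda> = "mat_act A :: 'a ^ 'n \<Rightarrow> 'a ^ 'n"
  define f where "f k = ((**) A ^^ k) (mat 1)" for k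
  define N where "N = DIM(complex ^ 'n ^ 'n)"
  obtain c where c: "\<exists>k\<le>N. c k \<noteq> 0" "(\<Sum>k\<le>N. c k *\<^sub>R f k) = 0"
    using linear_relation_among[of f] unfolding N_def by blast
  define p where "p = (\<Sum>k\<le>N. monom (complex_of_real (c k)) k)"
  have coeff: "coeff p k = (if k \<le> N then of_real (c k) else 0)" for k
    unfolding p_def by (simp add: coeff_sum)
  have "p \<noteq> 0" using c(1) coeff by (metis coeff_0 of_real_eq_0_iff)
  have deg: "degree p \<le> N" by (rule degree_le) (simp add: coeff)
  have fk: "(?\<Lambda> ^^ k) y = mat_act (f k) y" for k y
    by (induction k) (simp_all add: f_def mat_act_mat mat_act_mult)
  have "poly_act ?\<Lambda> p y = mat_act (\<Sum>k\<le>N. c k *\<^sub>R f k) y" for y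
    unfolding poly_act_eq[OF deg] mat_act_sum_left fk by (simp add: coeff)
  then have act: "poly_act ?\<Lambda> p y = 0" for y
    using c(2) by (simp add: mat_act_def vec_eq_iff scaleC.zero_left)
  have inj: "y = 0" if "Re \<mu> \<ge> 0" "?\<Lambda> y = \<mu> *\<^sub>C y" for \<mu> y
  proof -
    have "invertible (mat \<mu> - A)" using that(1) stable unfolding mat_spectrum_def by force
    then obtain B where B: "B ** (mat \<mu> - A) = mat 1" unfolding invertible_def by blast
    have "y = mat_act (B ** (mat \<mu> - A)) y" by (simp add: B mat_act_mat)
    also have "\<dots> = mat_act B (\<mu> *\<^sub>C y - ?\<Lambda> y)"
      by (simp only: mat_act_mult mat_act_diff_left mat_act_mat)
    finally show ?thesis using that(2) complex_linearD(5)[OF complex_linear_mat_act[of B]] by simp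
  qed
  have "\<exists>\<mu>s. (\<forall>\<mu>\<in>set \<mu>s. Re \<mu> < 0) \<and> (\<forall>y. shift_prod ?\<Lambda> \<mu>s y = 0)"
    by (rule annihilating_shifts[where B = "\<lambda>y. y", OF complex_linear_mat_act inj \<open>p \<noteq> 0\<close> act])
  then show ?thesis using that by auto
qed

section \<open>Systems with forcing terms in a solvable class\<close>

text \<open>Only the values on \<open>[0, \<infinity>)\<close> matter for the equation; continuing the exponential by a constant keeps it
bounded and continuous on the line.\<close>

definition half_exp :: "complex \<Rightarrow> 'e::complex_banach \<Rightarrow> real \<Rightarrow> 'e" where
  "half_exp \<mu> c t = exp (\<mu> * of_real (max t 0)) *\<^sub>C c"

lemma integrable_compact_support:
  fixes f :: "real \<Rightarrow> 'e::banach"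
  assumes "continuous_on UNIV f" "\<And>t. t \<notin> {-r..r} \<Longrightarrow> f t = 0"
  shows "f integrable_on UNIV"
  by (rule integrable_on_superset[where S = "{-r..r}"])
     (use assms in \<open>auto intro: integrable_continuous_real continuous_on_subset\<close>)

text \<open>A space \<open>S\<close> of compactly supported test functions inside a space \<open>L\<close> whose dual contains the classes.
The derivative of an ultradifferentiable test function of a rapidly growing class can lie outside the
space, whereas products with exponentials and primitives stay inside.\<close>

locale test_pair =
  fixes S L :: lcs
  assumes S_subset: "carrier S \<subseteq> carrier L"
    and S_space: "function_space (carrier S)"
    and S_smooth: "\<phi> \<in> carrier S \<Longrightarrow> smooth \<phi>"
    and S_compact: "\<phi> \<in> carrier S \<Longrightarrow> \<exists>r. \<forall>t. t \<notin> {-r..r} \<longrightarrow> \<phi> t = 0"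
    and S_exp: "\<phi> \<in> carrier S \<Longrightarrow> (\<lambda>t. exp (\<mu> * of_real t) * \<phi> t) \<in> carrier S"
    and S_primitive: "\<psi> \<in> positive_part S \<Longrightarrow> integral UNIV \<psi> = 0 \<Longrightarrow>
      \<exists>\<eta>\<in>positive_part S. nderiv 1 \<eta> = \<psi>"
begin

lemma positive_part_iff: "\<phi> \<in> positive_part S \<longleftrightarrow> \<phi> \<in> carrier S \<and> (\<forall>t<0. \<phi> t = 0)"
  unfolding positive_part_def
  using not_in_supp[of _ \<phi>] supp_subsetI[of "{0..}" \<phi>] by force

lemma S_integrable: "\<phi> \<in> carrier S \<Longrightarrow> \<phi> integrable_on UNIV"
  using S_compact[of \<phi>] integrable_compact_support[of \<phi>] continuous_on_nderiv[OF S_smooth, of \<phi> UNIV 0]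
  by auto

lemma S_add: "\<phi> \<in> carrier S \<Longrightarrow> \<psi> \<in> carrier S \<Longrightarrow> (\<lambda>t. \<phi> t + \<psi> t) \<in> carrier S"
  and S_cmult: "\<phi> \<in> carrier S \<Longrightarrow> (\<lambda>t. c * \<phi> t) \<in> carrier S"
  using S_space unfolding function_space_def by auto

lemma positive_part_exp:
  "\<phi> \<in> positive_part S \<Longrightarrow> (\<lambda>t. exp (\<mu> * of_real t) * \<phi> t) \<in> positive_part S"
  unfolding positive_part_iff using S_exp by auto

text \<open>The functional \<open>V \<psi> = W (exp (- \<mu> t) \<psi>)\<close> vanishes on every \<open>\<psi>\<close> with integral \<open>0\<close>, since \<open>\<psi> = \<eta>'\<close> and
\<open>X = exp (- \<mu> t) \<eta>\<close> has the derivative \<open>exp (- \<mu> t) \<psi> - \<mu> X\<close>. So \<open>V\<close> is a multiple of the integral.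
If all test functions have integral \<open>0\<close>, then \<open>V\<close> vanishes and the constant \<open>0\<close> will do.\<close>

lemma exponential_if_eigenfunctional:
  fixes W :: "(real \<Rightarrow> complex) \<Rightarrow> 'e::complex_banach"
  assumes lin: "linear_functional (carrier S) W"
    and W: "\<And>\<phi>. \<phi> \<in> positive_part S \<Longrightarrow> nderiv 1 \<phi> \<in> carrier S \<Longrightarrow> dist_deriv W \<phi> = \<mu> *\<^sub>C W \<phi>"
  obtains c where "\<And>\<phi>. \<phi> \<in> positive_part S \<Longrightarrow> W \<phi> = regular (half_exp \<mu> c) \<phi>"
proof -
  have W_add: "W (\<lambda>t. \<phi> t + \<psi> t) = W \<phi> + W \<psi>" and W_mult: "W (\<lambda>t. c * \<phi> t) = c *\<^sub>C W \<phi>"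
    if "\<phi> \<in> carrier S" "\<psi> \<in> carrier S" for \<phi> \<psi> c
    using lin that unfolding linear_functional_def by auto
  define V where "V \<psi> = W (\<lambda>t. exp (- \<mu> * of_real t) * \<psi> t)" for \<psi>
  have V_zero: "V \<psi> = 0" if \<psi>: "\<psi> \<in> positive_part S" and int: "integral UNIV \<psi> = 0" for \<psi>
  proof -
    obtain \<eta> where \<eta>: "\<eta> \<in> positive_part S" "nderiv 1 \<eta> = \<psi>" using S_primitive[OF \<psi> int] by blast
    define X where "X t = exp (- \<mu> * of_real t) * \<eta> t" for t
    define P where "P t = exp (- \<mu> * of_real t) * \<psi> t" for t
    have X: "X \<in> positive_part S" unfolding X_def by (rule positive_part_exp[OF \<eta>(1)])
    have P: "P \<in> positive_part S" unfolding P_def by (rule positive_part_exp[OF \<psi>])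
    have XP: "X \<in> carrier S" "P \<in> carrier S" using X P by (auto simp: positive_part_iff)
    have "nderiv 1 X = (\<lambda>t. exp (- \<mu> * of_real t) * exp_twist (- \<mu>) \<eta> 1 t)"
      unfolding X_def by (rule nderiv_exp_mult) (use \<eta> S_smooth in \<open>auto simp: positive_part_iff\<close>)
    also have "\<dots> = (\<lambda>t. P t + (- \<mu>) * X t)"
      using \<eta>(2) by (simp add: X_def P_def algebra_simps)
    finally have D: "nderiv 1 X = (\<lambda>t. P t + (- \<mu>) * X t)" .
    have "nderiv 1 X \<in> carrier S" unfolding D by (rule S_add[OF XP(2) S_cmult[OF XP(1)]])
    from W[OF X this] have "- W (\<lambda>t. P t + (- \<mu>) * X t) = \<mu> *\<^sub>C W X"
      unfolding dist_deriv_def D .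
    moreover have "W (\<lambda>t. P t + (- \<mu>) * X t) = W P + (- \<mu>) *\<^sub>C W X"
      unfolding W_add[OF XP(2) S_cmult[OF XP(1)]] W_mult[OF XP] by (rule refl)
    ultimately have "W P = 0" by (simp add: scaleC.minus_left)
    then show ?thesis by (simp add: V_def P_def[abs_def])
  qed
  have "\<exists>c. \<forall>\<psi>\<in>positive_part S. V \<psi> = integral UNIV \<psi> *\<^sub>C c"
  proof (cases "\<exists>\<rho>\<in>positive_part S. integral UNIV \<rho> \<noteq> 0")
    case False
    then show ?thesis using V_zero by (intro exI[of _ 0]) (auto simp: scaleC.zero_right)
  next
    case True
    then obtain \<rho> where \<rho>: "\<rho> \<in> positive_part S" "integral UNIV \<rho> \<noteq> 0" by blast
    have "V \<psi> = integral UNIV \<psi> *\<^sub>C inverse (integral UNIV \<rho>) *\<^sub>C V \<rho>"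
      if \<psi>: "\<psi> \<in> positive_part S" for \<psi>
    proof -
      define a where "a = - integral UNIV \<psi> / integral UNIV \<rho>"
      have C: "\<psi> \<in> carrier S" "\<rho> \<in> carrier S" using \<psi> \<rho> by (auto simp: positive_part_iff)
      have "(\<lambda>t. \<psi> t + a * \<rho> t) \<in> positive_part S"
        using \<psi> \<rho>(1) S_add[OF C(1) S_cmult[OF C(2), of a]] by (simp add: positive_part_iff)
      moreover have "integral UNIV (\<lambda>t. \<psi> t + a * \<rho> t) = integral UNIV \<psi> + a * integral UNIV \<rho>"
        using S_integrable[OF C(1)] S_integrable[OF C(2)]
        by (subst Henstock_Kurzweil_Integration.integral_add) (auto intro: integrable_on_mult_right)
      then have "integral UNIV (\<lambda>t. \<psi> t + a * \<rho> t) = 0" using \<rho>(2) by (simp add: a_def)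
      ultimately have "V (\<lambda>t. \<psi> t + a * \<rho> t) = 0" by (rule V_zero)
      moreover have "V (\<lambda>t. \<psi> t + a * \<rho> t) = V \<psi> + a *\<^sub>C V \<rho>"
      proof -
        have "V (\<lambda>t. \<psi> t + a * \<rho> t)
            = W (\<lambda>t. exp (- \<mu> * of_real t) * \<psi> t + a * (exp (- \<mu> * of_real t) * \<rho> t))"
          by (simp add: V_def algebra_simps)
        then show ?thesis
          unfolding W_add[OF S_exp[OF C(1)] S_cmult[OF S_exp[OF C(2)]]] W_mult[OF S_exp[OF C(2)] C(1)]
          by (simp add: V_def)
      qed
      ultimately show ?thesis
        by (simp add: a_def scaleC_scaleC divide_inverse scaleC.minus_left)
    qed
    then show ?thesis by blast
  qed
  then obtain c where c: "\<And>\<psi>. \<psi> \<in> positive_part S \<Longrightarrow> V \<psi> = integral UNIV \<psi> *\<^sub>C c" by blast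
  have "W \<phi> = regular (half_exp \<mu> c) \<phi>" if \<phi>: "\<phi> \<in> positive_part S" for \<phi>
  proof -
    have pos: "(\<lambda>t. exp (\<mu> * of_real t) * \<phi> t) \<in> positive_part S"
      by (rule positive_part_exp[OF \<phi>])
    have "W \<phi> = V (\<lambda>t. exp (\<mu> * of_real t) * \<phi> t)"
      by (simp add: V_def mult.assoc[symmetric] exp_add[symmetric])
    also have "\<dots> = integral UNIV (\<lambda>t. exp (\<mu> * of_real t) * \<phi> t) *\<^sub>C c" by (rule c[OF pos])
    also have "\<dots> = integral UNIV ((\<lambda>z. z *\<^sub>C c) \<circ> (\<lambda>t. exp (\<mu> * of_real t) * \<phi> t))"
      by (rule integral_linear[symmetric, OF _ scaleC.bounded_linear_left])
        (use pos S_integrable in \<open>auto simp: positive_part_iff\<close>)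
    also have "\<dots> = integral UNIV (\<lambda>t. \<phi> t *\<^sub>C half_exp \<mu> c t)"
    proof (rule integral_cong)
      show "((\<lambda>z. z *\<^sub>C c) \<circ> (\<lambda>t. exp (\<mu> * of_real t) * \<phi> t)) t = \<phi> t *\<^sub>C half_exp \<mu> c t" for t
        using \<phi> by (cases "t < 0")
          (auto simp: positive_part_iff half_exp_def scaleC_scaleC max_def scaleC.zero_left mult.commute)
    qed
    finally show ?thesis by (simp add: regular_def)
  qed
  then show ?thesis by (rule that)
qed

lemma positive_part_eq_if_nderiv_eq:
  assumes "\<phi> \<in> positive_part S" "\<psi> \<in> positive_part S" "nderiv 1 \<phi> = nderiv 1 \<psi>"
  shows "\<phi> = \<psi>"
proof -
  have smooth: "smooth \<phi>" "smooth \<psi>" using assms S_smooth by (auto simp: positive_part_iff)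
  have "((\<lambda>t. \<phi> t - \<psi> t) has_vector_derivative nderiv 1 \<phi> t - nderiv 1 \<psi> t) (at t within UNIV)" for t
    using smooth_has_deriv[OF smooth(1), of 0 t] smooth_has_deriv[OF smooth(2), of 0 t]
    by (intro has_vector_derivative_diff) simp_all
  then obtain c where "\<And>t. \<phi> t - \<psi> t = c"
    using has_vector_derivative_zero_constant[of UNIV "\<lambda>t. \<phi> t - \<psi> t"] assms(3) by auto
  moreover have "\<phi> (-1) - \<psi> (-1) = 0" using assms by (simp add: positive_part_iff)
  ultimately show ?thesis by (auto simp: fun_eq_iff)
qed

end

text \<open>A class that is stable under solving scalar equations and contains the decaying exponentials. The
equation is required only for test functions whose derivative lies in \<open>L\<close>, because a member of the class
is determined only there.\<close>

locale solvable_class = test_pair S L for S L +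
  fixes \<C> :: "((real \<Rightarrow> complex) \<Rightarrow> 'e::complex_banach) set"
  assumes C_add: "T \<in> \<C> \<Longrightarrow> U \<in> \<C> \<Longrightarrow> (\<lambda>\<phi>. T \<phi> + U \<phi>) \<in> \<C>"
    and C_linear: "complex_linear \<Lambda> \<Longrightarrow> T \<in> \<C> \<Longrightarrow> (\<lambda>\<phi>. \<Lambda> (T \<phi>)) \<in> \<C>"
    and C_functional: "T \<in> \<C> \<Longrightarrow> linear_functional (carrier S) T"
    and C_solve: "T \<in> \<C> \<Longrightarrow> Re \<mu> < 0 \<Longrightarrow> \<exists>U\<in>\<C>. \<forall>\<phi>\<in>positive_part S.
      nderiv 1 \<phi> \<in> carrier L \<longrightarrow> dist_deriv U \<phi> = \<mu> *\<^sub>C U \<phi> + T \<phi>"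
    and C_exponential: "Re \<mu> < 0 \<Longrightarrow> \<exists>U\<in>\<C>. \<forall>\<phi>\<in>positive_part S. U \<phi> = regular (half_exp \<mu> c) \<phi>"
begin

definition solves :: "('e \<Rightarrow> 'e) \<Rightarrow> ((real \<Rightarrow> complex) \<Rightarrow> 'e) \<Rightarrow> ((real \<Rightarrow> complex) \<Rightarrow> 'e) \<Rightarrow> bool" where
  "solves \<Lambda> W T \<longleftrightarrow> (\<forall>\<phi>\<in>positive_part S. nderiv 1 \<phi> \<in> carrier L \<longrightarrow>
     dist_deriv W \<phi> = \<Lambda> (W \<phi>) + T \<phi>)"

definition in_class :: "((real \<Rightarrow> complex) \<Rightarrow> 'e) \<Rightarrow> bool" where
  "in_class W \<longleftrightarrow> (\<exists>Z\<in>\<C>. eq_on_positive S W Z)"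

lemma C_zero: "(\<lambda>\<phi>. 0) \<in> \<C>"
  using C_linear[OF complex_linear_zero] C_exponential[of "-1" 0] by fastforce

lemma in_class_add: "in_class T \<Longrightarrow> in_class U \<Longrightarrow> in_class (\<lambda>\<phi>. T \<phi> + U \<phi>)"
  unfolding in_class_def eq_on_positive_def using C_add by fastforce

lemma in_class_linear:
  assumes "complex_linear \<Lambda>" "in_class T"
  shows "in_class (\<lambda>\<phi>. \<Lambda> (T \<phi>))"
proof -
  obtain Z where "Z \<in> \<C>" "\<forall>\<phi>\<in>positive_part S. T \<phi> = Z \<phi>"
    using assms(2) unfolding in_class_def eq_on_positive_def by blast
  then show ?thesis
    using C_linear[OF assms(1)] unfolding in_class_def eq_on_positive_def
    by (intro bexI[of _ "\<lambda>\<phi>. \<Lambda> (Z \<phi>)"]) auto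
qed

text \<open>A solution differs from the one provided by the class by an eigenfunctional of the derivative, which
is a decaying exponential.\<close>

lemma in_class_scalar_solution:
  assumes lin: "linear_functional (carrier S) W" and "in_class T" and \<mu>: "Re \<mu> < 0"
    and W: "solves ((*\<^sub>C) \<mu>) W T"
  shows "in_class W"
proof -
  obtain T' where T': "T' \<in> \<C>" "\<And>\<phi>. \<phi> \<in> positive_part S \<Longrightarrow> T \<phi> = T' \<phi>"
    using assms(2) unfolding in_class_def eq_on_positive_def by blast
  obtain U where U: "U \<in> \<C>" "\<And>\<phi>. \<phi> \<in> positive_part S \<Longrightarrow> nderiv 1 \<phi> \<in> carrier L \<Longrightarrow>
      dist_deriv U \<phi> = \<mu> *\<^sub>C U \<phi> + T' \<phi>"
    using C_solve[OF T'(1) \<mu>] by blast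
  have diff: "linear_functional (carrier S) (\<lambda>\<phi>. W \<phi> - U \<phi>)"
    using lin C_functional[OF U(1)] unfolding linear_functional_def
    by (auto simp: scaleC.diff_right)
  have "dist_deriv (\<lambda>\<phi>. W \<phi> - U \<phi>) \<phi> = \<mu> *\<^sub>C (W \<phi> - U \<phi>)"
    if "\<phi> \<in> positive_part S" "nderiv 1 \<phi> \<in> carrier S" for \<phi>
  proof -
    have "dist_deriv (\<lambda>\<phi>. W \<phi> - U \<phi>) \<phi> = dist_deriv W \<phi> - dist_deriv U \<phi>"
      by (simp add: dist_deriv_def)
    then show ?thesis
      using W U(2)[of \<phi>] T'(2)[of \<phi>] that S_subset unfolding solves_def
      by (auto simp: scaleC.diff_right)
  qed
  from exponential_if_eigenfunctional[OF diff this]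
  obtain c where c: "\<And>\<phi>. \<phi> \<in> positive_part S \<Longrightarrow> W \<phi> - U \<phi> = regular (half_exp \<mu> c) \<phi>"
    by blast
  obtain E where E: "E \<in> \<C>" "\<And>\<phi>. \<phi> \<in> positive_part S \<Longrightarrow> E \<phi> = regular (half_exp \<mu> c) \<phi>"
    using C_exponential[OF \<mu>] by blast
  have "W \<phi> = U \<phi> + E \<phi>" if "\<phi> \<in> positive_part S" for \<phi>
    unfolding E(2)[OF that] c[OF that, symmetric] by simp
  then show ?thesis
    unfolding in_class_def eq_on_positive_def
    by (intro bexI[of _ "\<lambda>\<phi>. U \<phi> + E \<phi>"] ballI C_add[OF U(1) E(1)])
qed

text \<open>Induction along the product: \<open>W1 = (\<Lambda> - \<mu>) W\<close> solves the same system with forcing \<open>(\<Lambda> - \<mu>) T\<close> and is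
annihilated, up to the class, by one factor fewer. Then \<open>W' = \<mu> W + (W1 + T)\<close> is a scalar equation.\<close>

lemma in_class_system_solution:
  assumes \<Lambda>: "complex_linear \<Lambda>"
    and "\<And>\<mu>. \<mu> \<in> set \<mu>s \<Longrightarrow> Re \<mu> < 0"
    and "linear_functional (carrier S) W" "in_class T" "solves \<Lambda> W T"
    and "in_class (\<lambda>\<phi>. shift_prod \<Lambda> \<mu>s (W \<phi>))"
  shows "in_class W"
  using assms(2-)
proof (induction \<mu>s arbitrary: W T)
  case (Cons \<mu> \<mu>s)
  define W1 where "W1 \<phi> = \<Lambda> (W \<phi>) - \<mu> *\<^sub>C W \<phi>" for \<phi>
  note shift = complex_linear_shift[OF \<Lambda>, of \<mu>]
  note \<Lambda>D = complex_linearD[OF \<Lambda>]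
  have "in_class W1"
  proof (rule Cons.IH)
    show "linear_functional (carrier S) W1"
      using Cons.prems(2) complex_linearD(2,3)[OF shift]
      unfolding linear_functional_def W1_def by auto
    show "in_class (\<lambda>\<phi>. \<Lambda> (T \<phi>) - \<mu> *\<^sub>C T \<phi>)"
      by (rule in_class_linear[OF shift Cons.prems(3)])
    show "solves \<Lambda> W1 (\<lambda>\<phi>. \<Lambda> (T \<phi>) - \<mu> *\<^sub>C T \<phi>)"
      unfolding solves_def
    proof (intro ballI impI)
      fix \<phi> assume "\<phi> \<in> positive_part S" "nderiv 1 \<phi> \<in> carrier L"
      then have W: "- W (nderiv 1 \<phi>) = \<Lambda> (W \<phi>) + T \<phi>"
        using Cons.prems(4) unfolding solves_def dist_deriv_def by blast
      have "dist_deriv W1 \<phi> = \<Lambda> (- W (nderiv 1 \<phi>)) - \<mu> *\<^sub>C (- W (nderiv 1 \<phi>))"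
        by (simp add: dist_deriv_def W1_def \<Lambda>D scaleC.minus_right)
      then show "dist_deriv W1 \<phi> = \<Lambda> (W1 \<phi>) + (\<Lambda> (T \<phi>) - \<mu> *\<^sub>C T \<phi>)"
        unfolding W by (simp add: W1_def \<Lambda>D scaleC_add_right)
    qed
  qed (use Cons.prems in \<open>auto simp: W1_def\<close>)
  show ?case
  proof (rule in_class_scalar_solution[OF Cons.prems(2)])
    show "in_class (\<lambda>\<phi>. W1 \<phi> + T \<phi>)" by (rule in_class_add[OF \<open>in_class W1\<close> Cons.prems(3)])
    show "solves ((*\<^sub>C) \<mu>) W (\<lambda>\<phi>. W1 \<phi> + T \<phi>)"
      using Cons.prems(4) by (simp add: solves_def W1_def)
  qed (use Cons.prems(1) in auto)
qed simp

text \<open>The recursion behind Putzer's formula for the matrix exponential. If \<open>v' = \<mu> v + T\<close>, and \<open>Y\<close> solves the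
system with forcing \<open>v\<close> up to a term \<open>q\<close>, then \<open>v + (\<Lambda> - \<mu>) Y\<close> solves it with forcing \<open>T\<close> up to the term
\<open>(\<Lambda> - \<mu>) q\<close>. The term that remains at the end vanishes when the product of shifts does.\<close>

lemma solution_modulo_shifts:
  assumes \<Lambda>: "complex_linear \<Lambda>" and "\<And>\<mu>. \<mu> \<in> set \<mu>s \<Longrightarrow> Re \<mu> < 0" and "T \<in> \<C>"
  shows "\<exists>Y\<in>\<C>. \<exists>u\<in>\<C>. solves \<Lambda> Y (\<lambda>\<phi>. T \<phi> - shift_prod \<Lambda> \<mu>s (u \<phi>))"
  using assms(2-)
proof (induction \<mu>s arbitrary: T)
  case Nil
  then show ?case
    using C_zero by (intro bexI[of _ "\<lambda>\<phi>. 0"] bexI[of _ T])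
      (auto simp: solves_def dist_deriv_def complex_linearD[OF \<Lambda>])
next
  case (Cons \<mu> \<mu>s)
  note \<Lambda>D = complex_linearD[OF \<Lambda>]
  obtain v where v: "v \<in> \<C>" "\<forall>\<phi>\<in>positive_part S.
      nderiv 1 \<phi> \<in> carrier L \<longrightarrow> dist_deriv v \<phi> = \<mu> *\<^sub>C v \<phi> + T \<phi>"
    using C_solve[OF Cons.prems(2), of \<mu>] Cons.prems(1) by auto
  obtain Y u where Y: "Y \<in> \<C>" "u \<in> \<C>" "solves \<Lambda> Y (\<lambda>\<phi>. v \<phi> - shift_prod \<Lambda> \<mu>s (u \<phi>))"
    using Cons.IH[OF _ v(1)] Cons.prems(1) by auto
  note shift = complex_linear_shift[OF \<Lambda>, of \<mu>]
  define Y1 where "Y1 \<phi> = v \<phi> + (\<Lambda> (Y \<phi>) - \<mu> *\<^sub>C Y \<phi>)" for \<phi>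
  have "Y1 \<in> \<C>" unfolding Y1_def by (rule C_add[OF v(1) C_linear[OF shift Y(1)]])
  moreover have "solves \<Lambda> Y1 (\<lambda>\<phi>. T \<phi> - shift_prod \<Lambda> (\<mu> # \<mu>s) (u \<phi>))"
    unfolding solves_def
  proof (intro ballI impI)
    fix \<phi> assume \<phi>: "\<phi> \<in> positive_part S" "nderiv 1 \<phi> \<in> carrier L"
    define q where "q = shift_prod \<Lambda> \<mu>s (u \<phi>)"
    have vd: "- v (nderiv 1 \<phi>) = \<mu> *\<^sub>C v \<phi> + T \<phi>" using v(2) \<phi> by (simp add: dist_deriv_def)
    have Yd: "- Y (nderiv 1 \<phi>) = \<Lambda> (Y \<phi>) + (v \<phi> - q)"
      using Y(3) \<phi> by (simp add: solves_def dist_deriv_def q_def)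
    have q: "shift_prod \<Lambda> (\<mu> # \<mu>s) (u \<phi>) = \<Lambda> q - \<mu> *\<^sub>C q"
    proof -
      have "shift_prod \<Lambda> \<mu>s (\<Lambda> y) = \<Lambda> (shift_prod \<Lambda> \<mu>s y)" for y
        by (induction \<mu>s arbitrary: y) (simp_all add: \<Lambda>D(2,4)[symmetric])
      then show ?thesis
        by (simp add: q_def complex_linearD[OF complex_linear_shift_prod[OF \<Lambda>]])
    qed
    have "dist_deriv Y1 \<phi> = - v (nderiv 1 \<phi>) + (\<Lambda> (- Y (nderiv 1 \<phi>)) - \<mu> *\<^sub>C (- Y (nderiv 1 \<phi>)))"
      by (simp add: dist_deriv_def Y1_def \<Lambda>D scaleC.minus_right)
    then show "dist_deriv Y1 \<phi> = \<Lambda> (Y1 \<phi>) + (T \<phi> - shift_prod \<Lambda> (\<mu> # \<mu>s) (u \<phi>))"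
      unfolding vd Yd q by (simp add: Y1_def \<Lambda>D scaleC_add_right scaleC.diff_right)
  qed
  ultimately show ?case using Y(2) by blast
qed

text \<open>For test functions whose derivative leaves \<open>L\<close> the equation prescribes the value of the solution at
that derivative, where nothing else constrains it. A test function supported in \<open>[0, \<infinity>)\<close> is determined
by its derivative, so these prescriptions do not conflict.\<close>

theorem system_solution_exists:
  assumes \<Lambda>: "complex_linear \<Lambda>" and \<mu>s: "\<And>\<mu>. \<mu> \<in> set \<mu>s \<Longrightarrow> Re \<mu> < 0"
    and zero: "\<And>y. shift_prod \<Lambda> \<mu>s y = 0" and F: "in_class F"
  shows "\<exists>Y. \<exists>Y'\<in>\<C>. (\<forall>\<phi>\<in>carrier L. Y \<phi> = Y' \<phi>) \<and>
    eq_on_positive S (dist_deriv Y) (\<lambda>\<phi>. \<Lambda> (Y \<phi>) + F \<phi>)"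
proof -
  obtain T where T: "T \<in> \<C>" "\<And>\<phi>. \<phi> \<in> positive_part S \<Longrightarrow> F \<phi> = T \<phi>"
    using F unfolding in_class_def eq_on_positive_def by blast
  obtain Y' where Y': "Y' \<in> \<C>" "solves \<Lambda> Y' T"
    using solution_modulo_shifts[of \<Lambda> \<mu>s T, OF \<Lambda> \<mu>s T(1)] by (auto simp: zero)
  define prim where "prim \<psi> = (SOME \<phi>. \<phi> \<in> positive_part S \<and> nderiv 1 \<phi> = \<psi>)" for \<psi>
  have prim: "prim (nderiv 1 \<phi>) = \<phi>" if "\<phi> \<in> positive_part S" for \<phi>
    unfolding prim_def by (rule some_equality) (use that positive_part_eq_if_nderiv_eq in auto)
  define Y where "Y \<psi> = (if \<psi> \<in> carrier L then Y' \<psi> else - (\<Lambda> (Y' (prim \<psi>)) + F (prim \<psi>)))" for \<psi>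
  have "dist_deriv Y \<phi> = \<Lambda> (Y \<phi>) + F \<phi>" if \<phi>: "\<phi> \<in> positive_part S" for \<phi>
  proof -
    have "\<phi> \<in> carrier L" using \<phi> S_subset by (auto simp: positive_part_iff)
    then show ?thesis
      using Y'(2) T(2)[OF \<phi>] prim[OF \<phi>] \<phi>
      by (cases "nderiv 1 \<phi> \<in> carrier L") (auto simp: Y_def dist_deriv_def solves_def)
  qed
  then show ?thesis
    using Y'(1) by (intro exI[of _ Y] bexI[of _ Y']) (auto simp: Y_def eq_on_positive_def)
qed

theorem system_solution_in_class:
  assumes \<Lambda>: "complex_linear \<Lambda>" and \<mu>s: "\<And>\<mu>. \<mu> \<in> set \<mu>s \<Longrightarrow> Re \<mu> < 0"
    and zero: "\<And>y. shift_prod \<Lambda> \<mu>s y = 0" and F: "in_class F"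
    and Y: "linear_functional (carrier S) Y"
      "eq_on_positive S (dist_deriv Y) (\<lambda>\<phi>. \<Lambda> (Y \<phi>) + F \<phi>)"
  shows "in_class Y"
proof (rule in_class_system_solution[OF \<Lambda> \<mu>s Y(1) F])
  show "solves \<Lambda> Y F" using Y(2) by (simp add: solves_def eq_on_positive_def)
  show "in_class (\<lambda>\<phi>. shift_prod \<Lambda> \<mu>s (Y \<phi>))"
    unfolding zero in_class_def eq_on_positive_def using C_zero by auto
qed auto

end

section \<open>Functionals given by bounded continuous functions\<close>

lemma regular_integrable:
  fixes h :: "real \<Rightarrow> 'e::complex_banach"
  assumes \<phi>: "continuous_on UNIV \<phi>" "integrable lborel \<phi>"
    and h: "continuous_on UNIV h" "bounded (range h)"
  shows "(\<lambda>t. \<phi> t *\<^sub>C h t) integrable_on UNIV"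
proof -
  obtain B where B: "\<And>t. norm (h t) \<le> B" using h(2) unfolding bounded_iff by auto
  show ?thesis
  proof (rule continuous_integrable_if_dominated[where k = "\<lambda>t. cmod (\<phi> t) * B"])
    show "(\<lambda>t. cmod (\<phi> t) * B) integrable_on UNIV"
      using \<phi>(2) by (intro integrable_on_lborel) auto
    show "norm (\<phi> t *\<^sub>C h t) \<le> cmod (\<phi> t) * B" for t
      using B by (simp add: norm_scaleC mult_left_mono)
  qed (use \<phi> h in \<open>auto intro: scaleC.continuous_on\<close>)
qed

lemma regular_norm_le:
  assumes \<phi>: "continuous_on UNIV \<phi>" "integrable lborel \<phi>"
    and h: "continuous_on UNIV h" "bounded (range h)"
  shows "norm (regular h \<phi>) \<le> (\<integral>t. cmod (\<phi> t) * norm (h t) \<partial>lborel)"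
proof -
  obtain B where B: "\<And>t. norm (h t) \<le> B" using h(2) unfolding bounded_iff by auto
  have "integrable lborel (\<lambda>t. cmod (\<phi> t) * norm (h t))"
    by (rule weighted_dominated_convergence(2)[of "\<lambda>t. cmod (\<phi> t)" "\<lambda>_ t. norm (h t)" B, OF _ _ _ tendsto_const])
       (use \<phi> h B in \<open>auto intro!: borel_measurable_continuous_onI continuous_on_norm\<close>)
  moreover have "norm (regular h \<phi>) \<le> integral UNIV (\<lambda>t. cmod (\<phi> t) * norm (h t))"
    unfolding regular_def
    by (rule integral_norm_bound_integral[OF regular_integrable[OF assms]])
       (use calculation in \<open>auto simp: norm_scaleC intro: integrable_on_lborel\<close>)
  ultimately show ?thesis by (simp add: integral_lborel)
qed

lemma regular_norm_le_L1:
  assumes \<phi>: "continuous_on UNIV \<phi>" "integrable lborel \<phi>"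
    and h: "continuous_on UNIV h" "\<And>t. norm (h t) \<le> B"
  shows "norm (regular h \<phi>) \<le> B * L1_norm \<phi>"
proof -
  have hb: "bounded (range h)" using h(2) unfolding bounded_iff by auto
  have "norm (regular h \<phi>) \<le> integral UNIV (\<lambda>t. cmod (\<phi> t) * B)"
    unfolding regular_def
    by (rule integral_norm_bound_integral[OF regular_integrable[OF \<phi> h(1) hb]])
       (use \<phi> h in \<open>auto simp: norm_scaleC intro!: integrable_on_lborel mult_left_mono\<close>)
  also have "\<dots> = (\<integral>t. cmod (\<phi> t) * B \<partial>lborel)"
    by (rule integral_lborel) (use \<phi> in auto)
  also have "\<dots> = B * L1_norm \<phi>" by (simp add: L1_norm_def)
  finally show ?thesis .
qed

lemma regular_add_test:
  assumes "continuous_on UNIV \<phi>" "integrable lborel \<phi>" "continuous_on UNIV \<psi>" "integrable lborel \<psi>"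
    and h: "continuous_on UNIV h" "bounded (range h)"
  shows "regular h (\<lambda>t. \<phi> t + \<psi> t) = regular h \<phi> + regular h \<psi>"
  unfolding regular_def scaleC_add_left
  by (rule Henstock_Kurzweil_Integration.integral_add; rule regular_integrable; fact)

lemma regular_cmult_test:
  assumes "continuous_on UNIV \<phi>" "integrable lborel \<phi>"
    and h: "continuous_on UNIV h" "bounded (range h)"
  shows "regular h (\<lambda>t. c * \<phi> t) = c *\<^sub>C regular h \<phi>"
  using integral_linear[OF regular_integrable[OF assms] scaleC.bounded_linear_right, of c]
  by (simp add: regular_def o_def scaleC_scaleC)

lemma regular_add:
  assumes \<phi>: "continuous_on UNIV \<phi>" "integrable lborel \<phi>"
    and "continuous_on UNIV g" "bounded (range g)" "continuous_on UNIV h" "bounded (range h)"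
  shows "regular (\<lambda>t. g t + h t) \<phi> = regular g \<phi> + regular h \<phi>"
  unfolding regular_def scaleC_add_right
  by (rule Henstock_Kurzweil_Integration.integral_add; rule regular_integrable; fact)

lemma regular_complex_linear:
  assumes \<phi>: "continuous_on UNIV \<phi>" "integrable lborel \<phi>"
    and h: "continuous_on UNIV h" "bounded (range h)" and \<Lambda>: "complex_linear \<Lambda>"
  shows "regular (\<lambda>t. \<Lambda> (h t)) \<phi> = \<Lambda> (regular h \<phi>)"
  using integral_linear[OF regular_integrable[OF \<phi> h] complex_linearD(1)[OF \<Lambda>]]
  by (simp add: regular_def o_def complex_linearD(2)[OF \<Lambda>])

lemma integrable_compact_continuous:
  fixes f :: "real \<Rightarrow> complex"
  assumes f: "continuous_on UNIV f" "\<And>t. t \<notin> {-r..r} \<Longrightarrow> f t = 0"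
  shows "integrable lborel f"
proof -
  have "integrable lborel (\<lambda>t. indicator {-r..r} t *\<^sub>R f t)"
    using borel_integrable_atLeastAtMost'[of "-r" r f] continuous_on_subset[OF f(1)]
    by (simp add: set_integrable_def)
  moreover have "(\<lambda>t. indicator {-r..r} t *\<^sub>R f t) = f"
    using f(2) by (auto simp: fun_eq_iff split: split_indicator)
  ultimately show ?thesis by simp
qed

text \<open>Integration by parts: the derivative of \<open>\<phi> v\<close> has integral \<open>0\<close>, as \<open>\<phi>\<close> has compact support.\<close>

lemma regular_solution:
  assumes v: "bounded_solution \<mu> h v" and h: "continuous_on UNIV h" "bounded (range h)"
    and \<phi>: "smooth \<phi>" "\<And>t. t \<notin> {-r..r} \<Longrightarrow> \<phi> t = 0"
  shows "dist_deriv (regular v) \<phi> = \<mu> *\<^sub>C regular v \<phi> + regular h \<phi>"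
proof -
  define D where "D = nderiv 1 \<phi>"
  have d\<phi>: "(\<phi> has_vector_derivative D t) (at t)" for t
    using smooth_has_deriv[OF \<phi>(1), of 0 t] by (simp add: D_def)
  have D0: "t \<notin> {-r..r} \<Longrightarrow> D t = 0" for t
    unfolding D_def by (rule nderiv_vanishes[of "{-r..r}"]) (use \<phi> in auto)
  have cont: "continuous_on UNIV \<phi>" "continuous_on UNIV D"
    using continuous_on_nderiv[OF \<phi>(1), of UNIV 0] continuous_on_nderiv[OF \<phi>(1), of UNIV 1]
    by (auto simp: D_def)
  have int: "integrable lborel \<phi>" "integrable lborel D"
    by (rule integrable_compact_continuous[of _ r]; use cont \<phi>(2) D0 in auto)+
  have vb: "continuous_on UNIV v" "bounded (range v)"
    using v bounded_solution_continuous by (auto simp: bounded_solution_def)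
  have "((\<lambda>t. \<phi> t *\<^sub>C v t) has_vector_derivative \<phi> t *\<^sub>C (\<mu> *\<^sub>C v t + h t) + D t *\<^sub>C v t) (at t)" for t
    by (rule scaleC.has_vector_derivative[OF d\<phi>]) (use v in \<open>simp add: bounded_solution_def\<close>)
  then have boundary: "((\<lambda>t. \<phi> t *\<^sub>C (\<mu> *\<^sub>C v t + h t) + D t *\<^sub>C v t) has_integral
      (\<phi> (\<bar>r\<bar> + 1) *\<^sub>C v (\<bar>r\<bar> + 1) - \<phi> (- \<bar>r\<bar> - 1) *\<^sub>C v (- \<bar>r\<bar> - 1))) {- \<bar>r\<bar> - 1..\<bar>r\<bar> + 1}"
    by (intro fundamental_theorem_of_calculus) (auto intro: has_vector_derivative_at_within)
  have "((\<lambda>t. \<phi> t *\<^sub>C (\<mu> *\<^sub>C v t + h t) + D t *\<^sub>C v t) has_integral 0) {- \<bar>r\<bar> - 1..\<bar>r\<bar> + 1}"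
  proof -
    have "\<phi> (\<bar>r\<bar> + 1) = 0" "\<phi> (- \<bar>r\<bar> - 1) = 0" by (rule \<phi>(2); simp; linarith)+
    then show ?thesis using boundary by (simp add: scaleC.zero_left)
  qed
  then have "((\<lambda>t. \<phi> t *\<^sub>C (\<mu> *\<^sub>C v t + h t) + D t *\<^sub>C v t) has_integral 0) UNIV"
  proof (rule has_integral_on_superset)
    fix t assume "t \<notin> {- \<bar>r\<bar> - 1..\<bar>r\<bar> + 1}"
    then have "t \<notin> {-r..r}" by auto
    then have "\<phi> t = 0" "D t = 0" by (rule \<phi>(2), rule D0)
    then show "\<phi> t *\<^sub>C (\<mu> *\<^sub>C v t + h t) + D t *\<^sub>C v t = 0"
      by (simp add: scaleC.zero_left)
  qed simp
  moreover have "((\<lambda>t. \<phi> t *\<^sub>C (\<mu> *\<^sub>C v t + h t) + D t *\<^sub>C v t) has_integral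
      ((\<mu> *\<^sub>C regular v \<phi> + regular h \<phi>) + regular v D)) UNIV"
  proof (rule has_integral_add)
    have "regular (\<lambda>t. \<mu> *\<^sub>C v t + h t) \<phi> = \<mu> *\<^sub>C regular v \<phi> + regular h \<phi>"
    proof (subst regular_add)
      show "continuous_on UNIV (\<lambda>t. \<mu> *\<^sub>C v t)" by (intro scaleC.continuous_on continuous_on_const vb)
      show "bounded (range (\<lambda>t. \<mu> *\<^sub>C v t))"
        using bounded_linear_image[OF vb(2) scaleC.bounded_linear_right, of \<mu>] by (simp add: image_image)
    qed (use cont int h regular_complex_linear[OF cont(1) int(1) vb complex_linear_scale] in auto)
    then show "((\<lambda>t. \<phi> t *\<^sub>C (\<mu> *\<^sub>C v t + h t)) has_integral (\<mu> *\<^sub>C regular v \<phi> + regular h \<phi>)) UNIV"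
    proof (subst (asm) regular_def)
      assume *: "integral UNIV (\<lambda>t. \<phi> t *\<^sub>C (\<mu> *\<^sub>C v t + h t)) = \<mu> *\<^sub>C regular v \<phi> + regular h \<phi>"
      have "(\<lambda>t. \<phi> t *\<^sub>C \<mu> *\<^sub>C v t + \<phi> t *\<^sub>C h t) integrable_on UNIV"
      proof (rule integrable_add)
        show "(\<lambda>t. \<phi> t *\<^sub>C h t) integrable_on UNIV" by (rule regular_integrable[OF cont(1) int(1) h])
        have "(\<lambda>t. \<mu> *\<^sub>C \<phi> t *\<^sub>C v t) integrable_on UNIV"
          using integrable_linear[OF regular_integrable[OF cont(1) int(1) vb] scaleC.bounded_linear_right, of \<mu>]
          by (simp add: o_def)
        then show "(\<lambda>t. \<phi> t *\<^sub>C \<mu> *\<^sub>C v t) integrable_on UNIV"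
          by (simp add: scaleC_scaleC mult.commute)
      qed
      then show ?thesis by (simp add: scaleC_add_right *[symmetric] integrable_integral)
    qed
    show "((\<lambda>t. D t *\<^sub>C v t) has_integral regular v D) UNIV"
      unfolding regular_def by (rule integrable_integral[OF regular_integrable[OF cont(2) int(2) vb]])
  qed
  ultimately have "(\<mu> *\<^sub>C regular v \<phi> + regular h \<phi>) + regular v D = 0"
    by (metis has_integral_unique)
  then show ?thesis by (simp add: dist_deriv_def D_def add_eq_0_iff)
qed

lemma half_exp_bounded_continuous:
  assumes "Re \<mu> < 0"
  shows "continuous_on UNIV (half_exp \<mu> c)" "norm (half_exp \<mu> c t) \<le> norm c"
    "(half_exp \<mu> c \<longlongrightarrow> 0) at_top"
proof -
  show "continuous_on UNIV (half_exp \<mu> c)"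
    unfolding half_exp_def by (intro scaleC.continuous_on continuous_intros)
  have n: "norm (half_exp \<mu> c t) = exp (Re \<mu> * max t 0) * norm c" for t
    by (simp add: half_exp_def norm_scaleC)
  show "norm (half_exp \<mu> c t) \<le> norm c"
    unfolding n using assms by (intro mult_left_le_one_le) (auto simp: mult_nonpos_nonneg)
  have "((\<lambda>t. exp (Re \<mu> * t) * norm c) \<longlongrightarrow> 0) at_top"
    using assms by real_asymp
  then show "(half_exp \<mu> c \<longlongrightarrow> 0) at_top"
  proof (rule Lim_null_comparison[rotated])
    show "\<forall>\<^sub>F t in at_top. norm (half_exp \<mu> c t) \<le> exp (Re \<mu> * t) * norm c"
      using eventually_ge_at_top[of 0] by eventually_elim (simp add: n)
  qed
qed

text \<open>The form in which decay of \<open>q\<close> is used for translates of functionals tested with a function supported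
in \<open>[-r, r]\<close>.\<close>

lemma window_average_vanishes:
  fixes q :: "real \<Rightarrow> 'e::complex_banach"
  assumes q: "continuous_on UNIV q" "bounded (range q)" and lim: "(q \<longlongrightarrow> 0) at_top"
  shows "((\<lambda>x. \<integral>s. indicator {-r..r} s * norm (q (s + x)) \<partial>lborel) \<longlongrightarrow> 0) at_top"
proof (rule tendsto_at_topI_sequentially)
  fix X :: "nat \<Rightarrow> real" assume X: "filterlim X at_top sequentially"
  obtain B where B: "\<And>t. norm (q t) \<le> B" using q(2) unfolding bounded_iff by auto
  have "(\<lambda>n. \<integral>s. indicator {-r..r} s * norm (q (s + X n)) \<partial>lborel)
      \<longlonglongrightarrow> (\<integral>s. indicator {-r..r} s * 0 \<partial>lborel)"
  proof (rule weighted_dominated_convergence(1)[where B = B])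
    show "(\<lambda>s. norm (q (s + X n))) \<in> borel_measurable borel" for n
      by (intro borel_measurable_continuous_onI continuous_on_norm continuous_on_compose2[OF q(1)]
          continuous_intros) auto
    show "(\<lambda>n. norm (q (s + X n))) \<longlonglongrightarrow> 0" for s
      by (intro tendsto_norm_zero filterlim_compose[OF lim] filterlim_tendsto_add_at_top[OF tendsto_const X])
    show "integrable lborel (indicat_real {-r..r})"
      by (rule integrable_real_indicator) (auto simp: emeasure_lborel_Icc_eq)
  qed (auto simp: B)
  then show "(\<lambda>n. \<integral>s. indicator {-r..r} s * norm (q (s + X n)) \<partial>lborel) \<longlonglongrightarrow> 0" by simp
qed

text \<open>Integrating from \<open>-1\<close> rather than from \<open>0\<close> makes the integral differentiable at \<open>0\<close>; to the left of \<open>0\<close> the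
integrand vanishes.\<close>

lemma primitive_compact_support:
  assumes \<psi>: "smooth \<psi>" and zero: "\<And>t. t \<notin> {0..r} \<Longrightarrow> \<psi> t = 0" and int: "integral UNIV \<psi> = 0"
  obtains \<eta> where "smooth \<eta>" "nderiv 1 \<eta> = \<psi>" "\<And>t. t \<notin> {0..r} \<Longrightarrow> \<eta> t = 0"
proof -
  define \<eta> where "\<eta> t = integral {-1..t} \<psi>" for t
  have cont: "continuous_on A \<psi>" for A using continuous_on_nderiv[OF \<psi>, of A 0] by simp
  have neg: "\<eta> t = 0" if "t < 0" for t
  proof -
    have "integral {-1..t} \<psi> = integral {-1..t} (\<lambda>s. 0)"
      by (rule integral_cong) (use that zero in auto)
    then show ?thesis by (simp add: \<eta>_def)
  qed
  have large: "\<eta> t = 0" if "t > r" for t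
  proof (cases "t < 0")
    case False
    have "(\<psi> has_integral \<eta> t) {-1..t}"
      unfolding \<eta>_def by (intro integrable_integral integrable_continuous_real cont)
    then have "(\<psi> has_integral \<eta> t) UNIV"
      by (rule has_integral_on_superset) (use that False in \<open>auto intro!: zero\<close>)
    then show ?thesis using int by (simp add: integral_unique)
  qed (rule neg)
  have deriv: "(\<eta> has_vector_derivative \<psi> t) (at t)" for t
  proof (cases "t < 0")
    case True
    then have "\<psi> t = 0" by (intro zero) auto
    then show ?thesis
      using has_vector_derivative_transform_within_open[of "\<lambda>_. 0" 0 t "{..<0}" \<eta>] True neg by simp
  next
    case False
    have "(\<eta> has_vector_derivative \<psi> t) (at t within {-1..t + 1})"
      unfolding \<eta>_def[abs_def] by (rule integral_has_vector_derivative[OF cont]) (use False in auto)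
    then show ?thesis using at_within_Icc_at[of "-1" t "t + 1"] False by simp
  qed
  have *: "(case_nat \<eta> (\<lambda>k. nderiv k \<psi>) k has_vector_derivative
      case_nat \<eta> (\<lambda>k. nderiv k \<psi>) (Suc k) t) (at t)" for k t
    using deriv smooth_has_deriv[OF \<psi>] by (cases k) auto
  have "smooth \<eta>" "nderiv 1 \<eta> = \<psi>"
    using nderiv_eqI[of "case_nat \<eta> (\<lambda>k. nderiv k \<psi>)" \<eta>, OF _ *] by auto
  then show ?thesis using that neg large by fastforce
qed

section \<open>Translations of integrable smooth functions\<close>

lemma linear_functionalD:
  assumes "linear_functional V T"
  shows "f \<in> V \<Longrightarrow> g \<in> V \<Longrightarrow> T (\<lambda>t. f t + g t) = T f + T g" "f \<in> V \<Longrightarrow> T (\<lambda>t. c * f t) = c *\<^sub>C T f"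
  using assms by (simp_all add: linear_functional_def)

lemma quadratic_remainder_imp_derivative:
  fixes g :: "real \<Rightarrow> 'e::real_normed_vector"
  assumes "\<And>y. norm (g (x + y) - g x - y *\<^sub>R d) \<le> K * y\<^sup>2"
  shows "(g has_vector_derivative d) (at x)"
  unfolding has_vector_derivative_def
proof (rule has_derivativeI_sandwich[of 1])
  show "bounded_linear (\<lambda>h. h *\<^sub>R d)" by (rule bounded_linear_scaleR_left)
  show "((\<lambda>y. K * \<bar>y - x\<bar>) \<longlongrightarrow> 0) (at x)"
    by (auto intro!: tendsto_eq_intros)
  fix y assume "y \<noteq> x"
  have "norm (g y - g x - (y - x) *\<^sub>R d) \<le> K * (y - x)\<^sup>2" using assms[of "y - x"] by simp
  also have "\<dots> = (K * \<bar>y - x\<bar>) * norm (y - x)"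
    by (simp add: power2_eq_square)
  finally show "norm (g y - g x - (y - x) *\<^sub>R d) / norm (y - x) \<le> K * \<bar>y - x\<bar>"
    using \<open>y \<noteq> x\<close> by (simp add: divide_le_eq)
qed simp

lemma L1_norm_nonneg: "L1_norm f \<ge> 0"
  by (simp add: L1_norm_def)

text \<open>Minkowski's integral inequality, from Tonelli's theorem.\<close>

lemma L1_norm_average:
  fixes G :: "real \<Rightarrow> real \<Rightarrow> complex"
  assumes F: "\<And>t. F t = integral {0..1} (\<lambda>u. G u t)" "continuous_on UNIV F"
    and G: "continuous_on UNIV (\<lambda>(u, t). G u t)"
    and c: "\<And>u. u \<in> {0..1} \<Longrightarrow> integrable lborel (G u)" "\<And>u. u \<in> {0..1} \<Longrightarrow> L1_norm (G u) \<le> c"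
  shows "integrable lborel F" "L1_norm F \<le> c"
proof -
  have "c \<ge> 0" using order_trans[OF L1_norm_nonneg c(2)[of 0]] by simp
  have Gu: "continuous_on A (\<lambda>u. G u t)" for t A
  proof -
    have "continuous_on A (\<lambda>u. (u, t))" by (intro continuous_intros)
    from continuous_on_compose2[OF G this] show ?thesis by simp
  qed
  have meas: "(\<lambda>x. ennreal (norm (G (snd x) (fst x))) * indicator {0..1} (snd x))
      \<in> borel_measurable (lborel \<Otimes>\<^sub>M lborel)"
  proof -
    have "(\<lambda>x. G (snd x) (fst x)) \<in> borel_measurable (borel :: (real \<times> real) measure)"
      by (intro borel_measurable_continuous_onI continuous_on_compose2[OF G[unfolded case_prod_unfold], of UNIV prod.swap, simplified])
        (auto intro!: continuous_intros simp: prod.swap_def)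
    then have [measurable]: "(\<lambda>x. G (snd x) (fst x)) \<in> borel_measurable (lborel \<Otimes>\<^sub>M lborel)"
      unfolding lborel_prod by simp
    show ?thesis by measurable
  qed
  have F_le: "ennreal (norm (F t)) \<le> (\<integral>\<^sup>+ u. ennreal (norm (G u t)) * indicator {0..1} u \<partial>lborel)" for t
  proof -
    have "norm (F t) \<le> integral {0..1} (\<lambda>u. norm (G u t))"
      unfolding F(1) by (rule Henstock_Kurzweil_Integration.integral_norm_bound_integral)
        (auto intro!: integrable_continuous_real continuous_on_norm Gu)
    moreover have "(\<integral>\<^sup>+ u. ennreal (norm (G u t)) * indicator {0..1} u \<partial>lborel)
        = ennreal (integral {0..1} (\<lambda>u. norm (G u t)))"
      by (rule nn_integral_has_integral_lebesgue')
        (auto intro!: integrable_integral integrable_continuous_real continuous_on_norm Gu)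
    ultimately show ?thesis by (simp add: ennreal_leI)
  qed
  have "(\<integral>\<^sup>+ t. ennreal (norm (F t)) \<partial>lborel)
      \<le> (\<integral>\<^sup>+ t. \<integral>\<^sup>+ u. ennreal (norm (G u t)) * indicator {0..1} u \<partial>lborel \<partial>lborel)"
    by (intro nn_integral_mono F_le)
  also have "\<dots> = (\<integral>\<^sup>+ u. \<integral>\<^sup>+ t. ennreal (norm (G u t)) * indicator {0..1} u \<partial>lborel \<partial>lborel)"
    using lborel_pair.Fubini[OF meas] by simp
  also have "\<dots> \<le> (\<integral>\<^sup>+ u. ennreal c * indicator {0..1::real} u \<partial>lborel)"
  proof (rule nn_integral_mono)
    fix u :: real
    show "(\<integral>\<^sup>+ t. ennreal (norm (G u t)) * indicator {0..1} u \<partial>lborel) \<le> ennreal c * indicator {0..1} u"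
    proof (cases "u \<in> {0..1}")
      case True
      have "(\<integral>\<^sup>+ t. ennreal (norm (G u t)) \<partial>lborel) = ennreal (L1_norm (G u))"
        unfolding L1_norm_def by (rule nn_integral_eq_integral) (use c(1)[OF True] in auto)
      also have "\<dots> \<le> ennreal c" by (intro ennreal_leI c True)
      finally show ?thesis using True by simp
    qed simp
  qed
  also have "\<dots> = ennreal c" by (simp add: nn_integral_cmult)
  finally have le: "(\<integral>\<^sup>+ t. ennreal (norm (F t)) \<partial>lborel) \<le> ennreal c" .
  show int: "integrable lborel F"
  proof (rule integrableI_bounded)
    show "F \<in> borel_measurable lborel" using borel_measurable_continuous_onI[OF F(2)] by simp
    show "(\<integral>\<^sup>+ t. ennreal (norm (F t)) \<partial>lborel) < \<infinity>"
      using le by (simp add: le_less_trans)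
  qed
  have "ennreal (L1_norm F) = (\<integral>\<^sup>+ t. ennreal (norm (F t)) \<partial>lborel)"
    unfolding L1_norm_def by (rule nn_integral_eq_integral[symmetric]) (use int in auto)
  with le have "ennreal (L1_norm F) \<le> ennreal c" by simp
  then show "L1_norm F \<le> c" using \<open>c \<ge> 0\<close> by (simp add: ennreal_le_iff)
qed

lemma L1_norm_shift:
  "integrable lborel f \<Longrightarrow> integrable lborel (\<lambda>t. f (t - x))"
  "L1_norm (\<lambda>t. f (t - x)) = L1_norm f"
  using lborel_integrable_real_affine[of f 1 "- x"]
    lborel_integral_real_affine[of 1 "\<lambda>t. cmod (f t)" "- x"]
  by (simp_all add: L1_norm_def)

lemma L1_norm_cmult: "L1_norm (\<lambda>t. c * f t) = cmod c * L1_norm f"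
  by (simp add: L1_norm_def norm_mult)

lemma smooth_translate: "smooth f \<Longrightarrow> smooth (\<lambda>t. f (t - x))"
  and nderiv_translate: "smooth f \<Longrightarrow> nderiv k (\<lambda>t. f (t - x)) = (\<lambda>t. nderiv k f (t - x))"
  using smooth_affine[of f 1 "- x"] nderiv_affine[of f k 1 "- x"] by simp_all

text \<open>Writing \<open>f (t - x) - f t\<close> as an average of \<open>- x f' (t - u x)\<close> over \<open>u\<close> in \<open>[0, 1]\<close> treats both signs of
\<open>x\<close> alike.\<close>

lemma L1_norm_translate_diff:
  assumes f: "smooth f" and int: "integrable lborel (nderiv 1 f)"
  shows "integrable lborel (\<lambda>t. f (t - x) - f t)"
    "L1_norm (\<lambda>t. f (t - x) - f t) \<le> \<bar>x\<bar> * L1_norm (nderiv 1 f)"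
proof -
  define G where "G u t = of_real (- x) * nderiv 1 f (t - u * x)" for u t
  have contf: "continuous_on A f" for A using continuous_on_nderiv[OF f, of A 0] by simp
  have 1: "f (t - x) - f t = integral {0..1} (\<lambda>u. G u t)" for t
  proof -
    have "((\<lambda>u. f ((- x) * u + t)) has_vector_derivative (- x) *\<^sub>R nderiv 1 f ((- x) * u + t)) (at u)" for u
      by (rule has_vector_derivative_affine) (use smooth_has_deriv[OF f, of 0] in simp)
    then have "((\<lambda>u. (- x) *\<^sub>R nderiv 1 f ((- x) * u + t)) has_integral
        (f ((- x) * 1 + t) - f ((- x) * 0 + t))) {0..1}"
      by (intro fundamental_theorem_of_calculus) (auto intro: has_vector_derivative_at_within)
    moreover have "(- x) *\<^sub>R nderiv 1 f ((- x) * u + t) = G u t" for u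
      unfolding G_def scaleR_conv_of_real by (simp add: algebra_simps)
    ultimately show ?thesis by (simp add: integral_unique)
  qed
  have 2: "continuous_on UNIV (\<lambda>t. f (t - x) - f t)"
    by (intro continuous_intros continuous_on_compose2[OF contf[of UNIV]]) auto
  have 3: "continuous_on UNIV (\<lambda>(u, t). G u t)"
    unfolding G_def case_prod_unfold
    by (intro continuous_intros continuous_on_compose2[OF continuous_on_nderiv[OF f, of UNIV]]) auto
  have 4: "integrable lborel (G u)" "L1_norm (G u) \<le> \<bar>x\<bar> * L1_norm (nderiv 1 f)" for u
    unfolding G_def[abs_def] L1_norm_cmult using L1_norm_shift(1)[OF int, of "u * x"] L1_norm_shift(2)[of "nderiv 1 f" "u * x"]
    by (auto intro!: integrable_mult_right)
  show "integrable lborel (\<lambda>t. f (t - x) - f t)"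
    "L1_norm (\<lambda>t. f (t - x) - f t) \<le> \<bar>x\<bar> * L1_norm (nderiv 1 f)"
    by (rule L1_norm_average[OF 1 2 3]; rule 4)+
qed

lemma L1_norm_translate_taylor:
  assumes f: "smooth f" and int: "integrable lborel (nderiv 1 f)" "integrable lborel (nderiv 2 f)"
  shows "L1_norm (\<lambda>t. f (t - x) - f t + of_real x * nderiv 1 f t) \<le> x\<^sup>2 * L1_norm (nderiv 2 f)"
proof -
  define G where "G u t = of_real (- x) * (nderiv 1 f (t - u * x) - nderiv 1 f t)" for u t
  have contf: "continuous_on A f" for A using continuous_on_nderiv[OF f, of A 0] by simp
  have smooth1: "smooth (nderiv 1 f)" by (rule smooth_nderiv[OF f])
  have nderiv2: "nderiv 1 (nderiv 1 f) = nderiv 2 f"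
    using nderiv_add[of 1 1 f] by (simp add: numeral_2_eq_2)
  have 1: "f (t - x) - f t + of_real x * nderiv 1 f t = integral {0..1} (\<lambda>u. G u t)" for t
  proof -
    have "((\<lambda>u. f ((- x) * u + t)) has_vector_derivative (- x) *\<^sub>R nderiv 1 f ((- x) * u + t)) (at u)" for u
      by (rule has_vector_derivative_affine) (use smooth_has_deriv[OF f, of 0] in simp)
    then have "((\<lambda>u. (- x) *\<^sub>R nderiv 1 f ((- x) * u + t)) has_integral
        (f ((- x) * 1 + t) - f ((- x) * 0 + t))) {0..1}"
      by (intro fundamental_theorem_of_calculus) (auto intro: has_vector_derivative_at_within)
    moreover have "((\<lambda>u::real. of_real x * nderiv 1 f t) has_integral (1 - 0) *\<^sub>R (of_real x * nderiv 1 f t)) {0..1}"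
      using has_integral_const_real[of "of_real x * nderiv 1 f t" 0 1] by simp
    ultimately have "((\<lambda>u. (- x) *\<^sub>R nderiv 1 f ((- x) * u + t) + of_real x * nderiv 1 f t) has_integral
        ((f ((- x) * 1 + t) - f ((- x) * 0 + t)) + (1 - 0) *\<^sub>R (of_real x * nderiv 1 f t))) {0..1}"
      by (rule has_integral_add)
    moreover have "(- x) *\<^sub>R nderiv 1 f ((- x) * u + t) + of_real x * nderiv 1 f t = G u t" for u
      unfolding G_def scaleR_conv_of_real by (simp add: algebra_simps)
    ultimately show ?thesis by (simp add: integral_unique)
  qed
  have 2: "continuous_on UNIV (\<lambda>t. f (t - x) - f t + of_real x * nderiv 1 f t)"
    by (intro continuous_intros continuous_on_compose2[OF contf[of UNIV]] continuous_on_nderiv[OF f]) auto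
  have 3: "continuous_on UNIV (\<lambda>(u, t). G u t)"
    unfolding G_def case_prod_unfold
    by (intro continuous_intros continuous_on_compose2[OF continuous_on_nderiv[OF f, of UNIV]]) auto
  have 4: "integrable lborel (G u)" "L1_norm (G u) \<le> x\<^sup>2 * L1_norm (nderiv 2 f)" if "u \<in> {0..1}" for u
  proof -
    note d = L1_norm_translate_diff[OF smooth1, unfolded nderiv2, OF int(2), of "u * x"]
    show "integrable lborel (G u)" unfolding G_def[abs_def] by (intro integrable_mult_right d)
    have "L1_norm (G u) = \<bar>x\<bar> * L1_norm (\<lambda>t. nderiv 1 f (t - u * x) - nderiv 1 f t)"
      unfolding G_def[abs_def] L1_norm_cmult by simp
    also have "\<dots> \<le> \<bar>x\<bar> * (\<bar>u * x\<bar> * L1_norm (nderiv 2 f))"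
      by (intro mult_left_mono d) auto
    also have "\<dots> = u * (x\<^sup>2 * L1_norm (nderiv 2 f))"
      using that by (simp add: abs_mult power2_eq_square)
    also have "\<dots> \<le> 1 * (x\<^sup>2 * L1_norm (nderiv 2 f))"
      using that by (intro mult_right_mono) (auto simp: L1_norm_nonneg)
    finally show "L1_norm (G u) \<le> x\<^sup>2 * L1_norm (nderiv 2 f)" by simp
  qed
  show ?thesis by (rule L1_norm_average(2)[OF 1 2 3 4])
qed

lemma carrier_DL1: "f \<in> carrier DL1_space \<longleftrightarrow> smooth f \<and> (\<forall>j. integrable lborel (nderiv j f))"
  by (simp add: DL1_space_def)

lemma DL1_continuous: "f \<in> carrier DL1_space \<Longrightarrow> continuous_on UNIV f"
  and DL1_integrable: "f \<in> carrier DL1_space \<Longrightarrow> integrable lborel f"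
  using continuous_on_nderiv[of f UNIV 0] unfolding carrier_DL1 by (auto dest: spec[of _ 0])

lemma function_space_DL1: "function_space (carrier DL1_space)"
  by (simp add: function_space_def carrier_DL1 smooth_zero nderiv_zero smooth_add nderiv_plus
      smooth_cmult nderiv_cmult)

lemma DL1_translate: "f \<in> carrier DL1_space \<Longrightarrow> (\<lambda>t. f (t - x)) \<in> carrier DL1_space"
  unfolding carrier_DL1 by (auto simp: smooth_translate nderiv_translate L1_norm_shift(1))

lemma DL1_nderiv: "f \<in> carrier DL1_space \<Longrightarrow> nderiv k f \<in> carrier DL1_space"
  unfolding carrier_DL1 by (auto simp: smooth_nderiv nderiv_add[symmetric])

lemma snd_DL1: "snd DL1_space = {\<lambda>f. \<Sum>j\<le>k. L1_norm (nderiv j f) |k. True}"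
  by (simp add: DL1_space_def)

text \<open>The seminorms of the space increase with their index, so finitely many are bounded by one of them.\<close>

lemma dual_DL1_bound:
  assumes "T \<in> dual DL1_space"
  obtains C k where "C \<ge> 0"
    "\<And>f. f \<in> carrier DL1_space \<Longrightarrow> norm (T f) \<le> C * (\<Sum>j\<le>k. L1_norm (nderiv j f))"
proof -
  have hom: "p (\<lambda>t. c * f t) = cmod c * p f" and nonneg: "p f \<ge> 0"
    if "p \<in> snd DL1_space" "f \<in> carrier DL1_space" for p f c
    using that unfolding snd_DL1 carrier_DL1
    by (auto simp: nderiv_cmult L1_norm_cmult sum_distrib_left intro!: sum_nonneg L1_norm_nonneg)
  show ?thesis
  proof (rule dual_bound[OF assms function_space_DL1])
    fix Q C assume Q: "finite Q" "Q \<subseteq> snd DL1_space" "C > 0"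
      "\<And>f. f \<in> carrier DL1_space \<Longrightarrow> norm (T f) \<le> C * (\<Sum>p\<in>Q. p f)"
  have "\<forall>p\<in>Q. \<exists>k. p = (\<lambda>f. \<Sum>j\<le>k. L1_norm (nderiv j f))" using Q(2) unfolding snd_DL1 by auto
  then obtain k where k: "\<And>p. p \<in> Q \<Longrightarrow> p = (\<lambda>f. \<Sum>j\<le>k p. L1_norm (nderiv j f))" by metis
  define K where "K = Max (insert 0 (k ` Q))"
  have "norm (T f) \<le> C * real (card Q) * (\<Sum>j\<le>K. L1_norm (nderiv j f))" if f: "f \<in> carrier DL1_space" for f
  proof -
    have "p f \<le> (\<Sum>j\<le>K. L1_norm (nderiv j f))" if p: "p \<in> Q" for p
    proof -
      have "k p \<le> K" unfolding K_def using Q(1) p by (intro Max_ge) auto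
      then show ?thesis
        by (subst k[OF p]) (intro sum_mono2, auto simp: L1_norm_nonneg)
    qed
    then have "(\<Sum>p\<in>Q. p f) \<le> real (card Q) * (\<Sum>j\<le>K. L1_norm (nderiv j f))"
      using sum_bounded_above[of Q "\<lambda>p. p f"] by simp
    then show ?thesis
      using Q(4)[OF f] \<open>C > 0\<close> by (smt (verit) mult.assoc mult_left_mono)
  qed
  then show ?thesis using \<open>C > 0\<close> by (intro that[of "C * real (card Q)" K]) auto
  qed (use hom nonneg in auto)
qed

lemma dual_DL1_if_bounded:
  assumes "linear_functional (carrier DL1_space) T" "C \<ge> 0"
    "\<And>f. f \<in> carrier DL1_space \<Longrightarrow> norm (T f) \<le> C * (\<Sum>j\<le>k. L1_norm (nderiv j f))"
  shows "T \<in> dual DL1_space"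
  by (rule dual_if_bounded[where Q = "{\<lambda>f. \<Sum>j\<le>k. L1_norm (nderiv j f)}", OF function_space_DL1])
    (use assms in \<open>auto simp: snd_DL1\<close>)

lemma translate_bound:
  assumes "\<And>f. f \<in> carrier DL1_space \<Longrightarrow> norm (T f) \<le> C * (\<Sum>j\<le>k. L1_norm (nderiv j f))"
    and f: "f \<in> carrier DL1_space"
  shows "norm (translate x T f) \<le> C * (\<Sum>j\<le>k. L1_norm (nderiv j f))"
proof -
  have "smooth f" using f by (simp add: carrier_DL1)
  then show ?thesis
    using assms(1)[OF DL1_translate[OF f]] by (simp add: translate_def nderiv_translate L1_norm_shift(2))
qed

text \<open>The second-order remainder of a translation is \<open>O(x\<^sup>2)\<close> in every seminorm of the space, so a continuous
functional maps it to \<open>O(x\<^sup>2)\<close>.\<close>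

lemma translate_has_derivative:
  assumes T: "T \<in> dual DL1_space" and f: "f \<in> carrier DL1_space"
  shows "((\<lambda>x. translate x T f) has_vector_derivative - translate x T (nderiv 1 f)) (at x)"
proof -
  obtain C k where "C \<ge> 0" and
    C: "\<And>f. f \<in> carrier DL1_space \<Longrightarrow> norm (T f) \<le> C * (\<Sum>j\<le>k. L1_norm (nderiv j f))"
    using dual_DL1_bound[OF T] by blast
  have lin: "linear_functional (carrier DL1_space) T" using T by (simp add: dual_iff)
  note sp = function_space_DL1
  have smooth: "smooth f" using f by (simp add: carrier_DL1)
  show ?thesis
  proof (rule quadratic_remainder_imp_derivative)
    fix y
    define g where "g t = f (t - x)" for t
    have g: "g \<in> carrier DL1_space" unfolding g_def by (rule DL1_translate[OF f])
    then have sg: "smooth g" by (simp add: carrier_DL1)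
    have g1: "nderiv 1 g = (\<lambda>t. nderiv 1 f (t - x))" unfolding g_def by (rule nderiv_translate[OF smooth])
    have d: "(\<lambda>t. g (t - y) - g t) \<in> carrier DL1_space"
      by (rule function_space_diff[OF sp DL1_translate[OF g] g])
    have m: "(\<lambda>t. of_real y * nderiv 1 g t) \<in> carrier DL1_space"
      using sp DL1_nderiv[OF g] unfolding function_space_def by blast
    have "translate (x + y) T f - translate x T f - y *\<^sub>R - translate x T (nderiv 1 f)
        = T (\<lambda>t. g (t - y)) - T g + of_real y *\<^sub>C T (nderiv 1 g)"
      unfolding g1 by (simp add: translate_def g_def[abs_def] scaleR_scaleC scaleC.minus_right algebra_simps)
    also have "\<dots> = T (\<lambda>t. (g (t - y) - g t) + of_real y * nderiv 1 g t)"
    proof -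
      have "T (\<lambda>t. (g (t - y) - g t) + of_real y * nderiv 1 g t)
          = T (\<lambda>t. g (t - y) - g t) + T (\<lambda>t. of_real y * nderiv 1 g t)"
        by (rule linear_functionalD(1)[OF lin d m])
      also have "T (\<lambda>t. of_real y * nderiv 1 g t) = of_real y *\<^sub>C T (nderiv 1 g)"
        by (rule linear_functionalD(2)[OF lin DL1_nderiv[OF g]])
      also have "T (\<lambda>t. g (t - y) - g t) = T (\<lambda>t. g (t - y)) - T g"
        by (rule linear_functional_diff[OF sp lin DL1_translate[OF g] g])
      finally show ?thesis by simp
    qed
    finally have eq: "translate (x + y) T f - translate x T f - y *\<^sub>R - translate x T (nderiv 1 f)
        = T (\<lambda>t. (g (t - y) - g t) + of_real y * nderiv 1 g t)" .
    have "norm (T (\<lambda>t. (g (t - y) - g t) + of_real y * nderiv 1 g t)) \<le> C * (\<Sum>j\<le>k. L1_norm (nderiv j (\<lambda>t. (g (t - y) - g t) + of_real y * nderiv 1 g t)))"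
      by (rule C) (use sp d m in \<open>auto simp: function_space_def\<close>)
    also have "\<dots> \<le> C * (\<Sum>j\<le>k. y\<^sup>2 * L1_norm (nderiv (j + 2) f))"
    proof (intro mult_left_mono sum_mono \<open>C \<ge> 0\<close>)
      fix j
      have "nderiv j (\<lambda>t. (g (t - y) - g t) + of_real y * nderiv 1 g t)
          = (\<lambda>t. nderiv j g (t - y) - nderiv j g t + of_real y * nderiv 1 (nderiv j g) t)"
      proof -
        have s: "smooth (\<lambda>t. g (t - y))" "smooth (\<lambda>t. (- 1) * g t)" "smooth (\<lambda>t. of_real y * nderiv 1 g t)"
          by (intro smooth_translate smooth_cmult smooth_nderiv sg)+
        have "nderiv j (\<lambda>t. (g (t - y) + (- 1) * g t) + of_real y * nderiv 1 g t)
          = (\<lambda>t. nderiv j g (t - y) + (- 1) * nderiv j g t + of_real y * nderiv j (nderiv 1 g) t)"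
          by (simp only: nderiv_plus[OF smooth_add[OF s(1,2)] s(3)] nderiv_plus[OF s(1,2)]
              nderiv_translate[OF sg] nderiv_cmult[OF sg] nderiv_cmult[OF smooth_nderiv[OF sg]])
        moreover have "nderiv j (nderiv 1 g) = nderiv 1 (nderiv j g)"
          by (simp only: nderiv_add[symmetric] add.commute)
        ultimately show ?thesis by simp
      qed
      moreover have "L1_norm (\<lambda>t. nderiv j g (t - y) - nderiv j g t + of_real y * nderiv 1 (nderiv j g) t)
          \<le> y\<^sup>2 * L1_norm (nderiv 2 (nderiv j g))"
        using g by (intro L1_norm_translate_taylor smooth_nderiv[OF sg])
          (auto simp: carrier_DL1 nderiv_add[symmetric])
      moreover have "L1_norm (nderiv 2 (nderiv j g)) = L1_norm (nderiv (j + 2) f)"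
      proof -
        have "nderiv 2 (nderiv j g) = nderiv (j + 2) g"
          by (simp only: nderiv_add[symmetric] add.commute[of 2])
        also have "\<dots> = (\<lambda>t. nderiv (j + 2) f (t - x))"
          unfolding g_def by (rule nderiv_translate[OF smooth])
        finally have "nderiv 2 (nderiv j g) = (\<lambda>t. nderiv (j + 2) f (t - x))" .
        then show ?thesis by (simp only: L1_norm_shift(2))
      qed
      ultimately show "L1_norm (nderiv j (\<lambda>t. (g (t - y) - g t) + of_real y * nderiv 1 g t))
          \<le> y\<^sup>2 * L1_norm (nderiv (j + 2) f)" by simp
    qed
    finally show "norm (translate (x + y) T f - translate x T f - y *\<^sub>R - translate x T (nderiv 1 f))
        \<le> (C * (\<Sum>j\<le>k. L1_norm (nderiv (j + 2) f))) * y\<^sup>2"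
      unfolding eq by (simp add: sum_distrib_left mult_ac)
  qed
qed

section \<open>Operations on the classes of functionals\<close>

lemma dual_cong:
  assumes "T \<in> dual S" "function_space (carrier S)" "\<And>\<phi>. \<phi> \<in> carrier S \<Longrightarrow> U \<phi> = T \<phi>"
  shows "U \<in> dual S"
proof -
  have "linear_functional (carrier S) U"
    using assms unfolding dual_iff linear_functional_def function_space_def by simp
  moreover have "continuous_map (lc_topology S) euclidean U"
    using assms by (auto simp: dual_iff topspace_lc_topology intro: continuous_map_eq)
  ultimately show ?thesis by (simp add: dual_iff)
qed

lemma dual_add: "T \<in> dual S \<Longrightarrow> U \<in> dual S \<Longrightarrow> (\<lambda>\<phi>. T \<phi> + U \<phi>) \<in> dual S"
  unfolding dual_iff linear_functional_def
  by (auto simp: scaleC_add_right intro: continuous_map_add)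

lemma dual_complex_linear:
  assumes \<Lambda>: "complex_linear \<Lambda>" and T: "T \<in> dual S"
  shows "(\<lambda>\<phi>. \<Lambda> (T \<phi>)) \<in> dual S"
proof -
  have "continuous_map euclidean euclidean \<Lambda>"
    using linear_continuous_on[OF complex_linearD(1)[OF \<Lambda>], of UNIV] by simp
  then have "continuous_map (lc_topology S) euclidean (\<Lambda> \<circ> T)"
    using T by (auto simp: dual_iff intro: continuous_map_compose)
  then show ?thesis
    using T by (auto simp: dual_iff linear_functional_def complex_linearD[OF \<Lambda>] o_def)
qed

lemma linear_functional_subset:
  "linear_functional V T \<Longrightarrow> W \<subseteq> V \<Longrightarrow> linear_functional W T"
  unfolding linear_functional_def by blast

lemma B_almost_add:
  assumes "T \<in> B_almost \<kappa> S L" "U \<in> B_almost \<kappa> S L"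
  shows "(\<lambda>\<phi>. T \<phi> + U \<phi>) \<in> B_almost \<kappa> S L"
proof -
  have "convolution (\<lambda>\<phi>. T \<phi> + U \<phi>) \<phi> = (\<lambda>x. convolution T \<phi> x + convolution U \<phi> x)" for \<phi>
    by (simp add: convolution_def fun_eq_iff)
  then show ?thesis
    using assms by (auto simp: B_almost_def intro: dual_add almost_add)
qed

lemma B_almost_complex_linear:
  assumes \<Lambda>: "complex_linear \<Lambda>" and T: "T \<in> B_almost \<kappa> S L"
  shows "(\<lambda>\<phi>. \<Lambda> (T \<phi>)) \<in> B_almost \<kappa> S L"
proof -
  have "convolution (\<lambda>\<phi>. \<Lambda> (T \<phi>)) \<phi> = (\<lambda>x. \<Lambda> (convolution T \<phi> x))" for \<phi>
    by (simp add: convolution_def fun_eq_iff)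
  then show ?thesis
    using T by (auto simp: B_almost_def intro: dual_complex_linear[OF \<Lambda>]
        almost_bounded_linear[OF complex_linearD(1)[OF \<Lambda>]])
qed

lemma B_plus0_add:
  assumes "T \<in> B_plus0 S L" "U \<in> B_plus0 S L"
  shows "(\<lambda>\<phi>. T \<phi> + U \<phi>) \<in> B_plus0 S L"
  using assms tendsto_add[of _ 0 at_top _ 0]
  by (auto simp: B_plus0_def translate_def intro: dual_add)

lemma B_plus0_complex_linear:
  assumes \<Lambda>: "complex_linear \<Lambda>" and T: "T \<in> B_plus0 S L"
  shows "(\<lambda>\<phi>. \<Lambda> (T \<phi>)) \<in> B_plus0 S L"
  using T bounded_linear.tendsto_zero[OF complex_linearD(1)[OF \<Lambda>]]
  by (auto simp: B_plus0_def translate_def intro: dual_complex_linear[OF \<Lambda>])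

text \<open>The values of functionals outside the carriers are irrelevant for the dual and for the classes, so the
solution that was adjusted there still belongs to them.\<close>

lemma (in solvable_class) stable_system_solutions:
  assumes \<Lambda>: "complex_linear \<Lambda>" and \<mu>s: "\<And>\<mu>. \<mu> \<in> set \<mu>s \<Longrightarrow> Re \<mu> < 0"
    and zero: "\<And>y. shift_prod \<Lambda> \<mu>s y = 0" and F: "in_class F"
    and L: "function_space (carrier L)" "\<C> \<subseteq> dual L" "\<C> \<subseteq> dual S"
    and asymp: "\<C> \<subseteq> B_asymp \<kappa> S L"
  shows "\<exists>Y\<in>B_asymp \<kappa> S L. (\<exists>Y'\<in>\<C>. \<forall>\<phi>\<in>carrier S. Y \<phi> = Y' \<phi>) \<and> Y \<in> dual S \<and>
      eq_on_positive S (dist_deriv Y) (\<lambda>\<phi>. \<Lambda> (Y \<phi>) + F \<phi>)"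
    and "Y \<in> dual S \<Longrightarrow> eq_on_positive S (dist_deriv Y) (\<lambda>\<phi>. \<Lambda> (Y \<phi>) + F \<phi>) \<Longrightarrow>
      \<exists>Z\<in>\<C>. eq_on_positive S Y Z"
    and "Y \<in> dual L \<Longrightarrow> Y \<in> dual S \<Longrightarrow>
      eq_on_positive S (dist_deriv Y) (\<lambda>\<phi>. \<Lambda> (Y \<phi>) + F \<phi>) \<Longrightarrow> Y \<in> B_asymp \<kappa> S L"
proof -
  have B_asympI: "Y \<in> B_asymp \<kappa> S L" if "Y \<in> dual L" "Z \<in> \<C>" "eq_on_positive S Y Z" for Y Z
  proof -
    have "Z \<in> B_asymp \<kappa> S L" using that(2) asymp by blast
    then obtain T1 Q where "T1 \<in> B_almost \<kappa> S L" "Q \<in> B_plus0 S L"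
      "eq_on_positive S Z (\<lambda>\<phi>. T1 \<phi> + Q \<phi>)" unfolding B_asymp_def by blast
    moreover from this that(3) have "eq_on_positive S Y (\<lambda>\<phi>. T1 \<phi> + Q \<phi>)"
      by (simp add: eq_on_positive_def)
    ultimately show ?thesis using that(1) unfolding B_asymp_def by blast
  qed
  show uniq: "\<exists>Z\<in>\<C>. eq_on_positive S Y Z"
    if "Y \<in> dual S" "eq_on_positive S (dist_deriv Y) (\<lambda>\<phi>. \<Lambda> (Y \<phi>) + F \<phi>)" for Y
    using system_solution_in_class[OF \<Lambda> \<mu>s zero F _ that(2)] that(1)
    unfolding in_class_def dual_iff by blast
  show "Y \<in> B_asymp \<kappa> S L" if "Y \<in> dual L" "Y \<in> dual S"
    "eq_on_positive S (dist_deriv Y) (\<lambda>\<phi>. \<Lambda> (Y \<phi>) + F \<phi>)" for Y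
    using uniq[OF that(2,3)] B_asympI[OF that(1)] by blast
  obtain Y Y' where Y: "Y' \<in> \<C>" "\<And>\<phi>. \<phi> \<in> carrier L \<Longrightarrow> Y \<phi> = Y' \<phi>"
    "eq_on_positive S (dist_deriv Y) (\<lambda>\<phi>. \<Lambda> (Y \<phi>) + F \<phi>)"
    using system_solution_exists[OF \<Lambda> \<mu>s zero F] by blast
  have YS: "Y \<phi> = Y' \<phi>" if "\<phi> \<in> carrier S" for \<phi> using that Y(2) S_subset by blast
  have "Y \<in> dual L" "Y \<in> dual S"
    using dual_cong[of Y' L Y, OF _ L(1) Y(2)] dual_cong[of Y' S Y, OF _ S_space YS] L(2,3) Y(1)
    by blast+
  moreover have "Y \<in> B_asymp \<kappa> S L"
    by (rule B_asympI[OF \<open>Y \<in> dual L\<close> Y(1)]) (auto simp: eq_on_positive_def positive_part_iff YS)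
  ultimately show "\<exists>Y\<in>B_asymp \<kappa> S L. (\<exists>Y'\<in>\<C>. \<forall>\<phi>\<in>carrier S. Y \<phi> = Y' \<phi>) \<and> Y \<in> dual S \<and>
      eq_on_positive S (dist_deriv Y) (\<lambda>\<phi>. \<Lambda> (Y \<phi>) + F \<phi>)"
    using Y YS by blast
qed

lemma regular_translate:
  assumes \<phi>: "continuous_on UNIV \<phi>" "\<And>t. t \<notin> {-r..r} \<Longrightarrow> \<phi> t = 0"
    and h: "continuous_on UNIV h"
  shows "regular h (\<lambda>t. \<phi> (t - x)) = regular (\<lambda>t. h (t + x)) \<phi>"
proof -
  define g where "g t = \<phi> (t - x) *\<^sub>C h t" for t
  have "continuous_on {-r + x..r + x} g"
    unfolding g_def
    by (intro scaleC.continuous_on continuous_on_compose2[OF \<phi>(1)] continuous_on_subset[OF h]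
        continuous_intros) auto
  then have int: "(g has_integral integral {-r + x..r + x} g) {-r + x..r + x}"
    by (intro integrable_integral integrable_continuous_real)
  have "(g has_integral integral {-r + x..r + x} g) UNIV"
  proof (rule has_integral_on_superset[OF int])
    fix t assume "t \<notin> {-r + x..r + x}"
    then have "t - x \<notin> {-r..r}" by auto
    then have "\<phi> (t - x) = 0" by (rule \<phi>(2))
    then show "g t = 0" by (simp add: g_def scaleC.zero_left)
  qed simp
  moreover have "((\<lambda>t. g (t + x)) has_integral integral {-r + x..r + x} g) {-r..r}"
    using has_integral_affinity'[of g _ "-r + x" "r + x" 1 x] int by simp
  then have "((\<lambda>t. g (t + x)) has_integral integral {-r + x..r + x} g) UNIV"
    by (rule has_integral_on_superset) (auto simp: g_def \<phi>(2) scaleC.zero_left)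
  ultimately have "integral UNIV g = integral UNIV (\<lambda>t. g (t + x))"
    by (metis integral_unique)
  then show ?thesis by (simp add: regular_def g_def[abs_def])
qed

text \<open>Replacing \<open>\<phi>\<close> by its maximum on \<open>[-r, r]\<close> makes the bound the same average for all derivatives of a test
function.\<close>

lemma regular_norm_le_window:
  assumes \<phi>: "continuous_on UNIV \<phi>" "\<And>t. t \<notin> {-r..r} \<Longrightarrow> \<phi> t = 0" "\<And>t. cmod (\<phi> t) \<le> m"
    and h: "continuous_on UNIV h" "bounded (range h)"
  shows "norm (regular h \<phi>) \<le> m * (\<integral>s. indicator {-r..r} s * norm (h s) \<partial>lborel)"
proof -
  obtain B where B: "\<And>t. norm (h t) \<le> B" using h(2) unfolding bounded_iff by auto
  have int\<phi>: "integrable lborel \<phi>" by (rule integrable_compact_continuous[OF \<phi>(1,2)])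
  have dom: "integrable lborel (\<lambda>t. k t * norm (h t))" if "integrable lborel k" for k
    by (rule weighted_dominated_convergence(2)[of k "\<lambda>_ t. norm (h t)" B, OF _ _ _ tendsto_const])
       (use h B that in \<open>auto intro!: borel_measurable_continuous_onI continuous_on_norm\<close>)
  have ind: "integrable lborel (indicat_real {-r..r})"
    by (rule integrable_real_indicator) (auto simp: emeasure_lborel_Icc_eq)
  have "norm (regular h \<phi>) \<le> (\<integral>t. cmod (\<phi> t) * norm (h t) \<partial>lborel)"
    by (rule regular_norm_le[OF \<phi>(1) int\<phi> h])
  also have "\<dots> \<le> (\<integral>t. m * (indicator {-r..r} t * norm (h t)) \<partial>lborel)"
  proof (rule integral_mono)
    show "integrable lborel (\<lambda>t. cmod (\<phi> t) * norm (h t))" by (rule dom) (use int\<phi> in auto)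
    show "integrable lborel (\<lambda>t. m * (indicator {-r..r} t * norm (h t)))"
      by (intro integrable_mult_right dom ind)
    show "cmod (\<phi> t) * norm (h t) \<le> m * (indicator {-r..r} t * norm (h t))" for t
      using \<phi>(2,3)[of t] by (cases "t \<in> {-r..r}") (auto intro: mult_right_mono)
  qed
  also have "\<dots> = m * (\<integral>s. indicator {-r..r} s * norm (h s) \<partial>lborel)"
    by (rule integral_mult_right_zero)
  finally show ?thesis .
qed

section \<open>Distributions\<close>

lemma carrier_test: "\<phi> \<in> carrier test_space \<longleftrightarrow> smooth \<phi> \<and> (\<exists>r. \<forall>t. t \<notin> {-r..r} \<longrightarrow> \<phi> t = 0)"
proof
  assume "\<phi> \<in> carrier test_space"
  then obtain K where K: "compact K" "supp \<phi> \<subseteq> K" and s: "smooth \<phi>"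
    by (auto simp: test_space_def ind_limit_def test_space_on_def Let_def)
  obtain r where "\<forall>t\<in>K. norm t \<le> r" using compact_imp_bounded[OF K(1)] unfolding bounded_iff by blast
  then have "\<phi> t = 0" if "t \<notin> {-r..r}" for t
    using K(2) not_in_supp[of t \<phi>] that by (force simp: abs_le_iff)
  with s show "smooth \<phi> \<and> (\<exists>r. \<forall>t. t \<notin> {-r..r} \<longrightarrow> \<phi> t = 0)" by blast
next
  assume "smooth \<phi> \<and> (\<exists>r. \<forall>t. t \<notin> {-r..r} \<longrightarrow> \<phi> t = 0)"
  then obtain r where s: "smooth \<phi>" and r: "\<And>t. t \<notin> {-r..r} \<Longrightarrow> \<phi> t = 0" by blast
  have "supp \<phi> \<subseteq> {-r..r}" by (rule supp_subsetI) (use r in auto)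
  with s show "\<phi> \<in> carrier test_space"
    by (auto simp: test_space_def ind_limit_def test_space_on_def Let_def)
qed

lemma common_support:
  fixes f g :: "real \<Rightarrow> complex"
  assumes "\<exists>r. \<forall>t. t \<notin> {-r..r} \<longrightarrow> f t = 0" "\<exists>r. \<forall>t. t \<notin> {-r..r} \<longrightarrow> g t = 0"
  shows "\<exists>r. \<forall>t. t \<notin> {-r..r} \<longrightarrow> f t = 0 \<and> g t = 0"
proof -
  obtain r1 r2 where r: "\<forall>t. t \<notin> {-r1..r1} \<longrightarrow> f t = 0" "\<forall>t. t \<notin> {-r2..r2} \<longrightarrow> g t = 0"
    using assms by blast
  show ?thesis
  proof (intro exI[of _ "max r1 r2"] allI impI)
    fix t assume "t \<notin> {- max r1 r2..max r1 r2}"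
    then have "t \<notin> {-r1..r1}" "t \<notin> {-r2..r2}" by auto
    then show "f t = 0 \<and> g t = 0" using r by blast
  qed
qed

lemma function_space_test: "function_space (carrier test_space)"
  unfolding function_space_def
proof (intro conjI ballI allI)
  fix f g assume "f \<in> carrier test_space" "g \<in> carrier test_space"
  then have "smooth f" "smooth g" "\<exists>r. \<forall>t. t \<notin> {-r..r} \<longrightarrow> f t = 0 \<and> g t = 0"
    unfolding carrier_test using common_support[of f g] by simp_all
  then show "(\<lambda>t. f t + g t) \<in> carrier test_space"
    unfolding carrier_test by (metis add_0 smooth_add)
next
  fix c f assume "f \<in> carrier test_space"
  then show "(\<lambda>t. c * f t) \<in> carrier test_space"
    unfolding carrier_test by (metis mult_zero_right smooth_cmult)
qed (simp add: carrier_test smooth_zero)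

lemma test_subset_DL1: "carrier test_space \<subseteq> carrier DL1_space"
proof
  fix \<phi> assume "\<phi> \<in> carrier test_space"
  then obtain r where s: "smooth \<phi>" and r: "\<And>t. t \<notin> {-r..r} \<Longrightarrow> \<phi> t = 0"
    unfolding carrier_test by blast
  have "integrable lborel (nderiv j \<phi>)" for j
    by (rule integrable_compact_continuous[where r = r])
      (use s r nderiv_vanishes[of "{-r..r}" \<phi>] in \<open>auto intro: continuous_on_nderiv\<close>)
  with s show "\<phi> \<in> carrier DL1_space" by (simp add: carrier_DL1)
qed

lemma primitive_in_test_class:
  assumes "smooth \<psi>" "\<exists>r. \<forall>t. t \<notin> {-r..r} \<longrightarrow> \<psi> t = 0" "\<forall>t<0. \<psi> t = 0" "integral UNIV \<psi> = 0"
  obtains \<eta> r where "smooth \<eta>" "nderiv 1 \<eta> = \<psi>" "\<And>t. t \<notin> {0..r} \<Longrightarrow> \<eta> t = 0" "r \<ge> 0"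
proof -
  obtain r where r: "\<And>t. t \<notin> {-r..r} \<Longrightarrow> \<psi> t = 0" using assms(2) by blast
  have "\<psi> t = 0" if "t \<notin> {0..\<bar>r\<bar>}" for t
  proof (cases "t < 0")
    case False
    then have "t \<notin> {-r..r}" using that by auto
    then show ?thesis by (rule r)
  qed (use assms(3) in simp)
  from primitive_compact_support[OF assms(1) this assms(4)]
  obtain \<eta> where \<eta>: "smooth \<eta>" "nderiv 1 \<eta> = \<psi>" "\<And>t. t \<notin> {0..\<bar>r\<bar>} \<Longrightarrow> \<eta> t = 0" by metis
  show ?thesis by (rule that[OF \<eta> abs_ge_zero])
qed

lemma compact_support_positive:
  "\<phi> \<in> positive_part S \<longleftrightarrow> \<phi> \<in> carrier S \<and> (\<forall>t<0. \<phi> t = 0)"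
  unfolding positive_part_def
  using not_in_supp[of _ \<phi>] supp_subsetI[of "{0..}" \<phi>] by force

interpretation test: test_pair test_space DL1_space
proof
  fix \<psi> assume "\<psi> \<in> positive_part test_space" "integral UNIV \<psi> = 0"
  then have "smooth \<psi>" "\<exists>r. \<forall>t. t \<notin> {-r..r} \<longrightarrow> \<psi> t = 0" "\<forall>t<0. \<psi> t = 0" "integral UNIV \<psi> = 0"
    unfolding compact_support_positive carrier_test by simp_all
  from primitive_in_test_class[OF this]
  obtain \<eta> r where \<eta>: "smooth \<eta>" "nderiv 1 \<eta> = \<psi>" "\<And>t. t \<notin> {0..r} \<Longrightarrow> \<eta> t = 0" "r \<ge> 0"
    by blast
  have "\<eta> \<in> positive_part test_space"
    unfolding compact_support_positive carrier_test
    using \<eta> by (auto intro!: exI[of _ r])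
  with \<eta>(2) show "\<exists>\<eta>\<in>positive_part test_space. nderiv 1 \<eta> = \<psi>" by blast
next
  fix \<phi> \<mu> assume "\<phi> \<in> carrier test_space"
  then show "(\<lambda>t. exp (\<mu> * of_real t) * \<phi> t) \<in> carrier test_space"
    unfolding carrier_test by (elim conjE exE) (simp add: smooth_exp_mult, blast)
qed (auto simp: test_subset_DL1[THEN subsetD] function_space_test carrier_test)

lemma cmod_le_SUP:
  fixes f :: "real \<Rightarrow> complex"
  assumes "continuous_on UNIV f" "\<And>t. t \<notin> {-r..r} \<Longrightarrow> f t = 0"
  shows "cmod (f t) \<le> (SUP t. cmod (f t))" and "0 \<le> (SUP t. cmod (f t))"
proof -
  have "bounded (f ` {-r..r})"
    by (intro compact_imp_bounded compact_continuous_image continuous_on_subset[OF assms(1)]) auto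
  then obtain B where B: "\<And>t. t \<in> {-r..r} \<Longrightarrow> cmod (f t) \<le> B" unfolding bounded_iff by blast
  have "cmod (f t) \<le> max B 0" for t using B[of t] assms(2)[of t] by (cases "t \<in> {-r..r}") auto
  then have "bdd_above (range (\<lambda>t. cmod (f t)))" by (meson bdd_aboveI2)
  then show *: "cmod (f t) \<le> (SUP t. cmod (f t))" for t by (intro cSUP_upper) auto
  show "0 \<le> (SUP t. cmod (f t))" using order_trans[OF norm_ge_zero *] .
qed

lemma L1_norm_le_length:
  assumes "continuous_on UNIV f" "\<And>t. t \<notin> {-r..r} \<Longrightarrow> f t = 0" "\<And>t. cmod (f t) \<le> m"
  shows "L1_norm f \<le> 2 * \<bar>r\<bar> * m"
proof -
  have "m \<ge> 0" using order_trans[OF norm_ge_zero assms(3)] .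
  have "L1_norm f \<le> (\<integral>t. m * indicator {-\<bar>r\<bar>..\<bar>r\<bar>} t \<partial>lborel)"
    unfolding L1_norm_def
  proof (rule integral_mono)
    show "integrable lborel (\<lambda>t. cmod (f t))"
      using integrable_compact_continuous[OF assms(1,2)] by auto
    show "integrable lborel (\<lambda>t. m * indicat_real {-\<bar>r\<bar>..\<bar>r\<bar>} t)"
      by (intro integrable_mult_right integrable_real_indicator) (auto simp: emeasure_lborel_Icc_eq)
    show "cmod (f t) \<le> m * indicator {-\<bar>r\<bar>..\<bar>r\<bar>} t" for t
    proof (cases "t \<in> {-\<bar>r\<bar>..\<bar>r\<bar>}")
      case False
      then have "t \<notin> {-r..r}" by auto
      then show ?thesis using assms(2) \<open>m \<ge> 0\<close> by simp
    qed (use assms(3) in simp)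
  qed
  also have "\<dots> = 2 * \<bar>r\<bar> * m" by simp
  finally show ?thesis .
qed

lemma dual_DL1_subset_dual_test:
  assumes T: "T \<in> dual DL1_space"
  shows "T \<in> dual test_space"
  unfolding test_space_def
proof (rule dual_ind_limit)
  have lin: "linear_functional (carrier DL1_space) T" using T by (simp add: dual_iff)
  show "function_space (carrier (ind_limit {K. compact K} test_space_on))"
    using function_space_test by (simp add: test_space_def)
  show "linear_functional (carrier (ind_limit {K. compact K} test_space_on)) T"
    using linear_functional_subset[OF lin test_subset_DL1] by (simp add: test_space_def)
  fix K :: "real set" assume "K \<in> {K. compact K}"
  then have "compact K" by simp
  then obtain r where r: "\<forall>t\<in>K. norm t \<le> r" using compact_imp_bounded[OF \<open>compact K\<close>] unfolding bounded_iff by blast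
  obtain C k where "C \<ge> 0" and
    C: "\<And>f. f \<in> carrier DL1_space \<Longrightarrow> norm (T f) \<le> C * (\<Sum>j\<le>k. L1_norm (nderiv j f))"
    using dual_DL1_bound[OF T] by blast
  have K: "smooth \<phi>" "\<And>t. t \<notin> {-r..r} \<Longrightarrow> \<phi> t = 0" if "\<phi> \<in> carrier (test_space_on K)" for \<phi>
  proof -
    show "smooth \<phi>" using that by (simp add: test_space_on_def)
    show "\<phi> t = 0" if "t \<notin> {-r..r}" for t
      using \<open>\<phi> \<in> carrier (test_space_on K)\<close> not_in_supp[of t \<phi>] that r
      by (force simp: test_space_on_def abs_le_iff)
  qed
  have sub: "carrier (test_space_on K) \<subseteq> carrier test_space"
  proof
    fix \<phi> assume "\<phi> \<in> carrier (test_space_on K)"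
    from K[OF this] show "\<phi> \<in> carrier test_space" unfolding carrier_test by (intro conjI exI[of _ r]) auto
  qed
  define q where "q j \<phi> = (SUP t. cmod (nderiv j \<phi> t))" for j \<phi>
  have cont: "continuous_on UNIV (nderiv j \<phi>)" and zero: "\<And>t. t \<notin> {-r..r} \<Longrightarrow> nderiv j \<phi> t = 0"
    if "\<phi> \<in> carrier (test_space_on K)" for \<phi> j
    using K[OF that] nderiv_vanishes[of "{-r..r}" \<phi>] by (auto intro: continuous_on_nderiv)
  show "T \<in> dual (test_space_on K)"
  proof (rule dual_if_bounded)
    show "function_space (carrier (test_space_on K))"
    proof -
      have eq: "carrier (test_space_on K) = {\<phi>. smooth \<phi> \<and> (\<forall>t. t \<notin> K \<longrightarrow> \<phi> t = 0)}"
        using not_in_supp supp_subsetI[OF compact_imp_closed[OF \<open>compact K\<close>]]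
        by (auto simp: test_space_on_def)
      show ?thesis unfolding function_space_def eq
        by (auto intro: smooth_zero smooth_add smooth_cmult)
    qed
    show "linear_functional (carrier (test_space_on K)) T"
      using linear_functional_subset[OF lin] sub test_subset_DL1 by blast
    show "finite (q ` {..k})" "q ` {..k} \<subseteq> snd (test_space_on K)"
      by (auto simp: q_def[abs_def] test_space_on_def)
    show "0 \<le> C * (real (Suc k) * (2 * \<bar>r\<bar>))" using \<open>C \<ge> 0\<close> by simp
    fix \<phi> assume \<phi>: "\<phi> \<in> carrier (test_space_on K)"
    have le: "L1_norm (nderiv j \<phi>) \<le> 2 * \<bar>r\<bar> * (\<Sum>p\<in>q ` {..k}. p \<phi>)" if "j \<le> k" for j
    proof -
      have "L1_norm (nderiv j \<phi>) \<le> 2 * \<bar>r\<bar> * q j \<phi>"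
        unfolding q_def by (rule L1_norm_le_length[OF cont[OF \<phi>] zero[OF \<phi>] cmod_le_SUP(1)[OF cont[OF \<phi>] zero[OF \<phi>]]])
      also have "q j \<phi> \<le> (\<Sum>p\<in>q ` {..k}. p \<phi>)"
      proof (rule member_le_sum)
        show "0 \<le> p \<phi>" if "p \<in> q ` {..k} - {q j}" for p
          using that cmod_le_SUP(2)[OF cont[OF \<phi>] zero[OF \<phi>]] by (auto simp: q_def)
      qed (use that in auto)
      finally show ?thesis by (simp add: mult_left_mono)
    qed
    have "norm (T \<phi>) \<le> C * (\<Sum>j\<le>k. L1_norm (nderiv j \<phi>))"
      by (rule C) (use \<phi> sub test_subset_DL1 in blast)
    also have "\<dots> \<le> C * (\<Sum>j\<le>k. 2 * \<bar>r\<bar> * (\<Sum>p\<in>q ` {..k}. p \<phi>))"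
      using le by (intro mult_left_mono sum_mono \<open>C \<ge> 0\<close>) auto
    also have "\<dots> = C * (real (Suc k) * (2 * \<bar>r\<bar>)) * (\<Sum>p\<in>q ` {..k}. p \<phi>)" by simp
    finally show "norm (T \<phi>) \<le> C * (real (Suc k) * (2 * \<bar>r\<bar>)) * (\<Sum>p\<in>q ` {..k}. p \<phi>)" .
  qed
qed

text \<open>The value at \<open>0\<close> of the bounded solution whose forcing is the translation function of \<open>T\<close> tested with
\<open>\<phi>\<close>; formally \<open>\<integral>\<^sub>0\<^sup>\<infinity> exp (\<mu> s) \<langle>T, \<phi>(\<cdot> + s)\<rangle> ds\<close>, the convolution of \<open>T\<close> with the decaying
exponential.\<close>

definition resolvent :: "complex \<Rightarrow> ((real \<Rightarrow> complex) \<Rightarrow> 'e::complex_banach) \<Rightarrow> (real \<Rightarrow> complex) \<Rightarrow> 'e" where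
  "resolvent \<mu> T \<phi> = (SOME v. bounded_solution \<mu> (\<lambda>x. translate x T \<phi>) v) 0"

context
  fixes T :: "(real \<Rightarrow> complex) \<Rightarrow> 'e::complex_banach" and \<mu> :: complex
  assumes T: "T \<in> dual DL1_space" and \<mu>: "Re \<mu> < 0"
begin

lemma translate_continuous_bounded:
  assumes \<phi>: "\<phi> \<in> carrier DL1_space"
  shows "continuous_on UNIV (\<lambda>x. translate x T \<phi>)" "bounded (range (\<lambda>x. translate x T \<phi>))"
proof -
  show "continuous_on UNIV (\<lambda>x. translate x T \<phi>)"
    using translate_has_derivative[OF T \<phi>]
    by (meson continuous_at_imp_continuous_on has_vector_derivative_continuous)
  obtain C k where "\<And>f. f \<in> carrier DL1_space \<Longrightarrow> norm (T f) \<le> C * (\<Sum>j\<le>k. L1_norm (nderiv j f))"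
    using dual_DL1_bound[OF T] by blast
  from translate_bound[OF this \<phi>] show "bounded (range (\<lambda>x. translate x T \<phi>))"
    unfolding bounded_iff by blast
qed

text \<open>Translating \<open>\<phi>\<close> translates the forcing, and bounded solutions are unique, so the whole bounded
solution, and not just its value at \<open>0\<close>, is the translation function of the resolvent.\<close>

lemma resolvent_bounded_solution:
  assumes \<phi>: "\<phi> \<in> carrier DL1_space"
  shows "bounded_solution \<mu> (\<lambda>x. translate x T \<phi>) (\<lambda>x. translate x (resolvent \<mu> T) \<phi>)"
proof -
  have ex: "bounded_solution \<mu> (\<lambda>x. translate x T \<psi>) (SOME v. bounded_solution \<mu> (\<lambda>x. translate x T \<psi>) v)"
    if \<psi>: "\<psi> \<in> carrier DL1_space" for \<psi>
  proof -
    obtain v where "bounded_solution \<mu> (\<lambda>x. translate x T \<psi>) v"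
      by (rule bounded_solution_exists[OF \<mu> translate_continuous_bounded[OF \<psi>]])
    then have "\<exists>v. bounded_solution \<mu> (\<lambda>x. translate x T \<psi>) v" by blast
    then show ?thesis by (rule someI_ex)
  qed
  define v where "v = (SOME v. bounded_solution \<mu> (\<lambda>x. translate x T \<phi>) v)"
  have v: "bounded_solution \<mu> (\<lambda>x. translate x T \<phi>) v" unfolding v_def by (rule ex[OF \<phi>])
  have "translate x (resolvent \<mu> T) \<phi> = v x" for x
  proof -
    have "translate y T (\<lambda>t. \<phi> (t - x)) = translate (y + x) T \<phi>" for y
      by (simp add: translate_def algebra_simps)
    then have "bounded_solution \<mu> (\<lambda>y. translate (y + x) T \<phi>)
        (SOME v. bounded_solution \<mu> (\<lambda>y. translate y T (\<lambda>t. \<phi> (t - x))) v)"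
      using ex[OF DL1_translate[OF \<phi>, of x]] by simp
    from bounded_solution_unique[OF \<mu> this bounded_solution_translate[OF v]]
    show ?thesis by (simp add: translate_def resolvent_def)
  qed
  with v show ?thesis by simp
qed

lemma resolvent_dual: "resolvent \<mu> T \<in> dual DL1_space"
proof -
  have lin: "linear_functional (carrier DL1_space) T" using T by (simp add: dual_iff)
  obtain C k where "C \<ge> 0" and
    C: "\<And>f. f \<in> carrier DL1_space \<Longrightarrow> norm (T f) \<le> C * (\<Sum>j\<le>k. L1_norm (nderiv j f))"
    using dual_DL1_bound[OF T] by blast
  show ?thesis
  proof (rule dual_DL1_if_bounded)
    show "linear_functional (carrier DL1_space) (resolvent \<mu> T)"
      unfolding linear_functional_def
    proof (intro conjI ballI allI)
      fix f g assume f: "f \<in> carrier DL1_space" and g: "g \<in> carrier DL1_space"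
      have fg: "(\<lambda>t. f t + g t) \<in> carrier DL1_space"
        using function_space_DL1 f g by (simp add: function_space_def)
      have "translate x T (\<lambda>t. f t + g t) = translate x T f + translate x T g" for x
        using lin DL1_translate[OF f, of x] DL1_translate[OF g, of x]
        by (simp add: linear_functional_def translate_def)
      then have "bounded_solution \<mu> (\<lambda>x. translate x T (\<lambda>t. f t + g t))
          (\<lambda>x. translate x (resolvent \<mu> T) f + translate x (resolvent \<mu> T) g)"
        using bounded_solution_add[OF resolvent_bounded_solution[OF f] resolvent_bounded_solution[OF g]]
        by simp
      from fun_cong[OF bounded_solution_unique[OF \<mu> resolvent_bounded_solution[OF fg] this], of 0]
      show "resolvent \<mu> T (\<lambda>t. f t + g t) = resolvent \<mu> T f + resolvent \<mu> T g"
        by (simp add: translate_def)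
    next
      fix c f assume f: "f \<in> carrier DL1_space"
      have cf: "(\<lambda>t. c * f t) \<in> carrier DL1_space"
        using function_space_DL1 f by (simp add: function_space_def)
      have "translate x T (\<lambda>t. c * f t) = c *\<^sub>C translate x T f" for x
        using lin DL1_translate[OF f, of x] by (simp add: linear_functional_def translate_def)
      then have "bounded_solution \<mu> (\<lambda>x. translate x T (\<lambda>t. c * f t))
          (\<lambda>x. c *\<^sub>C translate x (resolvent \<mu> T) f)"
        using bounded_solution_complex_linear[OF complex_linear_scale resolvent_bounded_solution[OF f]]
        by simp
      from fun_cong[OF bounded_solution_unique[OF \<mu> resolvent_bounded_solution[OF cf] this], of 0]
      show "resolvent \<mu> T (\<lambda>t. c * f t) = c *\<^sub>C resolvent \<mu> T f"
        by (simp add: translate_def)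
    qed
    show "C / - Re \<mu> \<ge> 0" using \<open>C \<ge> 0\<close> \<mu> by (intro divide_nonneg_pos) auto
    fix f assume f: "f \<in> carrier DL1_space"
    have "norm (translate 0 (resolvent \<mu> T) f) \<le> (C * (\<Sum>j\<le>k. L1_norm (nderiv j f))) / - Re \<mu>"
      by (rule bounded_solution_norm[OF \<mu> resolvent_bounded_solution[OF f]
            translate_continuous_bounded(1)[OF f] translate_bound[OF C f]])
    then show "norm (resolvent \<mu> T f) \<le> C / - Re \<mu> * (\<Sum>j\<le>k. L1_norm (nderiv j f))"
      by (simp add: translate_def)
  qed
qed

text \<open>The translation function of the resolvent has two derivatives at \<open>0\<close>: one from the scalar equation and
one from the action of the derivative on the test function.\<close>

lemma resolvent_equation:
  assumes \<phi>: "\<phi> \<in> carrier DL1_space"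
  shows "dist_deriv (resolvent \<mu> T) \<phi> = \<mu> *\<^sub>C resolvent \<mu> T \<phi> + T \<phi>"
proof -
  have "((\<lambda>x. translate x (resolvent \<mu> T) \<phi>) has_vector_derivative
      \<mu> *\<^sub>C translate 0 (resolvent \<mu> T) \<phi> + translate 0 T \<phi>) (at 0)"
    using resolvent_bounded_solution[OF \<phi>] by (simp add: bounded_solution_def)
  from vector_derivative_unique_at[OF translate_has_derivative[OF resolvent_dual \<phi>] this]
  show ?thesis by (simp add: translate_def dist_deriv_def)
qed

lemma resolvent_B_plus0:
  assumes "T \<in> B_plus0 test_space DL1_space"
  shows "resolvent \<mu> T \<in> B_plus0 test_space DL1_space"
proof -
  have "((\<lambda>x. translate x (resolvent \<mu> T) \<phi>) \<longlongrightarrow> 0) at_top" if "\<phi> \<in> carrier test_space" for \<phi>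
  proof -
    have \<phi>: "\<phi> \<in> carrier DL1_space" using that test_subset_DL1 by blast
    show ?thesis
      by (rule bounded_solution_vanishing[OF \<mu> resolvent_bounded_solution[OF \<phi>]
            translate_continuous_bounded[OF \<phi>]])
        (use assms that in \<open>simp add: B_plus0_def\<close>)
  qed
  then show ?thesis using resolvent_dual by (simp add: B_plus0_def)
qed

text \<open>Convolution with \<open>\<phi>\<close> is the translation function of the reflected test function.\<close>

lemma resolvent_B_almost:
  assumes "T \<in> B_almost \<kappa> test_space DL1_space"
  shows "resolvent \<mu> T \<in> B_almost \<kappa> test_space DL1_space"
proof -
  have "convolution (resolvent \<mu> T) \<phi> \<in> almost \<kappa>" if \<phi>: "\<phi> \<in> carrier test_space" for \<phi>
  proof -
    define \<psi> where "\<psi> t = \<phi> (- t)" for t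
    have eq: "convolution U \<phi> = (\<lambda>x. translate x U \<psi>)" for U :: "(real \<Rightarrow> complex) \<Rightarrow> 'e"
      by (simp add: convolution_def translate_def \<psi>_def fun_eq_iff)
    have "\<psi> \<in> carrier test_space"
    proof -
      obtain r where "smooth \<phi>" "\<forall>t. t \<notin> {-r..r} \<longrightarrow> \<phi> t = 0" using \<phi> unfolding carrier_test by blast
      then show ?thesis
        unfolding carrier_test \<psi>_def using smooth_affine[of \<phi> "-1" 0] by (auto intro!: exI[of _ r])
    qed
    then have "\<psi> \<in> carrier DL1_space" using test_subset_DL1 by blast
    from bounded_solution_almost[OF \<mu> resolvent_bounded_solution[OF this]] show ?thesis
      using assms \<phi> by (auto simp: B_almost_def eq)
  qed
  then show ?thesis using resolvent_dual by (simp add: B_almost_def)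
qed

end

lemma regular_dual_DL1:
  assumes h: "continuous_on UNIV h" "bounded (range h)"
  shows "regular h \<in> dual DL1_space"
proof -
  obtain B where B: "\<And>t. norm (h t) \<le> B" using h(2) unfolding bounded_iff by auto
  have "B \<ge> 0" using order_trans[OF norm_ge_zero B] .
  show ?thesis
  proof (rule dual_DL1_if_bounded[where k = 0])
    show "linear_functional (carrier DL1_space) (regular h)"
      unfolding linear_functional_def
      by (auto intro!: regular_add_test regular_cmult_test DL1_continuous DL1_integrable h)
    show "norm (regular h f) \<le> B * (\<Sum>j\<le>0. L1_norm (nderiv j f))" if "f \<in> carrier DL1_space" for f
      using regular_norm_le_L1[OF DL1_continuous[OF that] DL1_integrable[OF that] h(1) B] by simp
  qed (rule \<open>B \<ge> 0\<close>)
qed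

lemma regular_B_plus0:
  assumes q: "continuous_on UNIV q" "bounded (range q)" "(q \<longlongrightarrow> 0) at_top"
  shows "regular q \<in> B_plus0 test_space DL1_space"
proof -
  have "((\<lambda>x. translate x (regular q) \<phi>) \<longlongrightarrow> 0) at_top" if \<phi>: "\<phi> \<in> carrier test_space" for \<phi>
  proof -
    obtain r where s: "smooth \<phi>" and r: "\<And>t. t \<notin> {-r..r} \<Longrightarrow> \<phi> t = 0"
      using \<phi> unfolding carrier_test by blast
    have c: "continuous_on UNIV \<phi>" using continuous_on_nderiv[OF s, of UNIV 0] by simp
    define m where "m = (SUP t. cmod (\<phi> t))"
    have m: "cmod (\<phi> t) \<le> m" for t unfolding m_def by (rule cmod_le_SUP(1)[OF c r])
    have "norm (translate x (regular q) \<phi>) \<le> m * (\<integral>s. indicator {-r..r} s * norm (q (s + x)) \<partial>lborel)" for x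
    proof -
      have "translate x (regular q) \<phi> = regular (\<lambda>t. q (t + x)) \<phi>"
        unfolding translate_def by (rule regular_translate[OF c r q(1)])
      moreover have "continuous_on UNIV (\<lambda>t. q (t + x))"
        by (rule continuous_on_compose2[OF q(1)]) (auto intro: continuous_intros)
      moreover have "bounded (range (\<lambda>t. q (t + x)))" by (rule bounded_subset[OF q(2)]) auto
      ultimately show ?thesis using regular_norm_le_window[where r = r, OF c r m] by simp
    qed
    then show ?thesis
      by (intro Lim_null_comparison[OF always_eventually tendsto_mult_right_zero[OF window_average_vanishes[OF q]]]) auto
  qed
  then show ?thesis using regular_dual_DL1[OF q(1,2)] by (simp add: B_plus0_def)
qed

definition asymp_sums :: "almost_kind \<Rightarrow> lcs \<Rightarrow> lcs \<Rightarrow> ((real \<Rightarrow> complex) \<Rightarrow> 'e::complex_banach) set" where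
  "asymp_sums \<kappa> S L = {(\<lambda>\<phi>. T \<phi> + Q \<phi>) |T Q. T \<in> B_almost \<kappa> S L \<and> Q \<in> B_plus0 S L}"

lemma asymp_sumsI: "T \<in> B_almost \<kappa> S L \<Longrightarrow> Q \<in> B_plus0 S L \<Longrightarrow> (\<lambda>\<phi>. T \<phi> + Q \<phi>) \<in> asymp_sums \<kappa> S L"
  unfolding asymp_sums_def by blast

lemma solvable_class_asymp_sums: "solvable_class test_space DL1_space
  (asymp_sums \<kappa> test_space DL1_space :: ((real \<Rightarrow> complex) \<Rightarrow> 'e::complex_banach) set)"
proof unfold_locales
  fix T U :: "(real \<Rightarrow> complex) \<Rightarrow> 'e" and \<Lambda> :: "'e \<Rightarrow> 'e" and \<mu> c
  assume "T \<in> asymp_sums \<kappa> test_space DL1_space"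
  then obtain T1 TQ where T: "T = (\<lambda>\<phi>. T1 \<phi> + TQ \<phi>)"
    "T1 \<in> B_almost \<kappa> test_space DL1_space" "TQ \<in> B_plus0 test_space DL1_space"
    unfolding asymp_sums_def by blast
  have dual: "T1 \<in> dual DL1_space" "TQ \<in> dual DL1_space"
    using T by (auto simp: B_almost_def B_plus0_def)
  have "linear_functional (carrier DL1_space) T"
    unfolding T using dual_add[OF dual] by (simp add: dual_iff)
  then show "linear_functional (carrier test_space) T"
    by (rule linear_functional_subset[OF _ test_subset_DL1])
  {
    assume "U \<in> asymp_sums \<kappa> test_space DL1_space"
    then obtain U1 UQ where U: "U = (\<lambda>\<phi>. U1 \<phi> + UQ \<phi>)"
      "U1 \<in> B_almost \<kappa> test_space DL1_space" "UQ \<in> B_plus0 test_space DL1_space"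
      unfolding asymp_sums_def by blast
    show "(\<lambda>\<phi>. T \<phi> + U \<phi>) \<in> asymp_sums \<kappa> test_space DL1_space"
      unfolding asymp_sums_def mem_Collect_eq
      by (rule exI[of _ "\<lambda>\<phi>. T1 \<phi> + U1 \<phi>"], rule exI[of _ "\<lambda>\<phi>. TQ \<phi> + UQ \<phi>"])
        (auto simp: T(1) U(1) intro: B_almost_add B_plus0_add T(2,3) U(2,3))
  }
  {
    assume \<Lambda>: "complex_linear \<Lambda>"
    show "(\<lambda>\<phi>. \<Lambda> (T \<phi>)) \<in> asymp_sums \<kappa> test_space DL1_space"
      unfolding asymp_sums_def mem_Collect_eq
      by (rule exI[of _ "\<lambda>\<phi>. \<Lambda> (T1 \<phi>)"], rule exI[of _ "\<lambda>\<phi>. \<Lambda> (TQ \<phi>)"])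
        (auto simp: T(1) complex_linearD[OF \<Lambda>] intro: B_almost_complex_linear[OF \<Lambda>]
          B_plus0_complex_linear[OF \<Lambda>] T(2,3))
  }
  {
    assume \<mu>: "Re \<mu> < 0"
    define V where "V \<phi> = resolvent \<mu> T1 \<phi> + resolvent \<mu> TQ \<phi>" for \<phi>
    have "V \<in> asymp_sums \<kappa> test_space DL1_space"
      unfolding asymp_sums_def V_def
      using resolvent_B_almost[OF dual(1) \<mu> T(2)] resolvent_B_plus0[OF dual(2) \<mu> T(3)] by blast
    moreover have "dist_deriv V \<phi> = \<mu> *\<^sub>C V \<phi> + T \<phi>" if "\<phi> \<in> positive_part test_space" for \<phi>
    proof -
      have "\<phi> \<in> carrier DL1_space" using that test_subset_DL1 by (auto simp: positive_part_def)
      from resolvent_equation[OF dual(1) \<mu> this] resolvent_equation[OF dual(2) \<mu> this]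
      show ?thesis
        by (simp add: V_def[abs_def] dist_deriv_def T(1) scaleC_add_right algebra_simps)
    qed
    ultimately show "\<exists>U\<in>asymp_sums \<kappa> test_space DL1_space. \<forall>\<phi>\<in>positive_part test_space.
      nderiv 1 \<phi> \<in> carrier DL1_space \<longrightarrow> dist_deriv U \<phi> = \<mu> *\<^sub>C U \<phi> + T \<phi>" by blast
  }
next
  fix \<mu> and c :: 'e assume \<mu>: "Re \<mu> < 0"
  note e = half_exp_bounded_continuous[OF \<mu>, of c]
  have "bounded (range (half_exp \<mu> c))" using e(2) unfolding bounded_iff by blast
  then have "regular (half_exp \<mu> c) \<in> B_plus0 test_space DL1_space"
    by (rule regular_B_plus0[OF e(1) _ e(3)])
  moreover have "(\<lambda>\<phi>. 0 :: 'e) \<in> B_almost \<kappa> test_space DL1_space"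
    unfolding B_almost_def mem_Collect_eq
  proof (intro conjI ballI)
    show "(\<lambda>\<phi>. 0 :: 'e) \<in> dual DL1_space"
      by (rule dual_DL1_if_bounded[where C = 0 and k = 0])
        (auto simp: linear_functional_def scaleC.zero_right)
    show "convolution (\<lambda>\<phi>. 0 :: 'e) \<phi> \<in> almost \<kappa>" for \<phi>
      unfolding convolution_def by (rule zero_almost)
  qed
  ultimately have "(\<lambda>\<phi>. 0 + regular (half_exp \<mu> c) \<phi>) \<in> asymp_sums \<kappa> test_space DL1_space"
    by (intro asymp_sumsI)
  then show "\<exists>U\<in>asymp_sums \<kappa> test_space DL1_space. \<forall>\<phi>\<in>positive_part test_space. U \<phi> = regular (half_exp \<mu> c) \<phi>"
    by force
qed

lemma asymp_sums_subset_B_asymp: "asymp_sums \<kappa> S L \<subseteq> B_asymp \<kappa> S L"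
  by (auto simp: asymp_sums_def B_asymp_def eq_on_positive_def B_almost_def B_plus0_def
      intro!: dual_add)

theorem distribution_case:
  fixes A :: "complex ^ 'n ^ 'n" and F :: "(real \<Rightarrow> complex) \<Rightarrow> 'a::complex_banach ^ 'n"
  assumes stable: "mat_spectrum A \<subseteq> {z. Re z < 0}"
    and F: "F \<in> B_asymp \<kappa> test_space DL1_space"
  shows "\<exists>Y\<in>B_asymp \<kappa> test_space DL1_space. solution test_space A F Y"
    and "solution test_space A F Y \<Longrightarrow> \<exists>Z\<in>B_asymp \<kappa> test_space DL1_space. eq_on_positive test_space Y Z"
    and "solution test_space A F Y \<Longrightarrow> Y \<in> dual DL1_space \<Longrightarrow> Y \<in> B_asymp \<kappa> test_space DL1_space"
proof -
  let ?\<C> = "asymp_sums \<kappa> test_space DL1_space :: ((real \<Rightarrow> complex) \<Rightarrow> 'a ^ 'n) set"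
  interpret C: solvable_class test_space DL1_space ?\<C> by (rule solvable_class_asymp_sums)
  obtain \<mu>s where \<mu>s: "\<And>\<mu>. \<mu> \<in> set \<mu>s \<Longrightarrow> Re \<mu> < 0"
    "\<And>y :: 'a ^ 'n. shift_prod (mat_act A) \<mu>s y = 0"
    using stable_matrix_annihilated[OF stable] by blast
  have "C.in_class F"
  proof -
    obtain T Q where "T \<in> B_almost \<kappa> test_space DL1_space" "Q \<in> B_plus0 test_space DL1_space"
      "eq_on_positive test_space F (\<lambda>\<phi>. T \<phi> + Q \<phi>)" using F unfolding B_asymp_def by blast
    then show ?thesis
      unfolding C.in_class_def by (intro bexI[of _ "\<lambda>\<phi>. T \<phi> + Q \<phi>"] asymp_sumsI)
  qed
  have sub: "?\<C> \<subseteq> B_asymp \<kappa> test_space DL1_space" by (rule asymp_sums_subset_B_asymp)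
  then have dual: "?\<C> \<subseteq> dual DL1_space" by (auto simp: B_asymp_def)
  then have dual': "?\<C> \<subseteq> dual test_space" using dual_DL1_subset_dual_test by blast
  note * = C.stable_system_solutions[OF complex_linear_mat_act \<mu>s \<open>C.in_class F\<close> function_space_DL1 dual dual' sub]
  show "\<exists>Y\<in>B_asymp \<kappa> test_space DL1_space. solution test_space A F Y"
    using *(1) unfolding solution_def by blast
  show "\<exists>Z\<in>B_asymp \<kappa> test_space DL1_space. eq_on_positive test_space Y Z"
    if "solution test_space A F Y" using *(2) that sub unfolding solution_def by blast
  show "Y \<in> B_asymp \<kappa> test_space DL1_space"
    if "solution test_space A F Y" "Y \<in> dual DL1_space" using *(3) that unfolding solution_def by blast
qed

section \<open>Bounded asymptotically almost functions\<close>

definition bounded_asymp :: "almost_kind \<Rightarrow> (real \<Rightarrow> 'e::complex_banach) set" where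
  "bounded_asymp \<kappa> = {f \<in> asymp_almost \<kappa>. bounded (range f)}"

text \<open>For a bounded function the decomposition on \<open>[0, \<infinity>)\<close> extends to the line, since the difference
\<open>f - g\<close> is bounded and continuous everywhere.\<close>

lemma bounded_asymp_iff: "f \<in> bounded_asymp \<kappa> \<longleftrightarrow>
    (\<exists>g\<in>almost \<kappa>. \<exists>q. continuous_on UNIV q \<and> bounded (range q) \<and> (q \<longlongrightarrow> 0) at_top \<and>
      f = (\<lambda>t. g t + q t))"
proof
  assume f: "f \<in> bounded_asymp \<kappa>"
  then obtain g q where g: "g \<in> almost \<kappa>" and q: "(q \<longlongrightarrow> 0) at_top" "\<And>t. t \<ge> 0 \<Longrightarrow> f t = g t + q t"
    unfolding bounded_asymp_def asymp_almost_def by blast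
  define q' where "q' t = f t - g t" for t
  have "continuous_on UNIV q'"
    unfolding q'_def using f almost_continuous[OF g]
    by (intro continuous_on_diff) (auto simp: bounded_asymp_def asymp_almost_def)
  moreover have "bounded (range q')"
    unfolding q'_def using f almost_bounded[OF g]
    by (intro bounded_minus_comp) (auto simp: bounded_asymp_def)
  moreover have "(q' \<longlongrightarrow> 0) at_top"
    using q(1)
  proof (rule Lim_transform_eventually)
    show "\<forall>\<^sub>F t in at_top. q t = q' t"
      using eventually_ge_at_top[of 0] by eventually_elim (simp add: q'_def q(2))
  qed
  ultimately show "\<exists>g\<in>almost \<kappa>. \<exists>q. continuous_on UNIV q \<and> bounded (range q) \<and> (q \<longlongrightarrow> 0) at_top \<and>
      f = (\<lambda>t. g t + q t)"
    using g by (intro bexI[of _ g] exI[of _ q']) (auto simp: q'_def)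
next
  assume "\<exists>g\<in>almost \<kappa>. \<exists>q. continuous_on UNIV q \<and> bounded (range q) \<and> (q \<longlongrightarrow> 0) at_top \<and>
      f = (\<lambda>t. g t + q t)"
  then obtain g q where g: "g \<in> almost \<kappa>" and q: "continuous_on UNIV q" "bounded (range q)"
    "(q \<longlongrightarrow> 0) at_top" "f = (\<lambda>t. g t + q t)" by blast
  have "continuous_on UNIV f" unfolding q(4) by (intro continuous_on_add almost_continuous[OF g] q(1))
  moreover have "bounded (range f)" unfolding q(4) by (intro bounded_plus_comp almost_bounded[OF g] q(2))
  moreover have "continuous_on {0..} q" using q(1) by (rule continuous_on_subset) simp
  ultimately show "f \<in> bounded_asymp \<kappa>"
    using g q unfolding bounded_asymp_def asymp_almost_def by blast
qed

lemma bounded_asympD: "f \<in> bounded_asymp \<kappa> \<Longrightarrow> continuous_on UNIV f" "f \<in> bounded_asymp \<kappa> \<Longrightarrow> bounded (range f)"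
  by (auto simp: bounded_asymp_def asymp_almost_def)

lemma bounded_asympI:
  "g \<in> almost \<kappa> \<Longrightarrow> continuous_on UNIV q \<Longrightarrow> bounded (range q) \<Longrightarrow> (q \<longlongrightarrow> 0) at_top \<Longrightarrow>
    (\<lambda>t. g t + q t) \<in> bounded_asymp \<kappa>"
  unfolding bounded_asymp_iff by blast

lemma bounded_asymp_add:
  assumes "f1 \<in> bounded_asymp \<kappa>" "f2 \<in> bounded_asymp \<kappa>"
  shows "(\<lambda>t. f1 t + f2 t) \<in> bounded_asymp \<kappa>"
proof -
  obtain g1 q1 where 1: "g1 \<in> almost \<kappa>" "continuous_on UNIV q1" "bounded (range q1)"
    "(q1 \<longlongrightarrow> 0) at_top" "f1 = (\<lambda>t. g1 t + q1 t)"
    using assms(1) unfolding bounded_asymp_iff by blast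
  obtain g2 q2 where 2: "g2 \<in> almost \<kappa>" "continuous_on UNIV q2" "bounded (range q2)"
    "(q2 \<longlongrightarrow> 0) at_top" "f2 = (\<lambda>t. g2 t + q2 t)"
    using assms(2) unfolding bounded_asymp_iff by blast
  have "(\<lambda>t. (g1 t + g2 t) + (q1 t + q2 t)) \<in> bounded_asymp \<kappa>"
    using tendsto_add[OF 1(4) 2(4)]
    by (intro bounded_asympI almost_add continuous_on_add bounded_plus_comp 1 2) simp
  then show ?thesis unfolding 1(5) 2(5) by (simp add: algebra_simps)
qed

lemma bounded_asymp_complex_linear:
  assumes \<Lambda>: "complex_linear \<Lambda>" and "f \<in> bounded_asymp \<kappa>"
  shows "(\<lambda>t. \<Lambda> (f t)) \<in> bounded_asymp \<kappa>"
proof -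
  note bl = complex_linearD(1)[OF \<Lambda>]
  obtain g q where 1: "g \<in> almost \<kappa>" "continuous_on UNIV q" "bounded (range q)"
    "(q \<longlongrightarrow> 0) at_top" "f = (\<lambda>t. g t + q t)"
    using assms(2) unfolding bounded_asymp_iff by blast
  have "(\<lambda>t. \<Lambda> (g t) + \<Lambda> (q t)) \<in> bounded_asymp \<kappa>"
    using bounded_linear.tendsto_zero[OF bl 1(4)] bounded_linear_image[OF 1(3) bl]
    by (intro bounded_asympI almost_bounded_linear[OF bl] 1 bounded_linear.continuous_on[OF bl])
      (simp_all add: image_image)
  then show ?thesis by (simp add: 1(5) complex_linearD(3)[OF \<Lambda>])
qed

lemma bounded_asymp_solution:
  assumes \<mu>: "Re \<mu> < 0" and "f \<in> bounded_asymp \<kappa>"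
  obtains v where "bounded_solution \<mu> f v" "v \<in> bounded_asymp \<kappa>"
proof -
  obtain g q where 1: "g \<in> almost \<kappa>" "continuous_on UNIV q" "bounded (range q)"
    "(q \<longlongrightarrow> 0) at_top" "f = (\<lambda>t. g t + q t)"
    using assms(2) unfolding bounded_asymp_iff by blast
  obtain vg where vg: "bounded_solution \<mu> g vg"
    by (rule bounded_solution_exists[OF \<mu> almost_continuous[OF 1(1)] almost_bounded[OF 1(1)]])
  obtain vq where vq: "bounded_solution \<mu> q vq" by (rule bounded_solution_exists[OF \<mu> 1(2,3)])
  have "(\<lambda>t. vg t + vq t) \<in> bounded_asymp \<kappa>"
    using vq by (intro bounded_asympI bounded_solution_almost[OF \<mu> vg 1(1)]
        bounded_solution_continuous[OF vq] bounded_solution_vanishing[OF \<mu> vq 1(2,3,4)])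
      (simp add: bounded_solution_def)
  with bounded_solution_add[OF vg vq] show ?thesis using that unfolding 1(5) by blast
qed

lemma half_exp_bounded_asymp: "Re \<mu> < 0 \<Longrightarrow> half_exp \<mu> c \<in> bounded_asymp \<kappa>"
  using bounded_asympI[OF zero_almost, of "half_exp \<mu> c" \<kappa>] half_exp_bounded_continuous[of \<mu> c]
  by (auto simp: bounded_iff)

lemma zero_bounded_asymp: "(\<lambda>t. 0) \<in> bounded_asymp \<kappa>"
  using bounded_asympI[OF zero_almost, of "\<lambda>t. 0" \<kappa>] by simp

section \<open>Ultradifferentiable test functions\<close>

text \<open>The two classes differ only in a quantifier over the scale \<open>h\<close>. Membership of a test function uses
\<open>for_scales\<close>, growth bounds on coefficients and continuity of functionals use the dual quantifier
\<open>co_scales\<close>, and a pairing of both happens on a common scale (\<open>scales_meet\<close>).\<close>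

fun for_scales :: "ultra_class \<Rightarrow> (real \<Rightarrow> bool) \<Rightarrow> bool" where
  "for_scales Beurling P \<longleftrightarrow> (\<forall>h>0. P h)"
| "for_scales Roumieu P \<longleftrightarrow> (\<exists>h>0. P h)"

fun co_scales :: "ultra_class \<Rightarrow> (real \<Rightarrow> bool) \<Rightarrow> bool" where
  "co_scales Beurling P \<longleftrightarrow> (\<exists>h>0. P h)"
| "co_scales Roumieu P \<longleftrightarrow> (\<forall>h>0. P h)"

lemma scales_meet: "for_scales s P \<Longrightarrow> co_scales s Q \<Longrightarrow> \<exists>h>0. P h \<and> Q h"
  by (cases s) auto

lemma for_scales_mono:
  assumes "for_scales s P" "\<And>h. h > 0 \<Longrightarrow> P h \<Longrightarrow> Q h"
  shows "for_scales s Q"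
  using assms by (cases s) auto

lemma for_scales_rescale:
  assumes "for_scales s P" "c > 0" "\<And>h. h > 0 \<Longrightarrow> P h \<Longrightarrow> Q (c * h)"
  shows "for_scales s Q"
proof (cases s)
  case Beurling
  have "Q h" if "h > 0" for h
    using assms(3)[of "h / c"] assms(1,2) that Beurling by simp
  then show ?thesis using Beurling by simp
next
  case Roumieu
  then obtain h where "h > 0" "P h" using assms(1) by auto
  then have "c * h > 0" "Q (c * h)" using assms(2,3) by auto
  then show ?thesis using Roumieu by auto
qed

lemma for_scales_conj:
  assumes "for_scales s P" "for_scales s Q"
    and "\<And>h h'. 0 < h' \<Longrightarrow> h' \<le> h \<Longrightarrow> P h \<Longrightarrow> P h'" "\<And>h h'. 0 < h' \<Longrightarrow> h' \<le> h \<Longrightarrow> Q h \<Longrightarrow> Q h'"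
  shows "for_scales s (\<lambda>h. P h \<and> Q h)"
proof (cases s)
  case Roumieu
  then obtain h1 h2 where "h1 > 0" "P h1" "h2 > 0" "Q h2" using assms by auto
  then show ?thesis
    using Roumieu assms(3)[of "min h1 h2" h1] assms(4)[of "min h1 h2" h2]
    by (auto intro!: exI[of _ "min h1 h2"])
qed (use assms in auto)

lemma co_scales_mono: "co_scales s P \<Longrightarrow> (\<And>h. h > 0 \<Longrightarrow> P h \<Longrightarrow> Q h) \<Longrightarrow> co_scales s Q"
  by (cases s) auto

lemma carrier_ultra_limit: "\<phi> \<in> carrier (ultra_limit s \<L>) \<longleftrightarrow> for_scales s (\<lambda>h. \<phi> \<in> carrier (\<L> h))"
  by (cases s) (auto simp: proj_limit_def ind_limit_def Let_def)

lemma ultra_limit_dual: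
  assumes lin: "linear_functional (carrier (ultra_limit s \<L>)) T"
    and sp: "function_space (carrier (ultra_limit s \<L>))" "\<And>h. h > 0 \<Longrightarrow> function_space (carrier (\<L> h))"
    and snd: "\<And>h. snd (\<L> h) = {N h}"
    and bound: "co_scales s (\<lambda>h. \<exists>C\<ge>0. \<forall>f\<in>carrier (\<L> h). f \<in> carrier (ultra_limit s \<L>) \<longrightarrow> norm (T f) \<le> C * N h f)"
  shows "T \<in> dual (ultra_limit s \<L>)"
proof (cases s)
  case Beurling
  then obtain h C where h: "h > 0" "C \<ge> 0" and
    C: "\<And>f. f \<in> carrier (\<L> h) \<Longrightarrow> f \<in> carrier (ultra_limit s \<L>) \<Longrightarrow> norm (T f) \<le> C * N h f"
    using bound by auto
  show ?thesis
  proof (rule dual_if_bounded[where Q = "{N h}", OF sp(1) lin])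
    show "{N h} \<subseteq> snd (ultra_limit s \<L>)" using h snd Beurling by (auto simp: proj_limit_def)
    show "norm (T f) \<le> C * (\<Sum>p\<in>{N h}. p f)" if "f \<in> carrier (ultra_limit s \<L>)" for f
      using C[OF _ that] that h(1) Beurling unfolding carrier_ultra_limit by simp
  qed (use h in auto)
next
  case Roumieu
  have sub: "carrier (\<L> h) \<subseteq> carrier (ultra_limit s \<L>)" if "h > 0" for h
    using that Roumieu by (auto simp: ind_limit_def Let_def)
  have "T \<in> dual (ind_limit {0<..} \<L>)"
  proof (rule dual_ind_limit)
    fix h :: real assume "h \<in> {0<..}"
    then have h: "h > 0" by simp
    then obtain C where "C \<ge> 0" and
      C: "\<And>f. f \<in> carrier (\<L> h) \<Longrightarrow> f \<in> carrier (ultra_limit s \<L>) \<Longrightarrow> norm (T f) \<le> C * N h f"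
      using bound Roumieu by auto
    show "T \<in> dual (\<L> h)"
      by (rule dual_if_bounded[where Q = "{N h}" and C = C, OF sp(2)[OF h] linear_functional_subset[OF lin sub[OF h]]])
        (use C sub[OF h] snd \<open>C \<ge> 0\<close> in auto)
  qed (use sp(1) lin Roumieu in auto)
  then show ?thesis using Roumieu by simp
qed

locale ultra_weight =
  fixes M :: "nat \<Rightarrow> real" and s :: ultra_class
  assumes M_pos: "\<And>p. 0 < M p" and M_zero: "M 0 = 1" and M_summable: "cond_M3' M"
begin

abbreviation "\<S> \<equiv> ultra_test_space s M"
abbreviation "\<L> \<equiv> ultra_DL1_space s M"

definition sup_growth :: "(real \<Rightarrow> complex) \<Rightarrow> real \<Rightarrow> bool" where
  "sup_growth \<phi> h \<longleftrightarrow> (\<exists>C\<ge>0. \<forall>p t. h ^ p * cmod (nderiv p \<phi> t) \<le> C * M p)"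

definition L1_growth :: "(real \<Rightarrow> complex) \<Rightarrow> real \<Rightarrow> bool" where
  "L1_growth \<phi> h \<longleftrightarrow> (\<exists>C\<ge>0. \<forall>p. h ^ p * L1_norm (nderiv p \<phi>) \<le> C * M p)"

lemma M_ratio_null: "(\<lambda>p. M p / M (Suc p)) \<longlonglongrightarrow> 0"
  using M_summable unfolding cond_M3'_def by (rule summable_LIMSEQ_zero)

lemma M_ratio_bounded: obtains D where "D \<ge> 0" "\<And>p. M p \<le> D * M (Suc p)"
proof -
  obtain D where D: "\<And>p. norm (M p / M (Suc p)) \<le> D"
    using convergent_imp_Bseq[OF convergentI[OF M_ratio_null]] unfolding Bseq_def by blast
  have "D \<ge> 0" using order_trans[OF norm_ge_zero D] .
  moreover have "M p \<le> D * M (Suc p)" for p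
    using D[of p] M_pos[of p] M_pos[of "Suc p"] by (simp add: divide_le_eq)
  ultimately show ?thesis by (rule that)
qed

lemma sup_growth_antimono: "0 < h' \<Longrightarrow> h' \<le> h \<Longrightarrow> sup_growth \<phi> h \<Longrightarrow> sup_growth \<phi> h'"
  unfolding sup_growth_def
  by (meson mult_right_mono norm_ge_zero order_trans power_mono less_imp_le)

lemma L1_growth_antimono: "0 < h' \<Longrightarrow> h' \<le> h \<Longrightarrow> L1_growth \<phi> h \<Longrightarrow> L1_growth \<phi> h'"
  unfolding L1_growth_def
  by (meson mult_right_mono L1_norm_nonneg order_trans power_mono less_imp_le)

lemma carrier_ultra_DL1_h: "\<phi> \<in> carrier (ultra_DL1_space_h M h) \<longleftrightarrow> \<phi> \<in> carrier DL1_space \<and> L1_growth \<phi> h"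
proof -
  have "bdd_above (range (\<lambda>p. h ^ p * L1_norm (nderiv p \<phi>) / M p)) \<longleftrightarrow> L1_growth \<phi> h"
  proof
    assume "bdd_above (range (\<lambda>p. h ^ p * L1_norm (nderiv p \<phi>) / M p))"
    then obtain C where C: "\<And>p. h ^ p * L1_norm (nderiv p \<phi>) / M p \<le> C"
      unfolding bdd_above_def by auto
    have "h ^ p * L1_norm (nderiv p \<phi>) \<le> max C 0 * M p" for p
      using C[of p] M_pos[of p] by (simp add: divide_le_eq le_max_iff_disj max_mult_distrib_right)
    then show "L1_growth \<phi> h" unfolding L1_growth_def by (intro exI[of _ "max C 0"]) auto
  next
    assume "L1_growth \<phi> h"
    then obtain C where "\<And>p. h ^ p * L1_norm (nderiv p \<phi>) \<le> C * M p" unfolding L1_growth_def by blast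
    then have "h ^ p * L1_norm (nderiv p \<phi>) / M p \<le> C" for p
      using M_pos[of p] by (simp add: divide_le_eq)
    then show "bdd_above (range (\<lambda>p. h ^ p * L1_norm (nderiv p \<phi>) / M p))" by (intro bdd_aboveI2)
  qed
  then show ?thesis by (simp add: ultra_DL1_space_h_def)
qed

lemma carrier_ultra_test_h:
  assumes "compact K"
  shows "\<phi> \<in> carrier (ultra_test_space_h M K h) \<longleftrightarrow>
    smooth \<phi> \<and> (\<forall>t. t \<notin> K \<longrightarrow> \<phi> t = 0) \<and> sup_growth \<phi> h"
proof -
  have supp: "supp \<phi> \<subseteq> K \<longleftrightarrow> (\<forall>t. t \<notin> K \<longrightarrow> \<phi> t = 0)"
    using not_in_supp[of _ \<phi>] supp_subsetI[OF compact_imp_closed[OF assms], of \<phi>] by blast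
  have "bdd_above ((\<lambda>(p, t). h ^ p * cmod (nderiv p \<phi> t) / M p) ` (UNIV \<times> K)) \<longleftrightarrow> sup_growth \<phi> h"
    if zero: "\<forall>t. t \<notin> K \<longrightarrow> \<phi> t = 0"
  proof
    assume "bdd_above ((\<lambda>(p, t). h ^ p * cmod (nderiv p \<phi> t) / M p) ` (UNIV \<times> K))"
    then obtain C where C: "\<And>p t. t \<in> K \<Longrightarrow> h ^ p * cmod (nderiv p \<phi> t) / M p \<le> C"
      unfolding bdd_above_def by (auto simp: image_iff)
    have "h ^ p * cmod (nderiv p \<phi> t) \<le> max C 0 * M p" for p t
    proof (cases "t \<in> K")
      case True
      then show ?thesis
        using C[of t p] M_pos[of p] by (simp add: divide_le_eq le_max_iff_disj max_mult_distrib_right)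
    next
      case False
      then have "nderiv p \<phi> t = 0"
        using nderiv_vanishes[OF compact_imp_closed[OF assms], of \<phi> t p] zero by blast
      then show ?thesis using M_pos[of p] by simp
    qed
    then show "sup_growth \<phi> h" unfolding sup_growth_def by (intro exI[of _ "max C 0"]) auto
  next
    assume "sup_growth \<phi> h"
    then obtain C where "\<And>p t. h ^ p * cmod (nderiv p \<phi> t) \<le> C * M p" unfolding sup_growth_def by blast
    then have "h ^ p * cmod (nderiv p \<phi> t) / M p \<le> C" for p t
      using M_pos[of p] by (simp add: divide_le_eq)
    then show "bdd_above ((\<lambda>(p, t). h ^ p * cmod (nderiv p \<phi> t) / M p) ` (UNIV \<times> K))"
      by (auto intro!: bdd_aboveI[of _ C])
  qed
  then show ?thesis by (auto simp: ultra_test_space_h_def supp)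
qed

lemma for_scales_const: "for_scales s (\<lambda>h. P \<and> Q h) \<longleftrightarrow> P \<and> for_scales s Q"
proof (cases s)
  case Beurling
  have "(\<forall>h>0::real. P \<and> Q h) \<longleftrightarrow> P \<and> (\<forall>h>0. Q h)" using zero_less_one by blast
  then show ?thesis using Beurling by simp
qed auto

lemma carrier_L: "\<phi> \<in> carrier \<L> \<longleftrightarrow> \<phi> \<in> carrier DL1_space \<and> for_scales s (L1_growth \<phi>)"
  unfolding ultra_DL1_space_def carrier_ultra_limit carrier_ultra_DL1_h for_scales_const by simp

lemma carrier_S: "\<phi> \<in> carrier \<S> \<longleftrightarrow> \<phi> \<in> carrier test_space \<and> for_scales s (sup_growth \<phi>)"
proof -
  have "\<phi> \<in> carrier \<S> \<longleftrightarrow> (\<exists>K. compact K \<and> \<phi> \<in> carrier (ultra_limit s (ultra_test_space_h M K)))"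
    unfolding ultra_test_space_def ind_limit_def Let_def by simp
  also have "\<dots> \<longleftrightarrow> (\<exists>K. compact K \<and> (smooth \<phi> \<and> (\<forall>t. t \<notin> K \<longrightarrow> \<phi> t = 0)) \<and> for_scales s (sup_growth \<phi>))"
  proof (intro ex_cong1 conj_cong refl)
    fix K :: "real set" assume K: "compact K"
    show "\<phi> \<in> carrier (ultra_limit s (ultra_test_space_h M K)) \<longleftrightarrow>
        (smooth \<phi> \<and> (\<forall>t. t \<notin> K \<longrightarrow> \<phi> t = 0)) \<and> for_scales s (sup_growth \<phi>)"
      unfolding carrier_ultra_limit carrier_ultra_test_h[OF K] conj_assoc[symmetric] for_scales_const ..
  qed
  also have "\<dots> \<longleftrightarrow> (smooth \<phi> \<and> (\<exists>K. compact K \<and> (\<forall>t. t \<notin> K \<longrightarrow> \<phi> t = 0))) \<and> for_scales s (sup_growth \<phi>)"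
    by blast
  also have "(smooth \<phi> \<and> (\<exists>K. compact K \<and> (\<forall>t. t \<notin> K \<longrightarrow> \<phi> t = 0))) \<longleftrightarrow> \<phi> \<in> carrier test_space"
  proof -
    have "(\<exists>K. compact K \<and> (\<forall>t. t \<notin> K \<longrightarrow> \<phi> t = 0)) \<longleftrightarrow> (\<exists>r. \<forall>t. t \<notin> {-r..r} \<longrightarrow> \<phi> t = 0)"
    proof
      assume "\<exists>K. compact K \<and> (\<forall>t. t \<notin> K \<longrightarrow> \<phi> t = 0)"
      then obtain K where K: "compact K" "\<forall>t. t \<notin> K \<longrightarrow> \<phi> t = 0" by blast
      obtain r where r: "\<forall>t\<in>K. norm t \<le> r" using compact_imp_bounded[OF K(1)] unfolding bounded_iff by blast
      have "\<phi> t = 0" if "t \<notin> {-r..r}" for t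
        using that r K(2) by (force simp: abs_le_iff)
      then show "\<exists>r. \<forall>t. t \<notin> {-r..r} \<longrightarrow> \<phi> t = 0" by blast
    qed (blast intro: compact_Icc)
    then show ?thesis unfolding carrier_test by simp
  qed
  finally show ?thesis .
qed

lemma sup_growth_add:
  assumes "smooth \<phi>" "smooth \<psi>" "sup_growth \<phi> h" "sup_growth \<psi> h" "h > 0"
  shows "sup_growth (\<lambda>t. \<phi> t + \<psi> t) h"
proof -
  obtain C D where C: "C \<ge> 0" "\<And>p t. h ^ p * cmod (nderiv p \<phi> t) \<le> C * M p"
    and D: "D \<ge> 0" "\<And>p t. h ^ p * cmod (nderiv p \<psi> t) \<le> D * M p"
    using assms(3,4) unfolding sup_growth_def by blast
  have "h ^ p * cmod (nderiv p (\<lambda>t. \<phi> t + \<psi> t) t) \<le> (C + D) * M p" for p t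
  proof -
    have "h ^ p * cmod (nderiv p (\<lambda>t. \<phi> t + \<psi> t) t) \<le> h ^ p * (cmod (nderiv p \<phi> t) + cmod (nderiv p \<psi> t))"
      using assms by (simp add: nderiv_plus norm_triangle_ineq mult_left_mono)
    then show ?thesis using C(2)[of p t] D(2)[of p t] by (simp add: algebra_simps)
  qed
  then show ?thesis unfolding sup_growth_def using C(1) D(1) by (intro exI[of _ "C + D"]) auto
qed

lemma sup_growth_cmult:
  assumes "smooth \<phi>" "sup_growth \<phi> h"
  shows "sup_growth (\<lambda>t. c * \<phi> t) h"
proof -
  obtain C where C: "C \<ge> 0" "\<And>p t. h ^ p * cmod (nderiv p \<phi> t) \<le> C * M p"
    using assms(2) unfolding sup_growth_def by blast
  have "h ^ p * cmod (nderiv p (\<lambda>t. c * \<phi> t) t) \<le> (cmod c * C) * M p" for p t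
    using mult_left_mono[OF C(2)[of p t], of "cmod c"] assms(1)
    by (simp add: nderiv_cmult norm_mult mult_ac)
  then show ?thesis unfolding sup_growth_def using C(1) by (intro exI[of _ "cmod c * C"]) auto
qed

lemma L1_norm_add_le:
  "integrable lborel f \<Longrightarrow> integrable lborel g \<Longrightarrow> L1_norm (\<lambda>t. f t + g t) \<le> L1_norm f + L1_norm g"
proof -
  assume f: "integrable lborel f" and g: "integrable lborel g"
  have "L1_norm (\<lambda>t. f t + g t) \<le> (\<integral>t. cmod (f t) + cmod (g t) \<partial>lborel)"
    unfolding L1_norm_def using f g by (intro integral_mono norm_triangle_ineq) auto
  also have "\<dots> = L1_norm f + L1_norm g"
    unfolding L1_norm_def using f g by (intro Bochner_Integration.integral_add) auto
  finally show ?thesis .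
qed

lemma L1_growth_add:
  assumes "\<phi> \<in> carrier DL1_space" "\<psi> \<in> carrier DL1_space" "L1_growth \<phi> h" "L1_growth \<psi> h" "h > 0"
  shows "L1_growth (\<lambda>t. \<phi> t + \<psi> t) h"
proof -
  obtain C D where C: "C \<ge> 0" "\<And>p. h ^ p * L1_norm (nderiv p \<phi>) \<le> C * M p"
    and D: "D \<ge> 0" "\<And>p. h ^ p * L1_norm (nderiv p \<psi>) \<le> D * M p"
    using assms(3,4) unfolding L1_growth_def by blast
  have "h ^ p * L1_norm (nderiv p (\<lambda>t. \<phi> t + \<psi> t)) \<le> (C + D) * M p" for p
  proof -
    have "h ^ p * L1_norm (nderiv p (\<lambda>t. \<phi> t + \<psi> t)) \<le> h ^ p * (L1_norm (nderiv p \<phi>) + L1_norm (nderiv p \<psi>))"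
      using assms by (intro mult_left_mono) (auto simp: nderiv_plus carrier_DL1 intro!: L1_norm_add_le)
    then show ?thesis using C(2)[of p] D(2)[of p] by (simp add: algebra_simps)
  qed
  then show ?thesis unfolding L1_growth_def using C(1) D(1) by (intro exI[of _ "C + D"]) auto
qed

lemma L1_growth_cmult:
  assumes "\<phi> \<in> carrier DL1_space" "L1_growth \<phi> h"
  shows "L1_growth (\<lambda>t. c * \<phi> t) h"
proof -
  obtain C where C: "C \<ge> 0" "\<And>p. h ^ p * L1_norm (nderiv p \<phi>) \<le> C * M p"
    using assms(2) unfolding L1_growth_def by blast
  have "h ^ p * L1_norm (nderiv p (\<lambda>t. c * \<phi> t)) \<le> (cmod c * C) * M p" for p
    using mult_left_mono[OF C(2)[of p], of "cmod c"] assms(1)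
    by (simp add: nderiv_cmult carrier_DL1 L1_norm_cmult mult_ac)
  then show ?thesis unfolding L1_growth_def using C(1) by (intro exI[of _ "cmod c * C"]) auto
qed

lemma sup_growth_zero: "sup_growth (\<lambda>t. 0) h"
  and L1_growth_zero: "L1_growth (\<lambda>t. 0) h"
  by (auto simp: sup_growth_def L1_growth_def nderiv_zero L1_norm_def intro!: exI[of _ 0])

lemma for_scales_True: "(\<And>h. P h) \<Longrightarrow> for_scales s P"
  by (cases s) (auto intro: exI[of _ 1])

lemma function_space_S: "function_space (carrier \<S>)"
  unfolding function_space_def
proof (intro conjI ballI allI)
  note sp = function_space_test[unfolded function_space_def]
  show "(\<lambda>t. 0) \<in> carrier \<S>" using sp by (auto simp: carrier_S sup_growth_zero intro: for_scales_True)
  fix f g assume f: "f \<in> carrier \<S>" and g: "g \<in> carrier \<S>"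
  have "for_scales s (\<lambda>h. sup_growth f h \<and> sup_growth g h)"
    using f g by (intro for_scales_conj) (auto simp: carrier_S intro: sup_growth_antimono)
  then have "for_scales s (sup_growth (\<lambda>t. f t + g t))"
    by (rule for_scales_mono) (use f g in \<open>auto simp: carrier_S carrier_test intro: sup_growth_add\<close>)
  then show "(\<lambda>t. f t + g t) \<in> carrier \<S>" using f g sp by (simp add: carrier_S)
next
  note sp = function_space_test[unfolded function_space_def]
  fix c f assume f: "f \<in> carrier \<S>"
  have "for_scales s (sup_growth (\<lambda>t. c * f t))"
    using f unfolding carrier_S carrier_test by (auto elim!: for_scales_mono intro: sup_growth_cmult)
  then show "(\<lambda>t. c * f t) \<in> carrier \<S>" using f sp by (simp add: carrier_S)
qed

lemma function_space_L_h: "h > 0 \<Longrightarrow> function_space (carrier (ultra_DL1_space_h M h))"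
  using function_space_DL1 unfolding function_space_def
  by (simp add: carrier_ultra_DL1_h L1_growth_add L1_growth_cmult L1_growth_zero)

lemma function_space_L: "function_space (carrier \<L>)"
  unfolding function_space_def
proof (intro conjI ballI allI)
  note sp = function_space_DL1[unfolded function_space_def]
  show "(\<lambda>t. 0) \<in> carrier \<L>" using sp by (auto simp: carrier_L L1_growth_zero intro: for_scales_True)
  fix f g assume f: "f \<in> carrier \<L>" and g: "g \<in> carrier \<L>"
  have "for_scales s (\<lambda>h. L1_growth f h \<and> L1_growth g h)"
    using f g by (intro for_scales_conj) (auto simp: carrier_L intro: L1_growth_antimono)
  then have "for_scales s (L1_growth (\<lambda>t. f t + g t))"
    by (rule for_scales_mono) (use f g in \<open>auto simp: carrier_L intro: L1_growth_add\<close>)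
  then show "(\<lambda>t. f t + g t) \<in> carrier \<L>" using f g sp by (simp add: carrier_L)
next
  note sp = function_space_DL1[unfolded function_space_def]
  fix c f assume f: "f \<in> carrier \<L>"
  have "for_scales s (L1_growth (\<lambda>t. c * f t))"
    using f unfolding carrier_L by (auto elim!: for_scales_mono intro: L1_growth_cmult)
  then show "(\<lambda>t. c * f t) \<in> carrier \<L>" using f sp by (simp add: carrier_L)
qed

lemma S_subset_L: "carrier \<S> \<subseteq> carrier \<L>"
proof
  fix \<phi> assume \<phi>: "\<phi> \<in> carrier \<S>"
  then obtain r where s: "smooth \<phi>" and r: "\<And>t. t \<notin> {-r..r} \<Longrightarrow> \<phi> t = 0"
    unfolding carrier_S carrier_test by blast
  have "for_scales s (L1_growth \<phi>)"
  proof (rule for_scales_mono)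
    show "for_scales s (sup_growth \<phi>)" using \<phi> by (simp add: carrier_S)
    fix h :: real assume "h > 0" "sup_growth \<phi> h"
    then obtain C where C: "C \<ge> 0" "\<And>p t. h ^ p * cmod (nderiv p \<phi> t) \<le> C * M p"
      unfolding sup_growth_def by blast
    have "h ^ p * L1_norm (nderiv p \<phi>) \<le> (2 * \<bar>r\<bar> * C) * M p" for p
    proof -
      have "cmod (nderiv p \<phi> t) \<le> C * M p / h ^ p" for t
        using C(2)[of p t] \<open>h > 0\<close> by (simp add: le_divide_eq mult.commute)
      then have "L1_norm (nderiv p \<phi>) \<le> 2 * \<bar>r\<bar> * (C * M p / h ^ p)"
        using L1_norm_le_length[of "nderiv p \<phi>" r] continuous_on_nderiv[OF s]
          nderiv_vanishes[of "{-r..r}" \<phi> _ p] r by blast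
      then show ?thesis using \<open>h > 0\<close> by (simp add: field_simps)
    qed
    then show "L1_growth \<phi> h" unfolding L1_growth_def using C(1) by (intro exI[of _ "2 * \<bar>r\<bar> * C"]) auto
  qed
  moreover have "\<phi> \<in> carrier DL1_space" using \<phi> test_subset_DL1 by (auto simp: carrier_S)
  ultimately show "\<phi> \<in> carrier \<L>" by (simp add: carrier_L)
qed

text \<open>With \<open>a p = M p / h ^ p\<close>, each application of \<open>d/dt + \<mu>\<close> moves from \<open>a p\<close> to
\<open>a (p + 1) + \<bar>\<mu>\<bar> a p\<close>. The sequence \<open>b\<close> majorizes \<open>a\<close> and satisfies \<open>\<bar>\<mu>\<bar> b n \<le> b (n + 1)\<close>, so each step
costs a factor \<open>2\<close> at most, which halves the scale. Moreover \<open>b\<close> is at most a constant times \<open>a\<close>,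
because \<open>a p / a (p + 1)\<close>, being \<open>h M p / M (p + 1)\<close>, tends to \<open>0\<close>.\<close>

lemma exp_twist_growth:
  assumes f: "smooth f" and "h > 0" and C: "C \<ge> 0" "\<And>p t. h ^ p * cmod (nderiv p f t) \<le> C * M p"
  shows "\<exists>D\<ge>0. \<forall>k t. (h / 2) ^ k * cmod (exp_twist \<mu> f k t) \<le> D * M k"
proof -
  define a where "a p = M p / h ^ p" for p
  define b where "b n = (\<Sum>i\<le>n. cmod \<mu> ^ (n - i) * a i)" for n
  have a_pos: "a p > 0" for p using M_pos \<open>h > 0\<close> by (simp add: a_def)
  have b_Suc: "b (Suc n) = a (Suc n) + cmod \<mu> * b n" for n
    by (simp add: b_def sum_distrib_left Suc_diff_le mult.assoc)
  have b_nonneg: "b n \<ge> 0" for n unfolding b_def using a_pos by (intro sum_nonneg) (simp add: less_imp_le)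
  have fa: "cmod (nderiv p f t) \<le> C * a p" for p t
    using C(2)[of p t] \<open>h > 0\<close> by (simp add: a_def le_divide_eq mult.commute)
  have ab: "a p \<le> b p" for p
    using b_nonneg by (cases p) (auto simp: b_Suc, simp add: b_def)
  have twist: "cmod (nderiv p (exp_twist \<mu> f k) t) \<le> C * 2 ^ k * b (p + k)" for p k t
  proof (induction k arbitrary: p t)
    case 0
    then show ?case using order_trans[OF fa mult_left_mono[OF ab C(1)]] by simp
  next
    case (Suc k)
    have sm: "smooth (exp_twist \<mu> f k)" by (rule smooth_exp_twist[OF f])
    have "nderiv p (exp_twist \<mu> f (Suc k)) t
        = nderiv (Suc p) (exp_twist \<mu> f k) t + \<mu> * nderiv p (exp_twist \<mu> f k) t"
      unfolding exp_twist.simps nderiv_plus[OF smooth_nderiv[OF sm] smooth_cmult[OF sm]]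
        nderiv_cmult[OF sm] nderiv_Suc ..
    also have "cmod \<dots> \<le> C * 2 ^ k * b (Suc p + k) + cmod \<mu> * (C * 2 ^ k * b (p + k))"
      using norm_triangle_ineq[of "nderiv (Suc p) (exp_twist \<mu> f k) t" "\<mu> * nderiv p (exp_twist \<mu> f k) t"]
        Suc.IH[of "Suc p" t] mult_left_mono[OF Suc.IH[of p t], of "cmod \<mu>"]
      by (simp add: norm_mult)
    also have "\<dots> = C * 2 ^ k * (b (Suc (p + k)) + cmod \<mu> * b (p + k))" by (simp add: algebra_simps)
    also have "\<dots> \<le> C * 2 ^ k * (2 * b (Suc (p + k)))"
      using C(1) a_pos[of "Suc (p + k)"] by (intro mult_left_mono) (auto simp: b_Suc)
    finally show ?case by (simp add: mult_ac)
  qed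
  have "(\<lambda>p. cmod \<mu> * (h * (M p / M (Suc p)))) \<longlonglongrightarrow> cmod \<mu> * (h * 0)"
    by (intro tendsto_intros M_ratio_null)
  then have "\<forall>\<^sub>F p in sequentially. cmod \<mu> * (h * (M p / M (Suc p))) < 1 / 2"
    by (intro order_tendstoD) auto
  then obtain P where P: "\<And>p. p \<ge> P \<Longrightarrow> cmod \<mu> * (h * (M p / M (Suc p))) < 1 / 2"
    unfolding eventually_sequentially by blast
  have step: "cmod \<mu> * a p \<le> a (Suc p) / 2" if "p \<ge> P" for p
    using P[OF that] M_pos[of p] M_pos[of "Suc p"] \<open>h > 0\<close> by (simp add: a_def field_simps)
  define E where "E = max 2 (Max ((\<lambda>p. b p / a p) ` {..P}))"
  have bE: "b p \<le> E * a p" for p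
  proof (induction p)
    have le: "b p \<le> E * a p" if "p \<le> P" for p
    proof -
      have "b p / a p \<le> E" unfolding E_def by (rule max.coboundedI2) (use that in \<open>auto intro: Max_ge\<close>)
      then show ?thesis using a_pos[of p] by (simp add: divide_le_eq)
    qed
    { case 0 show ?case by (rule le) simp }
    { case (Suc p)
      show ?case
      proof (cases "Suc p \<le> P")
        case False
        have "E \<ge> 2" by (simp add: E_def)
        have "cmod \<mu> * b p \<le> E * (cmod \<mu> * a p)" using mult_left_mono[OF Suc, of "cmod \<mu>"] by (simp add: mult_ac)
        also have "\<dots> \<le> E * (a (Suc p) / 2)" using False \<open>E \<ge> 2\<close> by (intro mult_left_mono step) auto
        finally have "b (Suc p) \<le> a (Suc p) + E / 2 * a (Suc p)" by (simp add: b_Suc)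
        also have "\<dots> \<le> E / 2 * a (Suc p) + E / 2 * a (Suc p)"
          using \<open>E \<ge> 2\<close> a_pos[of "Suc p"] by (intro add_right_mono) simp
        finally show ?thesis by simp
      qed (rule le)
    }
  qed
  have "E \<ge> 0" by (simp add: E_def)
  have "(h / 2) ^ k * cmod (exp_twist \<mu> f k t) \<le> (C * E) * M k" for k t
  proof -
    have "cmod (exp_twist \<mu> f k t) \<le> C * 2 ^ k * (E * a k)"
      using twist[of 0 k t] mult_left_mono[OF bE[of k], of "C * 2 ^ k"] C(1) by simp
    then have "(h / 2) ^ k * cmod (exp_twist \<mu> f k t) \<le> (h / 2) ^ k * (C * 2 ^ k * (E * a k))"
      using \<open>h > 0\<close> by (intro mult_left_mono) auto
    also have "\<dots> = (C * E) * M k" using \<open>h > 0\<close> by (simp add: a_def power_divide)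
    finally show ?thesis .
  qed
  then show ?thesis using C(1) \<open>E \<ge> 0\<close> by (intro exI[of _ "C * E"]) auto
qed

lemma S_exp_mult:
  assumes \<phi>: "\<phi> \<in> carrier \<S>"
  shows "(\<lambda>t. exp (\<mu> * of_real t) * \<phi> t) \<in> carrier \<S>"
proof -
  obtain r where s: "smooth \<phi>" and r: "\<And>t. t \<notin> {-r..r} \<Longrightarrow> \<phi> t = 0"
    using \<phi> unfolding carrier_S carrier_test by blast
  have "for_scales s (sup_growth (\<lambda>t. exp (\<mu> * of_real t) * \<phi> t))"
  proof (rule for_scales_rescale[where c = "1 / 2"])
    show "for_scales s (sup_growth \<phi>)" using \<phi> by (simp add: carrier_S)
    fix h :: real assume "h > 0" "sup_growth \<phi> h"
    then obtain C where C: "C \<ge> 0" "\<And>p t. h ^ p * cmod (nderiv p \<phi> t) \<le> C * M p"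
      unfolding sup_growth_def by blast
    obtain D where D: "D \<ge> 0" "\<And>k t. (h / 2) ^ k * cmod (exp_twist \<mu> \<phi> k t) \<le> D * M k"
      using exp_twist_growth[OF s \<open>h > 0\<close> C] by blast
    define E where "E = exp (\<bar>Re \<mu>\<bar> * \<bar>r\<bar>)"
    have "(h / 2) ^ p * cmod (nderiv p (\<lambda>t. exp (\<mu> * of_real t) * \<phi> t) t) \<le> (E * D) * M p" for p t
    proof (cases "t \<in> {-r..r}")
      case False
      have "nderiv p (\<lambda>t. exp (\<mu> * of_real t) * \<phi> t) t = 0"
        by (rule nderiv_vanishes[of "{-r..r}"]) (use False r in auto)
      then show ?thesis using D(1) M_pos[of p] by (simp add: E_def)
    next
      case True
      have "Re \<mu> * t \<le> \<bar>Re \<mu> * t\<bar>" by simp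
      also have "\<dots> \<le> \<bar>Re \<mu>\<bar> * \<bar>r\<bar>" unfolding abs_mult using True by (intro mult_left_mono) auto
      finally have "cmod (exp (\<mu> * of_real t)) \<le> E" by (simp add: E_def)
      then have "cmod (exp (\<mu> * of_real t)) * ((h / 2) ^ p * cmod (exp_twist \<mu> \<phi> p t)) \<le> E * (D * M p)"
        using \<open>h > 0\<close> by (intro mult_mono D(2)) (auto simp: E_def)
      then show ?thesis unfolding nderiv_exp_mult[OF s] norm_mult by (simp add: mult_ac)
    qed
    then show "sup_growth (\<lambda>t. exp (\<mu> * of_real t) * \<phi> t) (1 / 2 * h)"
      unfolding sup_growth_def using D(1) by (intro exI[of _ "E * D"]) (auto simp: E_def)
  qed simp
  moreover have "(\<lambda>t. exp (\<mu> * of_real t) * \<phi> t) \<in> carrier test_space"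
    unfolding carrier_test using s r by (auto intro!: smooth_exp_mult exI[of _ r])
  ultimately show ?thesis by (simp add: carrier_S)
qed

text \<open>The derivatives of a primitive are those of \<open>\<psi>\<close> with the index shifted by one, which is harmless as
\<open>M p / M (p + 1)\<close> is bounded.\<close>

lemma S_primitive_in:
  assumes \<psi>: "\<psi> \<in> carrier \<S>" and \<eta>: "smooth \<eta>" "nderiv 1 \<eta> = \<psi>" "\<And>t. t \<notin> {0..r} \<Longrightarrow> \<eta> t = 0" "r \<ge> 0"
  shows "\<eta> \<in> carrier \<S>"
proof -
  obtain D where D: "D \<ge> 0" "\<And>p. M p \<le> D * M (Suc p)" using M_ratio_bounded by blast
  have cont: "continuous_on UNIV \<eta>" using continuous_on_nderiv[OF \<eta>(1), of UNIV 0] by simp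
  have zero: "\<eta> t = 0" if "t \<notin> {-r..r}" for t using \<eta>(3,4) that by auto
  define m where "m = (SUP t. cmod (\<eta> t))"
  have m: "cmod (\<eta> t) \<le> m" for t unfolding m_def by (rule cmod_le_SUP(1)[OF cont zero])
  have "m \<ge> 0" using order_trans[OF norm_ge_zero m] .
  have "for_scales s (sup_growth \<eta>)"
  proof (rule for_scales_mono)
    show "for_scales s (sup_growth \<psi>)" using \<psi> by (simp add: carrier_S)
    fix h :: real assume "h > 0" "sup_growth \<psi> h"
    then obtain C where C: "C \<ge> 0" "\<And>p t. h ^ p * cmod (nderiv p \<psi> t) \<le> C * M p"
      unfolding sup_growth_def by blast
    have "h ^ p * cmod (nderiv p \<eta> t) \<le> (m + h * C * D) * M p" for p t
    proof (cases p)
      case 0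
      have "m \<le> m + h * C * D" using \<open>h > 0\<close> C(1) D(1) by simp
      then show ?thesis using 0 m[of t] M_zero by simp
    next
      case (Suc k)
      have "h ^ Suc k * cmod (nderiv (Suc k) \<eta> t) = h * (h ^ k * cmod (nderiv k \<psi> t))"
        by (simp only: nderiv_Suc[of k] \<eta>(2) power_Suc mult.assoc)
      also have "\<dots> \<le> h * (C * M k)" using \<open>h > 0\<close> by (intro mult_left_mono C(2)) auto
      also have "\<dots> \<le> h * (C * (D * M (Suc k)))" using \<open>h > 0\<close> C(1) by (intro mult_left_mono D(2)) auto
      also have "\<dots> \<le> (m + h * C * D) * M (Suc k)"
        using \<open>m \<ge> 0\<close> M_pos[of "Suc k"] by (simp add: algebra_simps)
      finally show ?thesis using Suc by simp
    qed
    then show "sup_growth \<eta> h"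
      unfolding sup_growth_def using C(1) D(1) \<open>m \<ge> 0\<close> \<open>h > 0\<close> by (intro exI[of _ "m + h * C * D"]) auto
  qed
  moreover have "\<eta> \<in> carrier test_space" unfolding carrier_test using \<eta>(1) zero by blast
  ultimately show ?thesis by (simp add: carrier_S)
qed

sublocale test_pair \<S> \<L>
proof
  fix \<psi> assume \<psi>: "\<psi> \<in> positive_part \<S>" "integral UNIV \<psi> = 0"
  then have "smooth \<psi>" "\<exists>r. \<forall>t. t \<notin> {-r..r} \<longrightarrow> \<psi> t = 0" "\<forall>t<0. \<psi> t = 0"
    unfolding compact_support_positive carrier_S carrier_test by simp_all
  from primitive_in_test_class[OF this \<psi>(2)]
  obtain \<eta> r where \<eta>: "smooth \<eta>" "nderiv 1 \<eta> = \<psi>" "\<And>t. t \<notin> {0..r} \<Longrightarrow> \<eta> t = 0" "r \<ge> 0"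
    by blast
  have "\<eta> \<in> positive_part \<S>"
    using S_primitive_in[OF _ \<eta>(1,2) _ \<eta>(4)] \<psi>(1) \<eta>(3) unfolding compact_support_positive by simp
  with \<eta>(2) show "\<exists>\<eta>\<in>positive_part \<S>. nderiv 1 \<eta> = \<psi>" by blast
next
  show "smooth \<phi>" "\<exists>r. \<forall>t. t \<notin> {-r..r} \<longrightarrow> \<phi> t = 0" if "\<phi> \<in> carrier \<S>" for \<phi>
    using that unfolding carrier_S carrier_test by simp_all
qed (rule S_subset_L function_space_S S_exp_mult; assumption?)+

lemma S_reflect:
  assumes \<phi>: "\<phi> \<in> carrier \<S>"
  shows "(\<lambda>t. \<phi> (- t)) \<in> carrier \<S>"
proof -
  obtain r where s: "smooth \<phi>" and r: "\<And>t. t \<notin> {-r..r} \<Longrightarrow> \<phi> t = 0"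
    using \<phi> unfolding carrier_S carrier_test by blast
  have eq: "cmod (nderiv k (\<lambda>t. \<phi> (- t)) t) = cmod (nderiv k \<phi> (- t))" for k t
    using nderiv_affine[OF s, of k "-1" 0] by (simp add: norm_mult norm_power)
  have "sup_growth (\<lambda>t. \<phi> (- t)) h" if "sup_growth \<phi> h" for h
    using that unfolding sup_growth_def eq by blast
  then have "for_scales s (sup_growth (\<lambda>t. \<phi> (- t)))"
    using \<phi> for_scales_mono[of s "sup_growth \<phi>"] by (simp add: carrier_S)
  moreover have "(\<lambda>t. \<phi> (- t)) \<in> carrier test_space"
    unfolding carrier_test using smooth_affine[OF s, of "-1" 0] r by (auto intro!: exI[of _ r])
  ultimately show ?thesis by (simp add: carrier_S)
qed

end

section \<open>Ultradifferential operators applied to bounded functions\<close>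

lemma dist_deriv_pow: "(dist_deriv ^^ p) T \<phi> = (-1) ^ p *\<^sub>R T (nderiv p \<phi>)"
proof (induction p arbitrary: \<phi>)
  case (Suc p)
  have "(dist_deriv ^^ Suc p) T \<phi> = - (dist_deriv ^^ p) T (nderiv 1 \<phi>)"
    by (simp add: dist_deriv_def)
  also have "\<dots> = (-1) ^ Suc p *\<^sub>R T (nderiv (Suc p) \<phi>)"
    unfolding Suc.IH nderiv_Suc[of p] by simp
  finally show ?case .
qed simp

lemma ultradiff_eq: "ultradiff a T \<phi> = (\<Sum>p. a p *\<^sub>C (-1) ^ p *\<^sub>R T (nderiv p \<phi>))"
  unfolding ultradiff_def dist_deriv_pow ..

definition delta_coeffs :: "nat \<Rightarrow> complex" where
  "delta_coeffs p = (if p = 0 then 1 else 0)"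

lemma ultradiff_delta: "ultradiff delta_coeffs T \<phi> = T \<phi>"
proof -
  have "ultradiff delta_coeffs T \<phi> = (\<Sum>p\<in>{0}. delta_coeffs p *\<^sub>C (-1) ^ p *\<^sub>R T (nderiv p \<phi>))"
    unfolding ultradiff_eq by (rule suminf_finite) (auto simp: delta_coeffs_def scaleC.zero_left)
  then show ?thesis by (simp add: delta_coeffs_def)
qed

lemma dual_sum:
  assumes "finite J" "J \<noteq> {}" "\<And>j. j \<in> J \<Longrightarrow> T j \<in> dual S"
  shows "(\<lambda>\<phi>. \<Sum>j\<in>J. T j \<phi>) \<in> dual S"
  using assms by (induction J rule: finite_ne_induct) (auto intro: dual_add)

lemma B_almost_sum:
  assumes "finite J" "J \<noteq> {}" "\<And>j. j \<in> J \<Longrightarrow> T j \<in> B_almost \<kappa> S L"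
  shows "(\<lambda>\<phi>. \<Sum>j\<in>J. T j \<phi>) \<in> B_almost \<kappa> S L"
  using assms by (induction J rule: finite_ne_induct) (auto intro: B_almost_add)

lemma B_plus0_sum:
  assumes "finite J" "J \<noteq> {}" "\<And>j. j \<in> J \<Longrightarrow> T j \<in> B_plus0 S L"
  shows "(\<lambda>\<phi>. \<Sum>j\<in>J. T j \<phi>) \<in> B_plus0 S L"
  using assms by (induction J rule: finite_ne_induct) (auto intro: B_plus0_add)

context ultra_weight
begin

text \<open>Using half the scale leaves a factor \<open>1 / 2 ^ p\<close> in the pairing with a test function of scale \<open>h\<close>.\<close>

lemma ultradiff_coeffs_scales:
  assumes "ultradiff_coeffs s M a"
  shows "co_scales s (\<lambda>h. \<exists>C\<ge>0. \<forall>p. cmod (a p) \<le> C * (h / 2) ^ p / M p)"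
proof (cases s)
  case Beurling
  then obtain l C where "l > 0" "C > 0" "\<And>p. cmod (a p) \<le> C * l ^ p / M p" using assms by auto
  then have "2 * l > 0 \<and> (\<exists>C\<ge>0. \<forall>p. cmod (a p) \<le> C * (2 * l / 2) ^ p / M p)"
    by (intro conjI exI[of _ C]) auto
  then show ?thesis unfolding Beurling co_scales.simps by blast
next
  case Roumieu
  have "\<exists>C\<ge>0. \<forall>p. cmod (a p) \<le> C * (h / 2) ^ p / M p" if "h > 0" for h
  proof -
    have "\<exists>C>0. \<forall>p. cmod (a p) \<le> C * (h / 2) ^ p / M p"
      using assms half_gt_zero[OF that] unfolding Roumieu ultradiff_coeffs.simps by blast
    then show ?thesis by (auto intro: less_imp_le)
  qed
  then show ?thesis using Roumieu by simp
qed

lemma delta_coeffs_class: "ultradiff_coeffs s M delta_coeffs"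
proof -
  have "cmod (delta_coeffs p) \<le> 1 * l ^ p / M p" if "l > 0" for l p
    using that M_zero M_pos[of p] by (auto simp: delta_coeffs_def)
  from this[of 1] this show ?thesis by (cases s) (auto intro!: exI[of _ "1 :: real"])
qed

lemma series_bound:
  assumes "h > 0" "C \<ge> 0" "\<And>p. cmod (a p) \<le> C * (h / 2) ^ p / M p"
    and n: "\<And>p. n p \<ge> 0" "\<And>p. h ^ p * n p \<le> N * M p"
  shows "summable (\<lambda>p. cmod (a p) * n p)" "(\<Sum>p. cmod (a p) * n p) \<le> 2 * C * N"
proof -
  have le: "cmod (a p) * n p \<le> C * N * (1 / 2) ^ p" for p
  proof -
    have "cmod (a p) * n p \<le> C * (h / 2) ^ p / M p * (N * M p / h ^ p)"
      using assms(1,2) n[of p] M_pos[of p]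
      by (intro mult_mono assms(3)) (auto simp: le_divide_eq mult.commute)
    also have "\<dots> = C * N * (1 / 2) ^ p"
      using \<open>h > 0\<close> M_pos[of p] by (simp add: power_divide)
    finally show ?thesis .
  qed
  have geo: "(\<lambda>p. C * N * (1 / 2) ^ p) sums (C * N * 2)"
    using sums_mult[OF geometric_sums[of "1 / 2 :: real"], of "C * N"] by simp
  show sm: "summable (\<lambda>p. cmod (a p) * n p)"
    by (rule summable_comparison_test'[OF sums_summable[OF geo], of 0]) (use le n in \<open>simp add: abs_mult\<close>)
  have "(\<Sum>p. cmod (a p) * n p) \<le> (\<Sum>p. C * N * (1 / 2) ^ p)"
    by (rule suminf_le[OF le sm sums_summable[OF geo]])
  then show "(\<Sum>p. cmod (a p) * n p) \<le> 2 * C * N" using sums_unique[OF geo] by simp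
qed

lemma L_summable:
  assumes a: "ultradiff_coeffs s M a" and \<phi>: "\<phi> \<in> carrier \<L>"
  shows "summable (\<lambda>p. cmod (a p) * L1_norm (nderiv p \<phi>))"
proof -
  obtain h where h: "h > 0" "L1_growth \<phi> h" "\<exists>C\<ge>0. \<forall>p. cmod (a p) \<le> C * (h / 2) ^ p / M p"
    using scales_meet[OF _ ultradiff_coeffs_scales[OF a]] \<phi> unfolding carrier_L by blast
  then obtain C N where "C \<ge> 0" "\<And>p. cmod (a p) \<le> C * (h / 2) ^ p / M p"
    "\<And>p. h ^ p * L1_norm (nderiv p \<phi>) \<le> N * M p" unfolding L1_growth_def by blast
  then show ?thesis using series_bound(1)[OF h(1), of C a "\<lambda>p. L1_norm (nderiv p \<phi>)" N] L1_norm_nonneg by blast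
qed

lemma S_summable:
  assumes a: "ultradiff_coeffs s M a" and \<phi>: "\<phi> \<in> carrier \<S>"
  shows "summable (\<lambda>p. cmod (a p) * (SUP t. cmod (nderiv p \<phi> t)))"
proof -
  obtain r where sm: "smooth \<phi>" and r: "\<And>t. t \<notin> {-r..r} \<Longrightarrow> \<phi> t = 0"
    using \<phi> unfolding carrier_S carrier_test by blast
  obtain h where h: "h > 0" "sup_growth \<phi> h" "\<exists>C\<ge>0. \<forall>p. cmod (a p) \<le> C * (h / 2) ^ p / M p"
    using scales_meet[OF _ ultradiff_coeffs_scales[OF a]] \<phi> unfolding carrier_S by blast
  then obtain C N where C: "C \<ge> 0" "\<And>p. cmod (a p) \<le> C * (h / 2) ^ p / M p"
    and N: "\<And>p t. h ^ p * cmod (nderiv p \<phi> t) \<le> N * M p" unfolding sup_growth_def by blast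
  have "(SUP t. cmod (nderiv p \<phi> t)) \<le> N * M p / h ^ p" for p
    using N[of p] h(1) by (intro cSUP_least) (auto simp: le_divide_eq mult.commute)
  then have "h ^ p * (SUP t. cmod (nderiv p \<phi> t)) \<le> N * M p" for p
    using h(1) by (simp add: le_divide_eq mult.commute)
  moreover have "0 \<le> (SUP t. cmod (nderiv p \<phi> t))" for p
    by (rule cmod_le_SUP(2)[of _ r]) (use nderiv_vanishes[of "{-r..r}" \<phi> _ p] r sm in \<open>auto intro: continuous_on_nderiv\<close>)
  ultimately show ?thesis
    by (intro series_bound(1)[OF h(1) C, of "\<lambda>p. (SUP t. cmod (nderiv p \<phi> t))" N])
qed

lemma L_nderiv:
  assumes "\<phi> \<in> carrier \<L>"
  shows "continuous_on UNIV (nderiv p \<phi>)" "integrable lborel (nderiv p \<phi>)" "smooth \<phi>"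
  using assms by (auto simp: carrier_L carrier_DL1 intro: continuous_on_nderiv)

lemma ultradiff_regular_sums:
  assumes a: "ultradiff_coeffs s M a" and \<phi>: "\<phi> \<in> carrier \<L>"
    and h: "continuous_on UNIV h" "\<And>t. norm (h t) \<le> B"
  shows "summable (\<lambda>p. a p *\<^sub>C (-1) ^ p *\<^sub>R regular h (nderiv p \<phi>))"
    "norm (ultradiff a (regular h) \<phi>) \<le> B * (\<Sum>p. cmod (a p) * L1_norm (nderiv p \<phi>))"
proof -
  have le: "norm (a p *\<^sub>C (-1) ^ p *\<^sub>R regular h (nderiv p \<phi>)) \<le> B * (cmod (a p) * L1_norm (nderiv p \<phi>))" for p
  proof -
    have "norm (regular h (nderiv p \<phi>)) \<le> B * L1_norm (nderiv p \<phi>)"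
      by (rule regular_norm_le_L1[OF L_nderiv(1,2)[OF \<phi>] h])
    from mult_left_mono[OF this, of "cmod (a p)"] show ?thesis
      by (simp add: norm_scaleC mult_ac)
  qed
  have sm: "summable (\<lambda>p. B * (cmod (a p) * L1_norm (nderiv p \<phi>)))"
    by (rule summable_mult[OF L_summable[OF a \<phi>]])
  show "summable (\<lambda>p. a p *\<^sub>C (-1) ^ p *\<^sub>R regular h (nderiv p \<phi>))"
    by (rule summable_comparison_test'[OF sm, of 0]) (use le in simp)
  have "norm (ultradiff a (regular h) \<phi>) \<le> (\<Sum>p. B * (cmod (a p) * L1_norm (nderiv p \<phi>)))"
    unfolding ultradiff_eq by (rule norm_suminf_le[OF le sm])
  also have "\<dots> = B * (\<Sum>p. cmod (a p) * L1_norm (nderiv p \<phi>))"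
    by (rule suminf_mult[OF L_summable[OF a \<phi>]])
  finally show "norm (ultradiff a (regular h) \<phi>) \<le> B * (\<Sum>p. cmod (a p) * L1_norm (nderiv p \<phi>))" .
qed

lemma ultradiff_regular_summable:
  assumes "ultradiff_coeffs s M a" "\<phi> \<in> carrier \<L>" "continuous_on UNIV h" "bounded (range h)"
  shows "summable (\<lambda>p. a p *\<^sub>C (-1) ^ p *\<^sub>R regular h (nderiv p \<phi>))"
proof -
  obtain B where "\<And>t. norm (h t) \<le> B" using assms(4) unfolding bounded_iff by auto
  then show ?thesis by (rule ultradiff_regular_sums(1)[OF assms(1-3)])
qed

lemma ultradiff_regular_linear_functional:
  assumes a: "ultradiff_coeffs s M a" and h: "continuous_on UNIV h" "bounded (range h)"
  shows "linear_functional (carrier \<L>) (ultradiff a (regular h))"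
  unfolding linear_functional_def
proof (intro conjI ballI allI)
  fix f g assume f: "f \<in> carrier \<L>" and g: "g \<in> carrier \<L>"
  note fl = L_nderiv[OF f] and gl = L_nderiv[OF g]
  have "a p *\<^sub>C (-1) ^ p *\<^sub>R regular h (nderiv p (\<lambda>t. f t + g t))
      = a p *\<^sub>C (-1) ^ p *\<^sub>R regular h (nderiv p f) + a p *\<^sub>C (-1) ^ p *\<^sub>R regular h (nderiv p g)" for p
    by (simp add: nderiv_plus[OF fl(3) gl(3)] regular_add_test[OF fl(1,2) gl(1,2) h] scaleC_add_right scaleR_right_distrib)
  then show "ultradiff a (regular h) (\<lambda>t. f t + g t) = ultradiff a (regular h) f + ultradiff a (regular h) g"
    unfolding ultradiff_eq
    by (simp add: suminf_add[OF ultradiff_regular_summable[OF a f h] ultradiff_regular_summable[OF a g h]])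
next
  fix c f assume f: "f \<in> carrier \<L>"
  note fl = L_nderiv[OF f]
  have "a p *\<^sub>C (-1) ^ p *\<^sub>R regular h (nderiv p (\<lambda>t. c * f t))
      = c *\<^sub>C (a p *\<^sub>C (-1) ^ p *\<^sub>R regular h (nderiv p f))" for p
    by (simp add: nderiv_cmult[OF fl(3)] regular_cmult_test[OF fl(1,2) h] scaleC_scaleC scaleR_scaleC mult_ac)
  then show "ultradiff a (regular h) (\<lambda>t. c * f t) = c *\<^sub>C ultradiff a (regular h) f"
    unfolding ultradiff_eq
    by (simp add: bounded_linear.suminf[OF scaleC.bounded_linear_right ultradiff_regular_summable[OF a f h]])
qed

text \<open>One estimate for continuity on both test spaces: it refers to a test function only through bounds on
the integrals of its derivatives.\<close>

lemma ultradiff_regular_scales: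
  assumes a: "ultradiff_coeffs s M a" and h: "continuous_on UNIV h" "bounded (range h)"
  shows "co_scales s (\<lambda>k. \<exists>C\<ge>0. \<forall>f\<in>carrier \<L>. \<forall>N.
    (\<forall>p. k ^ p * L1_norm (nderiv p f) \<le> N * M p) \<longrightarrow> norm (ultradiff a (regular h) f) \<le> C * N)"
proof (rule co_scales_mono[OF ultradiff_coeffs_scales[OF a]])
  obtain B where B: "\<And>t. norm (h t) \<le> B" using h(2) unfolding bounded_iff by auto
  have "B \<ge> 0" using order_trans[OF norm_ge_zero B] .
  fix k :: real assume "k > 0" "\<exists>C\<ge>0. \<forall>p. cmod (a p) \<le> C * (k / 2) ^ p / M p"
  then obtain C where C: "C \<ge> 0" "\<And>p. cmod (a p) \<le> C * (k / 2) ^ p / M p" by blast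
  have "norm (ultradiff a (regular h) f) \<le> (B * (2 * C)) * N"
    if f: "f \<in> carrier \<L>" "\<forall>p. k ^ p * L1_norm (nderiv p f) \<le> N * M p" for f N
  proof -
    have "norm (ultradiff a (regular h) f) \<le> B * (\<Sum>p. cmod (a p) * L1_norm (nderiv p f))"
      by (rule ultradiff_regular_sums(2)[OF a f(1) h(1) B])
    also have "\<dots> \<le> B * (2 * C * N)"
      using f(2) by (intro mult_left_mono \<open>B \<ge> 0\<close> series_bound(2)[OF \<open>k > 0\<close> C]) (auto simp: L1_norm_nonneg)
    finally show ?thesis by (simp add: mult_ac)
  qed
  then show "\<exists>C\<ge>0. \<forall>f\<in>carrier \<L>. \<forall>N. (\<forall>p. k ^ p * L1_norm (nderiv p f) \<le> N * M p) \<longrightarrow>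
      norm (ultradiff a (regular h) f) \<le> C * N"
    using \<open>B \<ge> 0\<close> C(1) by (intro exI[of _ "B * (2 * C)"]) auto
qed

lemma ultradiff_regular_dual_L:
  assumes a: "ultradiff_coeffs s M a" and h: "continuous_on UNIV h" "bounded (range h)"
  shows "ultradiff a (regular h) \<in> dual \<L>"
  unfolding ultra_DL1_space_def
proof (rule ultra_limit_dual[where N = "\<lambda>k f. SUP p. k ^ p * L1_norm (nderiv p f) / M p"])
  show "co_scales s (\<lambda>k. \<exists>C\<ge>0. \<forall>f\<in>carrier (ultra_DL1_space_h M k).
      f \<in> carrier (ultra_limit s (ultra_DL1_space_h M)) \<longrightarrow>
      norm (ultradiff a (regular h) f) \<le> C * (SUP p. k ^ p * L1_norm (nderiv p f) / M p))"
  proof (rule co_scales_mono[OF ultradiff_regular_scales[OF a h]])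
    fix k :: real
    assume "\<exists>C\<ge>0. \<forall>f\<in>carrier \<L>. \<forall>N. (\<forall>p. k ^ p * L1_norm (nderiv p f) \<le> N * M p) \<longrightarrow>
      norm (ultradiff a (regular h) f) \<le> C * N"
    then obtain C where "C \<ge> 0" and C: "\<And>f N. f \<in> carrier \<L> \<Longrightarrow>
      (\<forall>p. k ^ p * L1_norm (nderiv p f) \<le> N * M p) \<Longrightarrow> norm (ultradiff a (regular h) f) \<le> C * N" by blast
    have "norm (ultradiff a (regular h) f) \<le> C * (SUP p. k ^ p * L1_norm (nderiv p f) / M p)"
      if f: "f \<in> carrier (ultra_DL1_space_h M k)" "f \<in> carrier \<L>" for f
    proof (rule C[OF f(2)], rule allI)
      fix p
      have "k ^ p * L1_norm (nderiv p f) / M p \<le> (SUP p. k ^ p * L1_norm (nderiv p f) / M p)"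
        by (rule cSUP_upper) (use f(1) in \<open>auto simp: ultra_DL1_space_h_def\<close>)
      then show "k ^ p * L1_norm (nderiv p f) \<le> (SUP p. k ^ p * L1_norm (nderiv p f) / M p) * M p"
        using M_pos[of p] by (simp add: divide_le_eq)
    qed
    then show "\<exists>C\<ge>0. \<forall>f\<in>carrier (ultra_DL1_space_h M k).
      f \<in> carrier (ultra_limit s (ultra_DL1_space_h M)) \<longrightarrow>
      norm (ultradiff a (regular h) f) \<le> C * (SUP p. k ^ p * L1_norm (nderiv p f) / M p)"
      using \<open>C \<ge> 0\<close> unfolding ultra_DL1_space_def by blast
  qed
qed (use ultradiff_regular_linear_functional[OF a h] function_space_L function_space_L_h
      in \<open>simp_all add: ultra_DL1_space_def[symmetric]\<close>, simp add: ultra_DL1_space_h_def)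

text \<open>The supremum norm controls the integral norm on functions supported in a fixed compact set. For the
empty set that norm is the supremum of an empty set of reals, an unspecified and possibly negative
number, and the space contains only the zero function.\<close>

lemma ultradiff_regular_dual_S:
  assumes a: "ultradiff_coeffs s M a" and h: "continuous_on UNIV h" "bounded (range h)"
  shows "ultradiff a (regular h) \<in> dual \<S>"
proof -
  let ?T = "ultradiff a (regular h)"
  let ?\<S>K = "\<lambda>K. ultra_limit s (ultra_test_space_h M K)"
  have lin: "linear_functional (carrier \<S>) ?T"
    by (rule linear_functional_subset[OF ultradiff_regular_linear_functional[OF a h] S_subset_L])
  have carrier_K: "\<phi> \<in> carrier (?\<S>K K) \<longleftrightarrow> \<phi> \<in> carrier \<S> \<and> (\<forall>t. t \<notin> K \<longrightarrow> \<phi> t = 0)"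
    if K: "compact K" for K \<phi>
  proof -
    have sub: "carrier (?\<S>K K) \<subseteq> carrier \<S>"
      using K unfolding ultra_test_space_def ind_limit_def Let_def by auto
    have eq: "\<phi> \<in> carrier (?\<S>K K) \<longleftrightarrow> (smooth \<phi> \<and> (\<forall>t. t \<notin> K \<longrightarrow> \<phi> t = 0)) \<and> for_scales s (sup_growth \<phi>)"
      unfolding carrier_ultra_limit carrier_ultra_test_h[OF K] conj_assoc[symmetric] for_scales_const ..
    show ?thesis
    proof
      assume "\<phi> \<in> carrier (?\<S>K K)"
      then show "\<phi> \<in> carrier \<S> \<and> (\<forall>t. t \<notin> K \<longrightarrow> \<phi> t = 0)" using sub eq by blast
    next
      assume "\<phi> \<in> carrier \<S> \<and> (\<forall>t. t \<notin> K \<longrightarrow> \<phi> t = 0)"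
      then show "\<phi> \<in> carrier (?\<S>K K)" unfolding eq carrier_S carrier_test by simp
    qed
  qed
  have "?T \<in> dual (?\<S>K K)" if K: "compact K" for K
  proof (rule ultra_limit_dual[where N = "\<lambda>k. ultra_norm M K k"])
    show "linear_functional (carrier (?\<S>K K)) ?T"
      by (rule linear_functional_subset[OF lin]) (auto simp: carrier_K[OF K])
    show "function_space (carrier (?\<S>K K))"
      using function_space_S unfolding function_space_def by (simp add: carrier_K[OF K])
    show "function_space (carrier (ultra_test_space_h M K k))" if "k > 0" for k
      using that unfolding function_space_def carrier_ultra_test_h[OF K] Ball_def
      by (simp add: smooth_zero smooth_add smooth_cmult sup_growth_zero sup_growth_add sup_growth_cmult)
    show "snd (ultra_test_space_h M K k) = {ultra_norm M K k}" for k
      by (simp add: ultra_test_space_h_def)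
    obtain r where r: "\<forall>t\<in>K. norm t \<le> r" using compact_imp_bounded[OF K] unfolding bounded_iff by blast
    show "co_scales s (\<lambda>k. \<exists>C\<ge>0. \<forall>f\<in>carrier (ultra_test_space_h M K k). f \<in> carrier (?\<S>K K) \<longrightarrow>
        norm (?T f) \<le> C * ultra_norm M K k f)"
    proof (rule co_scales_mono[OF ultradiff_regular_scales[OF a h]])
      fix k :: real
      assume "k > 0" and "\<exists>C\<ge>0. \<forall>f\<in>carrier \<L>. \<forall>N. (\<forall>p. k ^ p * L1_norm (nderiv p f) \<le> N * M p) \<longrightarrow>
        norm (?T f) \<le> C * N"
      then obtain C where "C \<ge> 0" and C: "\<And>f N. f \<in> carrier \<L> \<Longrightarrow>
        (\<forall>p. k ^ p * L1_norm (nderiv p f) \<le> N * M p) \<Longrightarrow> norm (?T f) \<le> C * N" by blast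
      show "\<exists>C\<ge>0. \<forall>f\<in>carrier (ultra_test_space_h M K k). f \<in> carrier (?\<S>K K) \<longrightarrow>
        norm (?T f) \<le> C * ultra_norm M K k f"
      proof (cases "K = {}")
        case True
        have "norm (?T f) \<le> 0 * ultra_norm M K k f" if "f \<in> carrier (?\<S>K K)" for f
        proof -
          have "f \<in> carrier \<S>" "\<forall>t. f t = 0" using that carrier_K[OF K] True by auto
          then have f: "f = (\<lambda>t. 0)" "f \<in> carrier \<L>" using S_subset_L by auto
          have "norm (?T f) \<le> C * 0"
            by (rule C[OF f(2)]) (simp add: f(1) nderiv_zero L1_norm_def)
          then show ?thesis by simp
        qed
        then show ?thesis by (intro exI[of _ 0]) auto
      next
        case False
        have "norm (?T f) \<le> (C * (2 * \<bar>r\<bar>)) * ultra_norm M K k f"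
          if f: "f \<in> carrier (ultra_test_space_h M K k)" "f \<in> carrier (?\<S>K K)" for f
        proof -
          have fL: "f \<in> carrier \<L>" using f(2) S_subset_L by (auto simp: carrier_K[OF K])
          have sm: "smooth f" and zero: "\<And>t. t \<notin> K \<Longrightarrow> f t = 0"
            using f(1) unfolding carrier_ultra_test_h[OF K] by auto
          have zeroK: "nderiv p f t = 0" if "t \<notin> K" for p t
            by (rule nderiv_vanishes[OF compact_imp_closed[OF K] zero that])
          have bdd: "bdd_above ((\<lambda>(p, t). k ^ p * cmod (nderiv p f t) / M p) ` (UNIV \<times> K))"
            using f(1) by (simp add: ultra_test_space_h_def)
          have le: "k ^ p * cmod (nderiv p f t) / M p \<le> ultra_norm M K k f" if "t \<in> K" for p t
            unfolding ultra_norm_def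
            using cSUP_upper[OF _ bdd, of "(p, t)"] that by simp
          have nn: "ultra_norm M K k f \<ge> 0"
          proof -
            obtain t where "t \<in> K" using False by blast
            then show ?thesis
              using order_trans[OF _ le[of t 0]] M_zero by simp
          qed
          have "cmod (nderiv p f t) \<le> ultra_norm M K k f * M p / k ^ p" for p t
          proof (cases "t \<in> K")
            case True
            then show ?thesis using le[OF True, of p] M_pos[of p] \<open>k > 0\<close> by (simp add: field_simps)
          next
            case False
            then show ?thesis using zeroK[OF False] nn M_pos[of p] \<open>k > 0\<close> by simp
          qed
          moreover have "nderiv p f t = 0" if "t \<notin> {-r..r}" for p t
            by (rule zeroK) (use that r in \<open>auto simp: abs_le_iff\<close>)
          ultimately have "L1_norm (nderiv p f) \<le> 2 * \<bar>r\<bar> * (ultra_norm M K k f * M p / k ^ p)" for p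
            using L1_norm_le_length[of "nderiv p f" r] continuous_on_nderiv[OF sm] by blast
          then have "k ^ p * L1_norm (nderiv p f) \<le> (2 * \<bar>r\<bar> * ultra_norm M K k f) * M p" for p
            using \<open>k > 0\<close> by (simp add: field_simps)
          then have "norm (?T f) \<le> C * (2 * \<bar>r\<bar> * ultra_norm M K k f)" by (intro C fL) blast
          then show ?thesis by (simp add: mult.assoc)
        qed
        then show ?thesis using \<open>C \<ge> 0\<close> by (intro exI[of _ "C * (2 * \<bar>r\<bar>)"]) auto
      qed
    qed
  qed
  then show ?thesis
    using function_space_S lin unfolding ultra_test_space_def by (intro dual_ind_limit) auto
qed

lemma ultradiff_regular_add:
  assumes a: "ultradiff_coeffs s M a" and \<phi>: "\<phi> \<in> carrier \<L>"
    and g: "continuous_on UNIV g" "bounded (range g)" and h: "continuous_on UNIV h" "bounded (range h)"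
  shows "ultradiff a (regular (\<lambda>t. g t + h t)) \<phi> = ultradiff a (regular g) \<phi> + ultradiff a (regular h) \<phi>"
proof -
  have "a p *\<^sub>C (-1) ^ p *\<^sub>R regular (\<lambda>t. g t + h t) (nderiv p \<phi>)
      = a p *\<^sub>C (-1) ^ p *\<^sub>R regular g (nderiv p \<phi>) + a p *\<^sub>C (-1) ^ p *\<^sub>R regular h (nderiv p \<phi>)" for p
    by (simp add: regular_add[OF L_nderiv(1,2)[OF \<phi>] g h] scaleC_add_right scaleR_right_distrib)
  then show ?thesis
    unfolding ultradiff_eq
    by (simp add: suminf_add[OF ultradiff_regular_summable[OF a \<phi> g] ultradiff_regular_summable[OF a \<phi> h]])
qed

lemma ultradiff_regular_complex_linear:
  assumes a: "ultradiff_coeffs s M a" and \<phi>: "\<phi> \<in> carrier \<L>"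
    and h: "continuous_on UNIV h" "bounded (range h)" and \<Lambda>: "complex_linear \<Lambda>"
  shows "ultradiff a (regular (\<lambda>t. \<Lambda> (h t))) \<phi> = \<Lambda> (ultradiff a (regular h) \<phi>)"
proof -
  have "a p *\<^sub>C (-1) ^ p *\<^sub>R regular (\<lambda>t. \<Lambda> (h t)) (nderiv p \<phi>)
      = \<Lambda> (a p *\<^sub>C (-1) ^ p *\<^sub>R regular h (nderiv p \<phi>))" for p
    by (simp add: regular_complex_linear[OF L_nderiv(1,2)[OF \<phi>] h \<Lambda>] complex_linearD(2)[OF \<Lambda>] scaleR_scaleC)
  then show ?thesis
    unfolding ultradiff_eq
    by (simp add: bounded_linear.suminf[OF complex_linearD(1)[OF \<Lambda>] ultradiff_regular_summable[OF a \<phi> h]])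
qed

text \<open>Termwise integration by parts. The series for \<open>nderiv 1 \<phi>\<close> converges because that function lies in the
larger test space.\<close>

lemma ultradiff_regular_solution:
  assumes a: "ultradiff_coeffs s M a" and \<phi>: "\<phi> \<in> carrier \<S>" "nderiv 1 \<phi> \<in> carrier \<L>"
    and v: "bounded_solution \<mu> h v" and h: "continuous_on UNIV h" "bounded (range h)"
  shows "dist_deriv (ultradiff a (regular v)) \<phi>
    = \<mu> *\<^sub>C ultradiff a (regular v) \<phi> + ultradiff a (regular h) \<phi>"
proof -
  have \<phi>L: "\<phi> \<in> carrier \<L>" using \<phi>(1) S_subset_L by blast
  obtain r where sm: "smooth \<phi>" and r: "\<And>t. t \<notin> {-r..r} \<Longrightarrow> \<phi> t = 0"
    using \<phi>(1) unfolding carrier_S carrier_test by blast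
  have vb: "continuous_on UNIV v" "bounded (range v)"
    using v bounded_solution_continuous by (auto simp: bounded_solution_def)
  note sv = ultradiff_regular_summable[OF a \<phi>L vb] and sh = ultradiff_regular_summable[OF a \<phi>L h]
    and sv' = ultradiff_regular_summable[OF a \<phi>(2) vb]
  have summand: "- (a p *\<^sub>C (-1) ^ p *\<^sub>R regular v (nderiv p (nderiv 1 \<phi>)))
      = \<mu> *\<^sub>C (a p *\<^sub>C (-1) ^ p *\<^sub>R regular v (nderiv p \<phi>)) + a p *\<^sub>C (-1) ^ p *\<^sub>R regular h (nderiv p \<phi>)" for p
  proof -
    have "dist_deriv (regular v) (nderiv p \<phi>) = \<mu> *\<^sub>C regular v (nderiv p \<phi>) + regular h (nderiv p \<phi>)"
      by (rule regular_solution[OF v h smooth_nderiv[OF sm], of r])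
        (use nderiv_vanishes[of "{-r..r}" \<phi> _ p] r in auto)
    moreover have "nderiv 1 (nderiv p \<phi>) = nderiv p (nderiv 1 \<phi>)"
      by (simp only: nderiv_add[symmetric] add.commute)
    ultimately have eq: "- regular v (nderiv p (nderiv 1 \<phi>)) = \<mu> *\<^sub>C regular v (nderiv p \<phi>) + regular h (nderiv p \<phi>)"
      by (simp add: dist_deriv_def)
    have "- (a p *\<^sub>C (-1) ^ p *\<^sub>R regular v (nderiv p (nderiv 1 \<phi>)))
        = a p *\<^sub>C (-1) ^ p *\<^sub>R (- regular v (nderiv p (nderiv 1 \<phi>)))"
      by (simp add: scaleC.minus_right)
    then show ?thesis
      unfolding eq by (simp add: scaleC_add_right scaleR_right_distrib scaleC_scaleC scaleR_scaleC mult_ac)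
  qed
  have "dist_deriv (ultradiff a (regular v)) \<phi> = (\<Sum>p. - (a p *\<^sub>C (-1) ^ p *\<^sub>R regular v (nderiv p (nderiv 1 \<phi>))))"
    unfolding dist_deriv_def ultradiff_eq by (rule suminf_minus[OF sv', symmetric])
  also have "\<dots> = (\<Sum>p. \<mu> *\<^sub>C (a p *\<^sub>C (-1) ^ p *\<^sub>R regular v (nderiv p \<phi>)))
      + (\<Sum>p. a p *\<^sub>C (-1) ^ p *\<^sub>R regular h (nderiv p \<phi>))"
    unfolding summand by (rule suminf_add[symmetric, OF bounded_linear.summable[OF scaleC.bounded_linear_right sv] sh])
  also have "(\<Sum>p. \<mu> *\<^sub>C (a p *\<^sub>C (-1) ^ p *\<^sub>R regular v (nderiv p \<phi>)))
      = \<mu> *\<^sub>C (\<Sum>p. a p *\<^sub>C (-1) ^ p *\<^sub>R regular v (nderiv p \<phi>))"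
    by (rule bounded_linear.suminf[OF scaleC.bounded_linear_right sv, symmetric])
  finally show ?thesis unfolding ultradiff_eq .
qed

lemma ultradiff_regular_translate:
  assumes \<phi>: "\<phi> \<in> carrier \<S>" and h: "continuous_on UNIV h"
  shows "ultradiff a (regular h) (\<lambda>t. \<phi> (t - x)) = ultradiff a (regular (\<lambda>t. h (t + x))) \<phi>"
proof -
  obtain r where sm: "smooth \<phi>" and r: "\<And>t. t \<notin> {-r..r} \<Longrightarrow> \<phi> t = 0"
    using \<phi> unfolding carrier_S carrier_test by blast
  have "regular h (nderiv p (\<lambda>t. \<phi> (t - x))) = regular (\<lambda>t. h (t + x)) (nderiv p \<phi>)" for p
    unfolding nderiv_translate[OF sm]
    by (rule regular_translate[OF continuous_on_nderiv[OF sm] _ h, of r])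
      (use nderiv_vanishes[of "{-r..r}" \<phi> _ p] r in auto)
  then show ?thesis unfolding ultradiff_eq by simp
qed

text \<open>A test function in \<open>S\<close> enters only through \<open>r\<close> and the constant \<open>c\<close>, uniformly in \<open>h\<close>. This serves both for
almost periodicity, with \<open>h\<close> a difference of translates, and for decay.\<close>

lemma ultradiff_regular_window:
  assumes a: "ultradiff_coeffs s M a" and \<phi>: "\<phi> \<in> carrier \<S>"
  obtains c r where "c \<ge> 0" "\<And>h :: real \<Rightarrow> 'e::complex_banach. continuous_on UNIV h \<Longrightarrow> bounded (range h) \<Longrightarrow>
    norm (ultradiff a (regular h) \<phi>) \<le> c * (\<integral>s. indicator {-r..r} s * norm (h s) \<partial>lborel)"
proof -
  obtain r where sm: "smooth \<phi>" and r: "\<And>t. t \<notin> {-r..r} \<Longrightarrow> \<phi> t = 0"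
    using \<phi> unfolding carrier_S carrier_test by blast
  define m where "m p = (SUP t. cmod (nderiv p \<phi> t))" for p
  have zero: "nderiv p \<phi> t = 0" if "t \<notin> {-r..r}" for p t
    using nderiv_vanishes[of "{-r..r}" \<phi> t p] r that by auto
  note cont = continuous_on_nderiv[OF sm, of UNIV]
  have m: "cmod (nderiv p \<phi> t) \<le> m p" for p t unfolding m_def by (rule cmod_le_SUP(1)[OF cont zero])
  have sum: "summable (\<lambda>p. cmod (a p) * m p)" unfolding m_def by (rule S_summable[OF a \<phi>])
  have m0: "m p \<ge> 0" for p using order_trans[OF norm_ge_zero m] .
  show ?thesis
  proof (rule that[of "\<Sum>p. cmod (a p) * m p" r])
    show "(\<Sum>p. cmod (a p) * m p) \<ge> 0" using m0 by (intro suminf_nonneg[OF sum]) simp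
    fix h :: "real \<Rightarrow> 'e" assume h: "continuous_on UNIV h" "bounded (range h)"
    define I where "I = (\<integral>s. indicator {-r..r} s * norm (h s) \<partial>lborel)"
    have "norm (a p *\<^sub>C (-1) ^ p *\<^sub>R regular h (nderiv p \<phi>)) \<le> cmod (a p) * m p * I" for p
      using mult_left_mono[OF regular_norm_le_window[where r = r, OF cont zero m h], of "cmod (a p)"]
      by (simp add: norm_scaleC I_def mult.assoc)
    then have "norm (ultradiff a (regular h) \<phi>) \<le> (\<Sum>p. cmod (a p) * m p * I)"
      unfolding ultradiff_eq by (rule norm_suminf_le) (rule summable_mult2[OF sum])
    also have "\<dots> = (\<Sum>p. cmod (a p) * m p) * I" by (rule suminf_mult2[OF sum, symmetric])
    finally show "norm (ultradiff a (regular h) \<phi>) \<le> (\<Sum>p. cmod (a p) * m p) * (\<integral>s. indicator {-r..r} s * norm (h s) \<partial>lborel)"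
      unfolding I_def .
  qed
qed

lemma shift_continuous_bounded:
  assumes "continuous_on UNIV (h :: real \<Rightarrow> 'e::complex_banach)" "bounded (range h)"
  shows "continuous_on UNIV (\<lambda>t. h (t + x))" "bounded (range (\<lambda>t. h (t + x)))"
proof -
  show "continuous_on UNIV (\<lambda>t. h (t + x))"
    by (rule continuous_on_compose2[OF assms(1)]) (auto intro: continuous_intros)
  show "bounded (range (\<lambda>t. h (t + x)))" by (rule bounded_subset[OF assms(2)]) auto
qed

lemma ultradiff_regular_B_almost:
  assumes a: "ultradiff_coeffs s M a" and g: "g \<in> almost \<kappa>"
  shows "ultradiff a (regular g) \<in> B_almost \<kappa> \<S> \<L>"
proof -
  note gc = almost_continuous[OF g] and gb = almost_bounded[OF g]
  have "convolution (ultradiff a (regular g)) \<phi> \<in> almost \<kappa>" if \<phi>: "\<phi> \<in> carrier \<S>" for \<phi>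
  proof -
    define \<psi> where "\<psi> t = \<phi> (- t)" for t
    have \<psi>: "\<psi> \<in> carrier \<S>" unfolding \<psi>_def by (rule S_reflect[OF \<phi>])
    then have \<psi>L: "\<psi> \<in> carrier \<L>" using S_subset_L by blast
    obtain c r where "c \<ge> 0" and c: "\<And>h :: real \<Rightarrow> 'a. continuous_on UNIV h \<Longrightarrow> bounded (range h) \<Longrightarrow>
      norm (ultradiff a (regular h) \<psi>) \<le> c * (\<integral>s. indicator {-r..r} s * norm (h s) \<partial>lborel)"
      using ultradiff_regular_window[OF a \<psi>, where ?'e = 'a] by blast
    have conv: "convolution (ultradiff a (regular g)) \<phi> x = ultradiff a (regular (\<lambda>t. g (t + x))) \<psi>" for x
      using ultradiff_regular_translate[OF \<psi> gc, of a x] by (simp add: convolution_def \<psi>_def)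
    show ?thesis
    proof (rule almost_transfer[OF g, where k = "\<lambda>s. c * indicator {-r..r} s"])
      show "integrable lborel (\<lambda>s. c * indicat_real {-r..r} s)"
        by (intro integrable_mult_right integrable_real_indicator) (auto simp: emeasure_lborel_Icc_eq)
      show "c * indicat_real {-r..r} s \<ge> 0" for s using \<open>c \<ge> 0\<close> by simp
      fix x y
      define d where "d t = g (t + x) - g (t + y)" for t
      have dc: "continuous_on UNIV d" "bounded (range d)"
        unfolding d_def by (intro continuous_on_diff bounded_minus_comp shift_continuous_bounded[OF gc gb])+
      have "ultradiff a (regular (\<lambda>t. d t + g (t + y))) \<psi> = ultradiff a (regular d) \<psi> + ultradiff a (regular (\<lambda>t. g (t + y))) \<psi>"
        by (rule ultradiff_regular_add[OF a \<psi>L dc shift_continuous_bounded[OF gc gb]])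
      then have "norm (convolution (ultradiff a (regular g)) \<phi> x - convolution (ultradiff a (regular g)) \<phi> y)
          = norm (ultradiff a (regular d) \<psi>)" by (simp add: conv d_def)
      also have "\<dots> \<le> c * (\<integral>s. indicator {-r..r} s * norm (d s) \<partial>lborel)" by (rule c[OF dc])
      also have "\<dots> = c * (\<integral>s. indicator {-r..r} (- s) * norm (d (- s)) \<partial>lborel)"
        using lborel_integral_real_affine[of "-1" "\<lambda>s. indicator {-r..r} s * norm (d s)" 0] by simp
      also have "\<dots> = (\<integral>s. c * (indicator {-r..r} (- s) * norm (d (- s))) \<partial>lborel)"
        by (rule integral_mult_right_zero[symmetric])
      also have "\<dots> = (\<integral>s. c * indicator {-r..r} s * norm (g (x - s) - g (y - s)) \<partial>lborel)"
      proof (rule Bochner_Integration.integral_cong[OF refl])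
        have "indicat_real {-r..r} (- s) = indicator {-r..r} s" for s
          by (auto split: split_indicator)
        then show "c * (indicator {-r..r} (- s) * norm (d (- s))) = c * indicator {-r..r} s * norm (g (x - s) - g (y - s))" for s
          by (simp add: d_def add.commute)
      qed
      finally show "norm (convolution (ultradiff a (regular g)) \<phi> x - convolution (ultradiff a (regular g)) \<phi> y)
          \<le> (\<integral>s. c * indicator {-r..r} s * norm (g (x - s) - g (y - s)) \<partial>lborel)" .
    qed
  qed
  then show ?thesis using ultradiff_regular_dual_L[OF a gc gb] by (simp add: B_almost_def)
qed

lemma ultradiff_regular_B_plus0:
  fixes q :: "real \<Rightarrow> 'e::complex_banach"
  assumes a: "ultradiff_coeffs s M a" and q: "continuous_on UNIV q" "bounded (range q)" "(q \<longlongrightarrow> 0) at_top"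
  shows "ultradiff a (regular q) \<in> B_plus0 \<S> \<L>"
proof -
  have "((\<lambda>x. translate x (ultradiff a (regular q)) \<phi>) \<longlongrightarrow> 0) at_top" if \<phi>: "\<phi> \<in> carrier \<S>" for \<phi>
  proof -
    obtain c r where "c \<ge> 0" and c: "\<And>h :: real \<Rightarrow> 'e. continuous_on UNIV h \<Longrightarrow> bounded (range h) \<Longrightarrow>
      norm (ultradiff a (regular h) \<phi>) \<le> c * (\<integral>s. indicator {-r..r} s * norm (h s) \<partial>lborel)"
      using ultradiff_regular_window[OF a \<phi>, where ?'e = 'e] by blast
    have "norm (translate x (ultradiff a (regular q)) \<phi>) \<le> c * (\<integral>s. indicator {-r..r} s * norm (q (s + x)) \<partial>lborel)" for x
      unfolding translate_def ultradiff_regular_translate[OF \<phi> q(1)]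
      by (rule c[OF shift_continuous_bounded[OF q(1,2)]])
    then show ?thesis
      by (intro Lim_null_comparison[OF always_eventually tendsto_mult_right_zero[OF window_average_vanishes[OF q]]]) auto
  qed
  then show ?thesis using ultradiff_regular_dual_L[OF a q(1,2)] by (simp add: B_plus0_def)
qed

end

context ultra_weight
begin

text \<open>The index type is finite and the operators are fixed, so that solving equations changes only the
functions \<open>H\<close>. The term without an operator is the one whose coefficients are \<open>delta_coeffs\<close>.\<close>

definition ultra_sums :: "almost_kind \<Rightarrow> ('i::finite \<Rightarrow> nat \<Rightarrow> complex) \<Rightarrow> ((real \<Rightarrow> complex) \<Rightarrow> 'e::complex_banach) set" where
  "ultra_sums \<kappa> b = {T. \<exists>H. (\<forall>j. H j \<in> bounded_asymp \<kappa>) \<and>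
     (\<forall>\<phi>\<in>carrier \<L>. T \<phi> = (\<Sum>j\<in>UNIV. ultradiff (b j) (regular (H j)) \<phi>))}"

lemma ultra_sumsI:
  "(\<And>j. H j \<in> bounded_asymp \<kappa>) \<Longrightarrow>
    (\<And>\<phi>. \<phi> \<in> carrier \<L> \<Longrightarrow> T \<phi> = (\<Sum>j\<in>UNIV. ultradiff (b j) (regular (H j)) \<phi>)) \<Longrightarrow> T \<in> ultra_sums \<kappa> b"
  unfolding ultra_sums_def by blast

lemma ultra_sumsE:
  assumes "T \<in> ultra_sums \<kappa> b"
  obtains H where "\<And>j. H j \<in> bounded_asymp \<kappa>"
    "\<And>\<phi>. \<phi> \<in> carrier \<L> \<Longrightarrow> T \<phi> = (\<Sum>j\<in>UNIV. ultradiff (b j) (regular (H j)) \<phi>)"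
  using assms unfolding ultra_sums_def by blast

context
  fixes b :: "'i::finite \<Rightarrow> nat \<Rightarrow> complex"
  assumes b: "\<And>j. ultradiff_coeffs s M (b j)"
begin

lemma ultra_sums_dual:
  assumes "T \<in> ultra_sums \<kappa> b"
  shows "T \<in> dual \<L>" "T \<in> dual \<S>"
proof -
  obtain H where H: "\<And>j. H j \<in> bounded_asymp \<kappa>"
    "\<And>\<phi>. \<phi> \<in> carrier \<L> \<Longrightarrow> T \<phi> = (\<Sum>j\<in>UNIV. ultradiff (b j) (regular (H j)) \<phi>)"
    using ultra_sumsE[OF assms] by blast
  have S: "T \<phi> = (\<Sum>j\<in>UNIV. ultradiff (b j) (regular (H j)) \<phi>)" if "\<phi> \<in> carrier \<S>" for \<phi>
    using H(2) that S_subset by blast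
  show "T \<in> dual \<L>"
    by (rule dual_cong[OF dual_sum function_space_L H(2)])
      (use b bounded_asympD[OF H(1)] in \<open>auto intro: ultradiff_regular_dual_L\<close>)
  show "T \<in> dual \<S>"
    by (rule dual_cong[OF dual_sum function_space_S S])
      (use b bounded_asympD[OF H(1)] in \<open>auto intro: ultradiff_regular_dual_S\<close>)
qed

text \<open>Split every \<open>H j\<close> into its almost periodic or automorphic part and its decaying part.\<close>

lemma ultra_sums_B_asymp:
  assumes "T \<in> ultra_sums \<kappa> b"
  shows "T \<in> B_asymp \<kappa> \<S> \<L>"
proof -
  obtain H where H: "\<And>j. H j \<in> bounded_asymp \<kappa>"
    "\<And>\<phi>. \<phi> \<in> carrier \<L> \<Longrightarrow> T \<phi> = (\<Sum>j\<in>UNIV. ultradiff (b j) (regular (H j)) \<phi>)"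
    using ultra_sumsE[OF assms] by blast
  have "\<forall>j. \<exists>g q. g \<in> almost \<kappa> \<and> continuous_on UNIV q \<and> bounded (range q) \<and> (q \<longlongrightarrow> 0) at_top \<and>
      H j = (\<lambda>t. g t + q t)"
    using H(1) unfolding bounded_asymp_iff by blast
  then obtain g q where gq: "\<And>j. g j \<in> almost \<kappa>" "\<And>j. continuous_on UNIV (q j)"
    "\<And>j. bounded (range (q j))" "\<And>j. (q j \<longlongrightarrow> 0) at_top" "\<And>j. H j = (\<lambda>t. g j t + q j t)" by metis
  define T1 where "T1 \<phi> = (\<Sum>j\<in>UNIV. ultradiff (b j) (regular (g j)) \<phi>)" for \<phi>
  define Q where "Q \<phi> = (\<Sum>j\<in>UNIV. ultradiff (b j) (regular (q j)) \<phi>)" for \<phi>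
  have "T1 \<in> B_almost \<kappa> \<S> \<L>"
    unfolding T1_def by (intro B_almost_sum ultradiff_regular_B_almost b gq) auto
  moreover have "Q \<in> B_plus0 \<S> \<L>"
    unfolding Q_def by (intro B_plus0_sum ultradiff_regular_B_plus0 b gq) auto
  moreover have "T \<phi> = T1 \<phi> + Q \<phi>" if "\<phi> \<in> carrier \<L>" for \<phi>
    unfolding H(2)[OF that] T1_def Q_def sum.distrib[symmetric] gq(5)
    by (intro sum.cong refl ultradiff_regular_add[OF b that] gq almost_continuous[OF gq(1)] almost_bounded[OF gq(1)])
  then have "eq_on_positive \<S> T (\<lambda>\<phi>. T1 \<phi> + Q \<phi>)"
    using S_subset by (auto simp: eq_on_positive_def positive_part_iff)
  ultimately show ?thesis using ultra_sums_dual(1)[OF assms] unfolding B_asymp_def by blast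
qed

lemma solvable_class_ultra_sums:
  assumes i0: "b i0 = delta_coeffs"
  shows "solvable_class \<S> \<L> (ultra_sums \<kappa> b :: ((real \<Rightarrow> complex) \<Rightarrow> 'e::complex_banach) set)"
proof unfold_locales
  fix T U :: "(real \<Rightarrow> complex) \<Rightarrow> 'e" and \<Lambda> :: "'e \<Rightarrow> 'e" and \<mu> c
  assume T: "T \<in> ultra_sums \<kappa> b"
  then obtain H where H: "\<And>j. H j \<in> bounded_asymp \<kappa>"
    "\<And>\<phi>. \<phi> \<in> carrier \<L> \<Longrightarrow> T \<phi> = (\<Sum>j\<in>UNIV. ultradiff (b j) (regular (H j)) \<phi>)"
    using ultra_sumsE[OF T] by blast
  note Hb = bounded_asympD[OF H(1)]
  show "linear_functional (carrier \<S>) T" using ultra_sums_dual(2)[OF T] by (simp add: dual_iff)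
  {
    assume U: "U \<in> ultra_sums \<kappa> b"
    obtain G where G: "\<And>j. G j \<in> bounded_asymp \<kappa>"
      "\<And>\<phi>. \<phi> \<in> carrier \<L> \<Longrightarrow> U \<phi> = (\<Sum>j\<in>UNIV. ultradiff (b j) (regular (G j)) \<phi>)"
      using ultra_sumsE[OF U] by blast
    show "(\<lambda>\<phi>. T \<phi> + U \<phi>) \<in> ultra_sums \<kappa> b"
    proof (rule ultra_sumsI)
      show "(\<lambda>t. H j t + G j t) \<in> bounded_asymp \<kappa>" for j by (rule bounded_asymp_add[OF H(1) G(1)])
      show "T \<phi> + U \<phi> = (\<Sum>j\<in>UNIV. ultradiff (b j) (regular (\<lambda>t. H j t + G j t)) \<phi>)"
        if "\<phi> \<in> carrier \<L>" for \<phi>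
        unfolding H(2)[OF that] G(2)[OF that] sum.distrib[symmetric]
        by (intro sum.cong refl ultradiff_regular_add[OF b that, symmetric] Hb bounded_asympD[OF G(1)])
    qed
  }
  {
    assume \<Lambda>: "complex_linear \<Lambda>"
    show "(\<lambda>\<phi>. \<Lambda> (T \<phi>)) \<in> ultra_sums \<kappa> b"
    proof (rule ultra_sumsI)
      show "(\<lambda>t. \<Lambda> (H j t)) \<in> bounded_asymp \<kappa>" for j by (rule bounded_asymp_complex_linear[OF \<Lambda> H(1)])
      show "\<Lambda> (T \<phi>) = (\<Sum>j\<in>UNIV. ultradiff (b j) (regular (\<lambda>t. \<Lambda> (H j t))) \<phi>)"
        if "\<phi> \<in> carrier \<L>" for \<phi>
        unfolding H(2)[OF that] linear_sum[OF bounded_linear.linear[OF complex_linearD(1)[OF \<Lambda>]]]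
        by (intro sum.cong refl ultradiff_regular_complex_linear[OF b that _ _ \<Lambda>, symmetric] Hb)
    qed
  }
  {
    assume \<mu>: "Re \<mu> < 0"
    have "\<exists>v. bounded_solution \<mu> (H j) v \<and> v \<in> bounded_asymp \<kappa>" for j
      using bounded_asymp_solution[OF \<mu> H(1)] by metis
    then obtain V where V: "\<And>j. bounded_solution \<mu> (H j) (V j)" "\<And>j. V j \<in> bounded_asymp \<kappa>" by metis
    define W where "W \<phi> = (\<Sum>j\<in>UNIV. ultradiff (b j) (regular (V j)) \<phi>)" for \<phi>
    have "W \<in> ultra_sums \<kappa> b" by (rule ultra_sumsI[OF V(2)]) (simp add: W_def)
    moreover have "dist_deriv W \<phi> = \<mu> *\<^sub>C W \<phi> + T \<phi>"
      if \<phi>: "\<phi> \<in> positive_part \<S>" "nderiv 1 \<phi> \<in> carrier \<L>" for \<phi>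
    proof -
      have \<phi>S: "\<phi> \<in> carrier \<S>" using \<phi>(1) by (simp add: positive_part_iff)
      then have \<phi>L: "\<phi> \<in> carrier \<L>" using S_subset by blast
      have "dist_deriv W \<phi> = (\<Sum>j\<in>UNIV. dist_deriv (ultradiff (b j) (regular (V j))) \<phi>)"
        by (simp add: dist_deriv_def W_def sum_negf)
      also have "\<dots> = (\<Sum>j\<in>UNIV. \<mu> *\<^sub>C ultradiff (b j) (regular (V j)) \<phi> + ultradiff (b j) (regular (H j)) \<phi>)"
        by (intro sum.cong refl ultradiff_regular_solution[OF b \<phi>S \<phi>(2) V(1)] Hb)
      also have "\<dots> = \<mu> *\<^sub>C W \<phi> + T \<phi>"
        by (simp add: sum.distrib W_def H(2)[OF \<phi>L] scaleC.sum_right)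
      finally show ?thesis .
    qed
    ultimately show "\<exists>U\<in>ultra_sums \<kappa> b. \<forall>\<phi>\<in>positive_part \<S>.
      nderiv 1 \<phi> \<in> carrier \<L> \<longrightarrow> dist_deriv U \<phi> = \<mu> *\<^sub>C U \<phi> + T \<phi>" by blast
  }
next
  fix \<mu> and c :: 'e assume \<mu>: "Re \<mu> < 0"
  define H where "H j = (if j = i0 then half_exp \<mu> c else (\<lambda>t. 0))" for j
  have H: "H j \<in> bounded_asymp \<kappa>" for j
    by (simp add: H_def half_exp_bounded_asymp[OF \<mu>] zero_bounded_asymp)
  have zero: "ultradiff a (regular (\<lambda>t. 0 :: 'e)) \<phi> = 0" for a \<phi>
    by (simp add: ultradiff_eq regular_def scaleC.zero_right)
  have "regular (half_exp \<mu> c) \<phi> = (\<Sum>j\<in>UNIV. ultradiff (b j) (regular (H j)) \<phi>)" for \<phi>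
  proof -
    have "ultradiff (b j) (regular (H j)) \<phi> = (if j = i0 then regular (half_exp \<mu> c) \<phi> else 0)" for j
      by (simp add: H_def zero i0 ultradiff_delta)
    then show ?thesis by simp
  qed
  then have "regular (half_exp \<mu> c) \<in> ultra_sums \<kappa> b" by (rule ultra_sumsI[OF H])
  then show "\<exists>U\<in>ultra_sums \<kappa> b. \<forall>\<phi>\<in>positive_part \<S>. U \<phi> = regular (half_exp \<mu> c) \<phi>" by blast
qed

end

text \<open>The operator \<open>P i j\<close> can be taken independent of \<open>i\<close>: the matrix mixes components of the functions \<open>H j\<close>,
whose values are vectors, and leaves the operators alone.\<close>

lemma ultra_sums_ultra_form:
  fixes T :: "(real \<Rightarrow> complex) \<Rightarrow> 'a::complex_banach ^ 'n" and b :: "'n option \<Rightarrow> nat \<Rightarrow> complex"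
  assumes b: "\<And>j. ultradiff_coeffs s M (b j)" "b None = delta_coeffs"
    and T: "T \<in> ultra_sums \<kappa> b" and Y: "\<And>\<phi>. \<phi> \<in> carrier \<S> \<Longrightarrow> Y \<phi> = T \<phi>"
  shows "ultra_form \<kappa> s M Y"
proof -
  obtain H where H: "\<And>j. H j \<in> bounded_asymp \<kappa>"
    "\<And>\<phi>. \<phi> \<in> carrier \<L> \<Longrightarrow> T \<phi> = (\<Sum>j\<in>UNIV. ultradiff (b j) (regular (H j)) \<phi>)"
    using ultra_sumsE[OF T] by blast
  have comp: "(\<lambda>t. H j t $ i) \<in> bounded_asymp \<kappa>" for i j
    by (rule bounded_asymp_complex_linear[OF complex_linear_nth H(1)])
  have "Y \<phi> $ i = (\<Sum>j\<in>UNIV. ultradiff (b (Some j)) (regular (\<lambda>t. H (Some j) t $ i)) \<phi>)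
      + regular (\<lambda>t. H None t $ i) \<phi>" if \<phi>: "\<phi> \<in> carrier \<S>" for \<phi> i
  proof -
    have \<phi>L: "\<phi> \<in> carrier \<L>" using \<phi> S_subset by blast
    have "Y \<phi> $ i = (\<Sum>j\<in>UNIV. ultradiff (b j) (regular (H j)) \<phi> $ i)"
      by (simp add: Y[OF \<phi>] H(2)[OF \<phi>L])
    also have "\<dots> = (\<Sum>j\<in>UNIV. ultradiff (b j) (regular (\<lambda>t. H j t $ i)) \<phi>)"
      by (intro sum.cong refl ultradiff_regular_complex_linear[OF b(1) \<phi>L _ _ complex_linear_nth, symmetric]
          bounded_asympD[OF H(1)])
    also have "\<dots> = (\<Sum>j\<in>UNIV. ultradiff (b (Some j)) (regular (\<lambda>t. H (Some j) t $ i)) \<phi>)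
        + ultradiff (b None) (regular (\<lambda>t. H None t $ i)) \<phi>"
      by (simp add: UNIV_option_conv sum.reindex add.commute)
    finally show ?thesis by (simp add: b(2) ultradiff_delta)
  qed
  then show ?thesis
    unfolding ultra_form_def using b(1) comp
    by (intro exI[of _ "\<lambda>i j. b (Some j)"] exI[of _ "\<lambda>i j t. H (Some j) t $ i"]
        exI[of _ "\<lambda>i t. H None t $ i"]) (auto simp: bounded_asymp_def)
qed

text \<open>The functions \<open>f1 j\<close> are placed on the \<open>j\<close>-th axis. The component \<open>F\<^sub>i\<close> then contributes one operator and
one vector-valued function, and all functions without operator are collected in a single vector.\<close>

theorem ultradistribution_case:
  fixes A :: "complex ^ 'n ^ 'n" and F :: "(real \<Rightarrow> complex) \<Rightarrow> 'a::complex_banach ^ 'n"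
  assumes stable: "mat_spectrum A \<subseteq> {z. Re z < 0}"
    and F: "\<forall>i. \<exists>a f1 f2. ultradiff_coeffs s M a \<and>
           f1 \<in> asymp_almost \<kappa> \<and> bounded (range f1) \<and>
           f2 \<in> asymp_almost \<kappa> \<and> bounded (range f2) \<and>
           eq_on_positive \<S> (\<lambda>\<phi>. F \<phi> $ i) (\<lambda>\<phi>. ultradiff a (regular f1) \<phi> + regular f2 \<phi>)"
  shows "\<exists>Y\<in>B_asymp \<kappa> \<S> \<L>. solution \<S> A F Y \<and> ultra_form \<kappa> s M Y"
    and "solution \<S> A F Y \<Longrightarrow> \<exists>Z\<in>B_asymp \<kappa> \<S> \<L>. ultra_form \<kappa> s M Z \<and> eq_on_positive \<S> Y Z"
    and "solution \<S> A F Y \<Longrightarrow> Y \<in> dual \<L> \<Longrightarrow> Y \<in> B_asymp \<kappa> \<S> \<L>"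
proof -
  obtain a f1 f2 where a: "\<And>i. ultradiff_coeffs s M (a i)"
    and f: "\<And>i. f1 i \<in> bounded_asymp \<kappa>" "\<And>i. f2 i \<in> bounded_asymp \<kappa>"
    and Fi: "\<And>i. eq_on_positive \<S> (\<lambda>\<phi>. F \<phi> $ i) (\<lambda>\<phi>. ultradiff (a i) (regular (f1 i)) \<phi> + regular (f2 i) \<phi>)"
  proof -
    define P where "P i a f1 f2 \<longleftrightarrow> ultradiff_coeffs s M a \<and> f1 \<in> bounded_asymp \<kappa> \<and> f2 \<in> bounded_asymp \<kappa> \<and>
      eq_on_positive \<S> (\<lambda>\<phi>. F \<phi> $ i) (\<lambda>\<phi>. ultradiff a (regular f1) \<phi> + regular f2 \<phi>)" for i a f1 f2
    have "\<forall>i. \<exists>a f1 f2. P i a f1 f2"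
      using F unfolding P_def bounded_asymp_def mem_Collect_eq conj_assoc .
    then obtain a f1 f2 where "\<And>i. P i (a i) (f1 i) (f2 i)" by metis
    then show ?thesis using that unfolding P_def by blast
  qed
  define b where "b = case_option delta_coeffs a"
  have b: "ultradiff_coeffs s M (b j)" for j using a delta_coeffs_class by (cases j) (auto simp: b_def)
  have b_None: "b None = delta_coeffs" by (simp add: b_def)
  let ?\<C> = "ultra_sums \<kappa> b :: ((real \<Rightarrow> complex) \<Rightarrow> 'a ^ 'n) set"
  interpret C: solvable_class \<S> \<L> ?\<C> by (rule solvable_class_ultra_sums[where b = b, OF b b_None])
  define H :: "'n option \<Rightarrow> real \<Rightarrow> 'a ^ 'n" where
    "H = case_option (\<lambda>t. \<chi> i. f2 i t) (\<lambda>j t. axis j (f1 j t))"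
  have sum_axis: "(\<chi> i. f2 i t) = (\<Sum>i\<in>UNIV. axis i (f2 i t))" for t
    by (simp add: vec_eq_iff axis_def)
  have sum_asymp: "(\<lambda>t. \<Sum>i\<in>I. axis i (f2 i t)) \<in> bounded_asymp \<kappa>" for I :: "'n set"
  proof (induction I rule: infinite_finite_induct)
    case (insert i I)
    have "(\<lambda>t. axis i (f2 i t) + (\<Sum>i\<in>I. axis i (f2 i t))) \<in> bounded_asymp \<kappa>"
      by (rule bounded_asymp_add[OF bounded_asymp_complex_linear[OF complex_linear_axis f(2)] insert.IH])
    then show ?case using insert by simp
  qed (simp_all add: zero_bounded_asymp)
  have H: "H j \<in> bounded_asymp \<kappa>" for j
    using sum_asymp[of UNIV] bounded_asymp_complex_linear[OF complex_linear_axis f(1)]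
    by (cases j) (auto simp: H_def sum_axis)
  define T where "T \<phi> = (\<Sum>j\<in>UNIV. ultradiff (b j) (regular (H j)) \<phi>)" for \<phi>
  have T: "T \<in> ?\<C>" by (rule ultra_sumsI[OF H]) (simp add: T_def)
  have "F \<phi> = T \<phi>" if \<phi>: "\<phi> \<in> positive_part \<S>" for \<phi>
    unfolding vec_eq_iff
  proof
    fix i
    have \<phi>L: "\<phi> \<in> carrier \<L>" using \<phi> S_subset by (auto simp: positive_part_iff)
    have zero: "ultradiff c (regular (\<lambda>t. 0 :: 'a)) \<phi> = 0" for c
      by (simp add: ultradiff_eq regular_def scaleC.zero_right)
    have "T \<phi> $ i = (\<Sum>j\<in>UNIV. ultradiff (b j) (regular (H j)) \<phi> $ i)" by (simp add: T_def)
    also have "\<dots> = (\<Sum>j\<in>UNIV. ultradiff (b j) (regular (\<lambda>t. H j t $ i)) \<phi>)"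
      by (intro sum.cong refl ultradiff_regular_complex_linear[OF b \<phi>L _ _ complex_linear_nth, symmetric]
          bounded_asympD[OF H])
    also have "\<dots> = (\<Sum>j\<in>UNIV. ultradiff (a j) (regular (\<lambda>t. axis j (f1 j t) $ i)) \<phi>) + regular (f2 i) \<phi>"
      by (simp add: UNIV_option_conv sum.reindex add.commute b_def H_def ultradiff_delta)
    also have "(\<Sum>j\<in>UNIV. ultradiff (a j) (regular (\<lambda>t. axis j (f1 j t) $ i)) \<phi>)
        = (\<Sum>j\<in>UNIV. if j = i then ultradiff (a i) (regular (f1 i)) \<phi> else 0)"
      by (rule sum.cong) (auto simp: axis_def zero)
    also have "\<dots> = ultradiff (a i) (regular (f1 i)) \<phi>" by simp
    also have "\<dots> + regular (f2 i) \<phi> = F \<phi> $ i" using Fi[of i] \<phi> by (simp add: eq_on_positive_def)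
    finally show "F \<phi> $ i = T \<phi> $ i" by simp
  qed
  then have inF: "C.in_class F" unfolding C.in_class_def eq_on_positive_def using T by blast
  obtain \<mu>s where \<mu>s: "\<And>\<mu>. \<mu> \<in> set \<mu>s \<Longrightarrow> Re \<mu> < 0"
    "\<And>y :: 'a ^ 'n. shift_prod (mat_act A) \<mu>s y = 0"
    using stable_matrix_annihilated[OF stable] by blast
  have sub: "?\<C> \<subseteq> B_asymp \<kappa> \<S> \<L>" "?\<C> \<subseteq> dual \<L>" "?\<C> \<subseteq> dual \<S>"
    using ultra_sums_B_asymp[where b = b, OF b] ultra_sums_dual[where b = b, OF b] by auto
  note * = C.stable_system_solutions[OF complex_linear_mat_act \<mu>s inF function_space_L sub(2,3,1)]
  note form = ultra_sums_ultra_form[where b = b, OF b b_None]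
  show "\<exists>Y\<in>B_asymp \<kappa> \<S> \<L>. solution \<S> A F Y \<and> ultra_form \<kappa> s M Y"
    using *(1) form unfolding solution_def by blast
  show "\<exists>Z\<in>B_asymp \<kappa> \<S> \<L>. ultra_form \<kappa> s M Z \<and> eq_on_positive \<S> Y Z"
    if "solution \<S> A F Y"
  proof -
    obtain Z where "Z \<in> ?\<C>" "eq_on_positive \<S> Y Z"
      using *(2) \<open>solution \<S> A F Y\<close> unfolding solution_def by blast
    then show ?thesis using sub(1) form[of Z \<kappa> Z] by blast
  qed
  show "Y \<in> B_asymp \<kappa> \<S> \<L>"
    if "solution \<S> A F Y" "Y \<in> dual \<L>" using *(3) that unfolding solution_def by blast
qed

end

theorem theorem4p1:
  fixes A :: "complex ^ 'n ^ 'n" and \<kappa> :: almost_kind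
  assumes nontrivial: "\<exists>x :: 'a::complex_banach. x \<noteq> 0"
    and stable: "mat_spectrum A \<subseteq> {z. Re z < 0}"
  shows
    "(\<forall>F :: (real \<Rightarrow> complex) \<Rightarrow> 'a ^ 'n. F \<in> B_asymp \<kappa> test_space DL1_space \<longrightarrow>
        (\<exists>Y\<in>B_asymp \<kappa> test_space DL1_space. solution test_space A F Y) \<and>
        (\<forall>Y. solution test_space A F Y \<longrightarrow>
           (\<exists>Z\<in>B_asymp \<kappa> test_space DL1_space. eq_on_positive test_space Y Z) \<and>
           (Y \<in> dual DL1_space \<longrightarrow> Y \<in> B_asymp \<kappa> test_space DL1_space)))
   \<and>
     (\<forall>(M :: nat \<Rightarrow> real) s (F :: (real \<Rightarrow> complex) \<Rightarrow> 'a ^ 'n).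
        (\<forall>p. 0 < M p) \<and> M 0 = 1 \<and> cond_M1 M \<and> cond_M2 M \<and> cond_M3' M \<and>
        F \<in> dual (ultra_DL1_space s M) \<and>
        (\<forall>i. \<exists>a f1 f2. ultradiff_coeffs s M a \<and>
           f1 \<in> asymp_almost \<kappa> \<and> bounded (range f1) \<and>
           f2 \<in> asymp_almost \<kappa> \<and> bounded (range f2) \<and>
           eq_on_positive (ultra_test_space s M) (\<lambda>\<phi>. F \<phi> $ i)
             (\<lambda>\<phi>. ultradiff a (regular f1) \<phi> + regular f2 \<phi>)) \<longrightarrow>
        (\<exists>Y\<in>B_asymp \<kappa> (ultra_test_space s M) (ultra_DL1_space s M).
           solution (ultra_test_space s M) A F Y \<and> ultra_form \<kappa> s M Y) \<and>
        (\<forall>Y. solution (ultra_test_space s M) A F Y \<longrightarrow>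
           (\<exists>Z\<in>B_asymp \<kappa> (ultra_test_space s M) (ultra_DL1_space s M).
              ultra_form \<kappa> s M Z \<and> eq_on_positive (ultra_test_space s M) Y Z) \<and>
           (Y \<in> dual (ultra_DL1_space s M) \<longrightarrow>
              Y \<in> B_asymp \<kappa> (ultra_test_space s M) (ultra_DL1_space s M))))"
proof (intro conjI allI impI, goal_cases)
  case (1 F)
  then show ?case by (rule distribution_case(1)[OF stable])
next
  case (2 F Y)
  show ?case by (rule distribution_case(2)[OF stable 2])
next
  case (3 F Y)
  show ?case by (rule distribution_case(3)[OF stable 3])
next
  case (4 M s F)
  note hyp = 4[THEN conjunct2, THEN conjunct2, THEN conjunct2, THEN conjunct2, THEN conjunct2, THEN conjunct2]
  from 4 interpret ultra_weight M s by unfold_locales blast+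
  show ?case by (rule ultradistribution_case(1)[OF stable hyp])
next
  case (5 M s F Y)
  note hyp = 5(1)[THEN conjunct2, THEN conjunct2, THEN conjunct2, THEN conjunct2, THEN conjunct2, THEN conjunct2]
  from 5 interpret ultra_weight M s by unfold_locales blast+
  show ?case by (rule ultradistribution_case(2)[OF stable hyp 5(2)])
next
  case (6 M s F Y)
  note hyp = 6(1)[THEN conjunct2, THEN conjunct2, THEN conjunct2, THEN conjunct2, THEN conjunct2, THEN conjunct2]
  from 6 interpret ultra_weight M s by unfold_locales blast+
  show ?case by (rule ultradistribution_case(3)[OF stable hyp 6(2,3)])
qed

end
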